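(* Let $\Omega$ be a Hausdorff topological space with Borel $\sigma$-field $\mathfrak{B}$, let $\Theta$ be the set of all measures $\mu$ on $(\Omega,\mathfrak{B})$ with $\mu(\Omega)<\infty$, and let $\Theta_0,\Theta_1\subset\Theta$. Let $\kappa_1,\kappa_2,\ldots$ be independent realizations of a Poisson random process on $\Omega$ with mean measure $\mu\in\Theta$; the data for sample size $n$ are $\kappa_1,\ldots,\kappa_n$. Consider $H_0:\mu\in\Theta_0$ versus $H_1:\mu\in\Theta_1$. Write $\mathrm{cl}_c$ for closure in the weak topology on $\Theta$. (a) Let $\Omega$ be Polish. (i) If $\Theta_0$ and $\Theta_1$ are relatively compact in the $\tau$-topology and $\mathrm{cl}_c(\Theta_0)\cap\mathrm{cl}_c(\Theta_1)\neq\emptyset$, then $H_0$ and $H_1$ are indistinguishable. (ii) If $\Theta_0$ or $\Theta_1$ is relatively compact in the weak topology and $\mathrm{cl}_c(\Theta_0)\cap\mathrm{cl}_c(\Theta_1)=\emptyset$, then $H_0$ and $H_1$ are distinguishable, and there exist tests $K_n$ and constants $c>0$, $n_0$ such that $\alpha(K_n)\le\exp\{-cn\}$ and $\beta(K_n)\le\exp\{-cn\}$ for all $n>n_0$. (b) Let $\Omega$ be Polish. If $\Theta_0$ or $\Theta_1$ is relatively compact in the weak topology and $\mathrm{cl}_c(\Theta_0)\cap\mathrm{cl}_c(\Theta_1)=\emptyset$, then there exist open sets $B_1,\ldots,B_k\subset\Omega$ such that the closures in $\mathbb{R}^k$ of $\{(\mu(B_1),\ldots,\mu(B_k)):\mu\in\Theta_0\}$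 and $\{(\mu(B_1),\ldots,\mu(B_k)):\mu\in\Theta_1\}$ have no common points. (c) Let $\Omega$ be Hausdorff. If $H_0$ and $H_1$ are distinguishable, then they are uniformly discernible, and there exist a sequence of tests $K_n$ uniformly discerning $H_0$ and $H_1$, with associated random variable $N$, and constants $t>0$, $C<\infty$ such that $\sup_{\mu\in\Theta_0\cup\Theta_1}E_\mu[\exp\{tN\}]<C<\infty$. (d) Let $\Omega$ be Polish. If $\Theta_0$ is relatively compact in the weak topology, then $\Theta_0$ is uniformly asymptotically discernible: there are sets $\Theta_k\subset\Theta$, $k=1,2,\ldots$, with $\Theta_k\subseteq\Theta_{k+1}$ and $\bigcup_{k=1}^\infty\Theta_k\cup\mathrm{cl}_c(\Theta_0)=\Theta$, and a sequence of tests $K_n$ which, for every $k=1,2,\ldots$, uniformly discerns the hypothesis $\mu\in\Theta_0$ and the alternative $\mu\in\Theta_k$.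
   Context: The weak topology on $\Theta$ is generated by the maps $\mu\mapsto\int_\Omega f\,d\mu$, $f$ bounded continuous. The $\tau$-topology on $\Theta$ is the coarsest topology for which all maps $\mu\mapsto\mu(B)$, $B\in\mathfrak{B}$, are continuous. A set is relatively compact in a topology if its closure in $\Theta$ is compact. A test is a measurable function $K_n=K_n(\kappa_1,\ldots,\kappa_n)$ with values in $[0,1]$; $\alpha(K_n)=\sup_{\mu\in\Theta_0}E_\mu[K_n]$ and $\beta(K_n)=\sup_{\mu\in\Theta_1}E_\mu[1-K_n]$, where $P_\mu,E_\mu$ refer to independent Poisson processes with mean measure $\mu$. $H_0$ and $H_1$ are distinguishable if for every $0<\alpha<1$ there are tests $K_n$ with $\alpha(K_n)<\alpha$ and $\lim_{n\to\infty}\beta(K_n)=0$. They are indistinguishable if $\alpha(K_n)+\beta(K_n)\ge1$ for every $n$ and every test $K_n$. For sets $\Theta_0,\Theta_1'\subset\Theta$, a sequence of tests $K_n$ uniformly discerns the hypothesis $\mu\in\Theta_0$ and the alternative $\mu\in\Theta_1'$ if there is a positive random variable $N$ (a function of $\kappa_1,\kappa_2,\ldots$, which may depend on the pair of sets; called the associated random variable) with $\lim_{C\to\infty}\sup_{\mu\in\Theta_0\cup\Theta_1'}P_\mu(N>C)=0$ such that $P_\mu(K_n=0\text{ for all }n>N)=1$ for all $\mu\in\Theta_0$ and $P_\mu(K_n=1\text{ for all }n>N)=1$ for all $\mu\in\Theta_1'$. The hypothesis and alternative are uniformly discernible if such a sequence of tests exists. *)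

theory Defs
  imports "HOL-Probability.Probability"
begin

definition Polish_topology :: "'a topology \<Rightarrow> bool" where
  "Polish_topology X \<longleftrightarrow> completely_metrizable_space X \<and> separable_space X"


section \<open>Finite Borel measures and their topologies\<close>

definition finite_measures :: "'a::topological_space measure set" where
  "finite_measures = {\<mu>. sets \<mu> = sets borel \<and> finite_measure \<mu>}"

text \<open>The coarsest topology on \<open>A\<close> that makes all the real functions in \<open>F\<close> continuous.\<close>

definition initial_topology :: "'b set \<Rightarrow> ('b \<Rightarrow> real) set \<Rightarrow> 'b topology" where
  "initial_topology A F =
     topology_generated_by (insert A {{x \<in> A. f x \<in> U} | f U. f \<in> F \<and> open U})"

lemma topspace_initial_topology [simp]: "topspace (initial_topology A F) = A"
  by (auto simp: initial_topology_def)

definition weak_topology :: "'a::topological_space measure topology" where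
  "weak_topology = initial_topology finite_measures
     {\<lambda>\<mu>. \<integral>x. f x \<partial>\<mu> | f. continuous_on UNIV f \<and> bounded (range f)}"

definition tau_topology :: "'a::topological_space measure topology" where
  "tau_topology = initial_topology finite_measures {\<lambda>\<mu>. measure \<mu> B | B. B \<in> sets borel}"

definition relatively_compact_in :: "'b topology \<Rightarrow> 'b set \<Rightarrow> bool" where
  "relatively_compact_in T A \<longleftrightarrow> compactin T (T closure_of A)"


section \<open>Poisson processes\<close>

text \<open>
  A realization of a point process with finitely many points (counted with multiplicity) is
  encoded as its counting measure, a finite Borel measure with values in the natural numbers.
  As for \<^const>\<open>subprob_algebra\<close>, the \<open>\<sigma>\<close>-field on the set of realizations is
  the one generated by the evaluations \<open>\<nu> \<mapsto> \<nu>(B)\<close> at the Borel sets \<open>B\<close>.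
\<close>

definition counting_measures :: "'a::topological_space measure set" where
  "counting_measures = {\<nu> \<in> finite_measures. \<forall>B\<in>sets borel. measure \<nu> B \<in> \<nat>}"

definition config_space :: "'a::topological_space measure measure" where
  "config_space =
     (SUP B \<in> sets borel. vimage_algebra counting_measures (\<lambda>\<nu>. emeasure \<nu> B) borel)"

lemma space_config_space: "space config_space = counting_measures"
  by (auto simp: config_space_def space_Sup_eq_UN)

text \<open>
  The Poisson probabilities are written out because \<^const>\<open>poisson_pmf\<close> is specified only for
  positive rates, whereas here \<open>\<mu>(B) = 0\<close> is possible (and then gives the count \<open>0\<close> almost surely,
  as \<open>0 ^ 0 = 1\<close>).
\<close>

definition poisson_process ::
    "'s measure \<Rightarrow> ('s \<Rightarrow> 'a::topological_space measure) \<Rightarrow> 'a measure \<Rightarrow> bool" where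
  "poisson_process P \<xi> \<mu> \<longleftrightarrow>
     \<xi> \<in> measurable P config_space \<and>
     (\<forall>B\<in>sets borel. \<forall>k::nat.
        measure P {s \<in> space P. measure (\<xi> s) B = real k}
          = measure \<mu> B ^ k / fact k * exp (- measure \<mu> B)) \<and>
     (\<forall>(B :: nat \<Rightarrow> 'a set) m.
        (\<forall>i<m. B i \<in> sets borel) \<and> disjoint_family_on B {..<m} \<longrightarrow>
        prob_space.indep_vars P (\<lambda>_. borel) (\<lambda>i s. measure (\<xi> s) (B i)) {..<m})"

text \<open>
  A sampling model consists of the probability measures \<open>Pr \<mu>\<close> (written \<open>P\<^sub>\<mu>\<close> on paper), one for
  each finite measure \<open>\<mu>\<close>, and of the observations \<open>\<kappa> 0, \<kappa> 1, \<dots>\<close>, which are independent Poisson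
  processes with mean measure \<open>\<mu>\<close> under \<open>Pr \<mu>\<close>. Observations are numbered from \<open>0\<close>, so the
  data for sample size \<open>n\<close> are \<open>\<kappa> 0, \<dots>, \<kappa> (n - 1)\<close>.
\<close>

definition poisson_sampling ::
    "('a::topological_space measure \<Rightarrow> 's measure) \<Rightarrow> (nat \<Rightarrow> 's \<Rightarrow> 'a measure) \<Rightarrow> bool" where
  "poisson_sampling Pr \<kappa> \<longleftrightarrow>
     (\<forall>\<mu>\<in>finite_measures.
        prob_space (Pr \<mu>) \<and>
        prob_space.indep_vars (Pr \<mu>) (\<lambda>_. config_space) \<kappa> UNIV \<and>
        (\<forall>i. poisson_process (Pr \<mu>) (\<kappa> i) \<mu>))"

definition sample :: "(nat \<Rightarrow> 's \<Rightarrow> 'a measure) \<Rightarrow> nat \<Rightarrow> 's \<Rightarrow> (nat \<Rightarrow> 'a measure)" where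
  "sample \<kappa> n s = (\<lambda>i\<in>{..<n}. \<kappa> i s)"

definition sample_path :: "(nat \<Rightarrow> 's \<Rightarrow> 'a measure) \<Rightarrow> 's \<Rightarrow> (nat \<Rightarrow> 'a measure)" where
  "sample_path \<kappa> s = (\<lambda>i. \<kappa> i s)"


section \<open>Tests\<close>

definition is_test :: "nat \<Rightarrow> ((nat \<Rightarrow> 'a::topological_space measure) \<Rightarrow> real) \<Rightarrow> bool" where
  "is_test n K \<longleftrightarrow>
     K \<in> borel_measurable (Pi\<^sub>M {..<n} (\<lambda>_. config_space)) \<and>
     (\<forall>x\<in>space (Pi\<^sub>M {..<n} (\<lambda>_. config_space)). 0 \<le> K x \<and> K x \<le> 1)"

text \<open>
  Error probabilities are extended nonnegative reals, so that the supremum over an empty set of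
  measures is \<open>0\<close>.
\<close>

definition test_alpha ::
    "('a measure \<Rightarrow> 's measure) \<Rightarrow> (nat \<Rightarrow> 's \<Rightarrow> 'a measure) \<Rightarrow> 'a measure set \<Rightarrow>
     nat \<Rightarrow> ((nat \<Rightarrow> 'a measure) \<Rightarrow> real) \<Rightarrow> ennreal" where
  "test_alpha Pr \<kappa> \<Theta>0 n K = (SUP \<mu>\<in>\<Theta>0. \<integral>\<^sup>+s. ennreal (K (sample \<kappa> n s)) \<partial>Pr \<mu>)"

definition test_beta ::
    "('a measure \<Rightarrow> 's measure) \<Rightarrow> (nat \<Rightarrow> 's \<Rightarrow> 'a measure) \<Rightarrow> 'a measure set \<Rightarrow>
     nat \<Rightarrow> ((nat \<Rightarrow> 'a measure) \<Rightarrow> real) \<Rightarrow> ennreal" where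
  "test_beta Pr \<kappa> \<Theta>1 n K = (SUP \<mu>\<in>\<Theta>1. \<integral>\<^sup>+s. ennreal (1 - K (sample \<kappa> n s)) \<partial>Pr \<mu>)"

definition distinguishable ::
    "('a::topological_space measure \<Rightarrow> 's measure) \<Rightarrow> (nat \<Rightarrow> 's \<Rightarrow> 'a measure) \<Rightarrow>
     'a measure set \<Rightarrow> 'a measure set \<Rightarrow> bool" where
  "distinguishable Pr \<kappa> \<Theta>0 \<Theta>1 \<longleftrightarrow>
     (\<forall>a::real. 0 < a \<and> a < 1 \<longrightarrow>
        (\<exists>K. (\<forall>n. is_test n (K n) \<and> test_alpha Pr \<kappa> \<Theta>0 n (K n) < ennreal a) \<and>
             (\<lambda>n. test_beta Pr \<kappa> \<Theta>1 n (K n)) \<longlonglongrightarrow> 0))"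

definition indistinguishable ::
    "('a::topological_space measure \<Rightarrow> 's measure) \<Rightarrow> (nat \<Rightarrow> 's \<Rightarrow> 'a measure) \<Rightarrow>
     'a measure set \<Rightarrow> 'a measure set \<Rightarrow> bool" where
  "indistinguishable Pr \<kappa> \<Theta>0 \<Theta>1 \<longleftrightarrow>
     (\<forall>n K. is_test n K \<longrightarrow> test_alpha Pr \<kappa> \<Theta>0 n K + test_beta Pr \<kappa> \<Theta>1 n K \<ge> 1)"


section \<open>Discernibility\<close>

text \<open>\<open>N\<close> is the associated random variable, a function of the whole sequence of observations.\<close>

definition uniformly_discerns_with ::
    "('a::topological_space measure \<Rightarrow> 's measure) \<Rightarrow> (nat \<Rightarrow> 's \<Rightarrow> 'a measure) \<Rightarrow>
     (nat \<Rightarrow> (nat \<Rightarrow> 'a measure) \<Rightarrow> real) \<Rightarrow> ((nat \<Rightarrow> 'a measure) \<Rightarrow> real) \<Rightarrow>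
     'a measure set \<Rightarrow> 'a measure set \<Rightarrow> bool" where
  "uniformly_discerns_with Pr \<kappa> K N \<Theta>0 \<Theta>1 \<longleftrightarrow>
     (\<forall>n. is_test n (K n)) \<and>
     N \<in> borel_measurable (Pi\<^sub>M UNIV (\<lambda>_. config_space)) \<and>
     (\<forall>x\<in>space (Pi\<^sub>M UNIV (\<lambda>_. config_space)). 0 < N x) \<and>
     ((\<lambda>C::real. SUP \<mu>\<in>\<Theta>0 \<union> \<Theta>1. emeasure (Pr \<mu>) {s \<in> space (Pr \<mu>). N (sample_path \<kappa> s) > C})
        \<longlongrightarrow> 0) at_top \<and>
     (\<forall>\<mu>\<in>\<Theta>0. AE s in Pr \<mu>. \<forall>n. real n > N (sample_path \<kappa> s) \<longrightarrow> K n (sample \<kappa> n s) = 0) \<and>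
     (\<forall>\<mu>\<in>\<Theta>1. AE s in Pr \<mu>. \<forall>n. real n > N (sample_path \<kappa> s) \<longrightarrow> K n (sample \<kappa> n s) = 1)"

definition uniformly_discerns ::
    "('a::topological_space measure \<Rightarrow> 's measure) \<Rightarrow> (nat \<Rightarrow> 's \<Rightarrow> 'a measure) \<Rightarrow>
     (nat \<Rightarrow> (nat \<Rightarrow> 'a measure) \<Rightarrow> real) \<Rightarrow> 'a measure set \<Rightarrow> 'a measure set \<Rightarrow> bool" where
  "uniformly_discerns Pr \<kappa> K \<Theta>0 \<Theta>1 \<longleftrightarrow> (\<exists>N. uniformly_discerns_with Pr \<kappa> K N \<Theta>0 \<Theta>1)"

definition uniformly_discernible ::
    "('a::topological_space measure \<Rightarrow> 's measure) \<Rightarrow> (nat \<Rightarrow> 's \<Rightarrow> 'a measure) \<Rightarrow>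
     'a measure set \<Rightarrow> 'a measure set \<Rightarrow> bool" where
  "uniformly_discernible Pr \<kappa> \<Theta>0 \<Theta>1 \<longleftrightarrow> (\<exists>K. uniformly_discerns Pr \<kappa> K \<Theta>0 \<Theta>1)"

definition uniformly_asymptotically_discernible ::
    "('a::topological_space measure \<Rightarrow> 's measure) \<Rightarrow> (nat \<Rightarrow> 's \<Rightarrow> 'a measure) \<Rightarrow>
     'a measure set \<Rightarrow> bool" where
  "uniformly_asymptotically_discernible Pr \<kappa> \<Theta>0 \<longleftrightarrow>
     (\<exists>\<Phi> K.
        (\<forall>k\<ge>1. \<Phi> k \<subseteq> finite_measures) \<and>
        (\<forall>k\<ge>1. \<Phi> k \<subseteq> \<Phi> (Suc k)) \<and>
        (\<Union>k\<in>{1..}. \<Phi> k) \<union> weak_topology closure_of \<Theta>0 = finite_measures \<and>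
        (\<forall>k\<ge>1. uniformly_discerns Pr \<kappa> K \<Theta>0 (\<Phi> k)))"


section \<open>Vectors of measures of sets\<close>

text \<open>
  \<^term>\<open>Euclidean_space k\<close> realizes \<open>\<real>\<^sup>k\<close> as the sequences that vanish from index \<open>k\<close> on.
\<close>

definition measure_vector :: "nat \<Rightarrow> (nat \<Rightarrow> 'a set) \<Rightarrow> 'a measure \<Rightarrow> (nat \<Rightarrow> real)" where
  "measure_vector k B \<mu> = (\<lambda>i. if i < k then measure \<mu> (B i) else 0)"

end

theory Submission
  imports Defs
begin

text \<open>
  Two families of mean measures are compared through \<open>n\<close> independent Poisson samples. The
  positive and the negative assertions have separate reasons.

  \<^bold>\<open>Separation.\<close> A weak neighbourhood of a finite measure \<open>\<mu>\<close> is controlled by the measures of finitely many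
  open sets: the integral of a continuous function with values in \<open>[0, 1]\<close> is a limit of averages of \<open>\<nu>{f > t}\<close> over
  levels \<open>t\<close>, the levels can be chosen \<open>\<mu>\<close>-null, and then \<open>\<nu> \<mapsto> \<nu>{f > t}\<close> is weakly continuous
  at \<open>\<mu>\<close>. If one family has a compact closure that is disjoint from the closure of the other, finitely
  many such neighbourhoods separate the families with a margin (\<open>compact_separation_by_open_sets\<close>). This is the
  assertion on vectors of measures of open sets. It also gives tests: the count of a set \<open>B\<close> is a
  Poisson variable with mean \<open>\<mu>(B)\<close>, hence by Chernoff's bound the empirical mean of the counts leaves the margin with
  exponentially small probability (\<open>sample_mean_discriminates\<close>, \<open>compact_imp_exponentially_separable\<close>).

  \<^bold>\<open>Discernibility.\<close> If two families are distinguishable, some test for a fixed sample size \<open>m\<close> has both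
  errors below \<open>1/8\<close>. A majority vote over disjoint blocks of \<open>m\<close> observations turns it into nonrandomized tests with
  exponentially small errors (\<open>amplify_test\<close>). Such tests almost surely make finitely many errors, and the index
  from which the decisions no longer change has a uniformly small tail (\<open>stabilization\<close>). For a relatively compact
  \<open>\<Theta>0\<close> in a Polish space, countably many functions determine a finite measure. The measures that
  are separated by the first \<open>k\<close> of them with gap \<open>1/(k+1)\<close> from every point of the closure of \<open>\<Theta>0\<close> form alternatives that
  increase to the complement of the closure, and a diagonal sequence of tests serves all of them
  (\<open>diagonal_tests\<close>, \<open>compact_asymptotically_discernible\<close>).

  \<^bold>\<open>Indistinguishability.\<close> A \<open>\<tau>\<close>-compact set of measures is weakly closed, so the common weak limit point \<open>\<mu>\<close> is a
  common \<open>\<tau>\<close>-limit point (\<open>weak_closure_in_tau_compact\<close>). By Dini's theorem a \<open>\<tau>\<close>-compact set is uniformly dominated, up to small errors,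
  by one finite measure \<open>\<nu>\<close>. This passes to the laws of the samples, first for events that depend on finitely many counts, where
  the Poisson weights can be compared, and then for all events by approximation
  (\<open>cylinder_law_dominated\<close>, \<open>tau_compact_law_dominated\<close>). Consequently the power of every fixed test is lower semicontinuous
  along the compact set, and the errors over the two families are at least those at \<open>\<mu>\<close>, which add up to \<open>1\<close>.
\<close>

section \<open>Initial topologies and staircase approximation\<close>

lemma finite_measuresD:
  assumes "\<mu> \<in> finite_measures"
  shows "sets \<mu> = sets borel" "space \<mu> = UNIV" "finite_measure \<mu>"
  using assms sets_eq_imp_space_eq[of \<mu> borel] by (auto simp: finite_measures_def)

text \<open>
  The sets in the conclusion are the finite intersections of subbasic sets, centred at \<open>x\<close>. A
  common radius \<open>e\<close> suffices because only finitely many functions occur.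
\<close>

lemma initial_topology_neighbourhood:
  assumes "openin (initial_topology A F) W" "x \<in> W"
  shows "\<exists>G e. finite G \<and> G \<subseteq> F \<and> e > 0 \<and> (\<forall>y\<in>A. (\<forall>f\<in>G. \<bar>f y - f x\<bar> < e) \<longrightarrow> y \<in> W)"
proof -
  have "generate_topology_on (insert A {{x \<in> A. f x \<in> U} | f U. f \<in> F \<and> open U}) W"
    using assms(1) by (simp add: initial_topology_def openin_topology_generated_by)
  then show ?thesis
    using assms(2)
  proof (induction rule: generate_topology_on.induct)
    case Empty
    then show ?case by simp
  next
    case (Int a b)
    then obtain G1 e1 G2 e2 where
      "finite G1" "G1 \<subseteq> F" "e1 > 0" "\<forall>y\<in>A. (\<forall>f\<in>G1. \<bar>f y - f x\<bar> < e1) \<longrightarrow> y \<in> a"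
      "finite G2" "G2 \<subseteq> F" "e2 > 0" "\<forall>y\<in>A. (\<forall>f\<in>G2. \<bar>f y - f x\<bar> < e2) \<longrightarrow> y \<in> b"
      by blast
    then show ?case
      by (intro exI[of _ "G1 \<union> G2"] exI[of _ "min e1 e2"]) auto
  next
    case (UN K)
    then obtain k where "k \<in> K" "x \<in> k" by blast
    with UN.IH[OF this] show ?case by blast
  next
    case (Basis s)
    then consider "s = A" | f U where "f \<in> F" "open U" "s = {x \<in> A. f x \<in> U}"
      by blast
    then show ?case
    proof cases
      case 1
      then show ?thesis by (intro exI[of _ "{}"] exI[of _ 1]) auto
    next
      case 2
      with Basis have "f x \<in> U" by auto
      with \<open>open U\<close> obtain e where "e > 0" "ball (f x) e \<subseteq> U"
        using open_contains_ball by blast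
      with 2 show ?thesis
        by (intro exI[of _ "{f}"] exI[of _ e]) (auto simp: subset_eq dist_real_def abs_minus_commute)
    qed
  qed
qed

lemma continuous_map_initial_topology:
  assumes "f \<in> F"
  shows "continuous_map (initial_topology A F) euclideanreal f"
proof -
  have "openin (initial_topology A F) {x \<in> A. f x \<in> U}" if "open U" for U
    unfolding initial_topology_def using that assms
    by (intro topology_generated_by_Basis) auto
  then show ?thesis
    by (auto simp: continuous_map)
qed

lemma openin_close_value:
  assumes "continuous_map T euclideanreal f"
  shows "openin T {y \<in> topspace T. \<bar>f y - c\<bar> < e}"
proof -
  have "openin T {y \<in> topspace T. f y \<in> ball c e}"
    by (rule openin_continuous_map_preimage[OF assms]) auto
  then show ?thesis by (simp add: dist_real_def abs_minus_commute)
qed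

lemma topspace_weak_topology [simp]: "topspace weak_topology = finite_measures"
  and topspace_tau_topology [simp]: "topspace tau_topology = finite_measures"
  by (simp_all add: weak_topology_def tau_topology_def)

lemma weak_integral_continuous:
  assumes "continuous_on UNIV f" "bounded (range f)"
  shows "continuous_map weak_topology euclideanreal (\<lambda>\<mu>. \<integral>x. f x \<partial>\<mu>)"
  unfolding weak_topology_def using assms by (intro continuous_map_initial_topology) blast

lemma tau_measure_continuous:
  assumes "B \<in> sets borel"
  shows "continuous_map tau_topology euclideanreal (\<lambda>\<mu>. measure \<mu> B)"
  unfolding tau_topology_def using assms by (intro continuous_map_initial_topology) blast

text \<open>
  With one threshold in each interval \<open>[j/p, (j+1)/p)\<close>, the number of thresholds below \<open>y\<close> is the
  integer part of \<open>p * y\<close> or one more. The thresholds may move inside their intervals; this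
  freedom is used to avoid the levels that carry mass.
\<close>

lemma staircase_approximation:
  fixes y :: real and p :: nat
  assumes "p > 0" "0 \<le> y" "y \<le> 1"
    and t: "\<And>j. j < p \<Longrightarrow> real j / p \<le> t j \<and> t j < (real j + 1) / p"
  shows "\<bar>y - (\<Sum>j<p. indicat_real {t j<..} y) / p\<bar> \<le> 1 / p"
proof -
  define q where "q = nat \<lfloor>p * y\<rfloor>"
  define S where "S = {j. j < p \<and> t j < y}"
  have q: "real q \<le> p * y" "p * y < real q + 1"
    using assms by (auto simp: q_def)
  have "real q \<le> p"
    using q(1) mult_left_mono[OF \<open>y \<le> 1\<close>, of p] by simp
  have "{..<q} \<subseteq> S"
  proof
    fix j assume "j \<in> {..<q}"
    then have j: "j < p" "real j + 1 \<le> q" using \<open>real q \<le> p\<close> by auto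
    have "t j < (real j + 1) / p" using t j by auto
    also have "\<dots> \<le> real q / p" using j assms by (intro divide_right_mono) auto
    also have "\<dots> \<le> y" using q(1) assms by (simp add: field_simps)
    finally show "j \<in> S" using j by (simp add: S_def)
  qed
  moreover have "S \<subseteq> {..<q + 1}"
  proof
    fix j assume "j \<in> S"
    then have j: "j < p" "t j < y" by (auto simp: S_def)
    have "real j / p \<le> t j" using t j by auto
    also have "\<dots> < y" by (fact j)
    also have "\<dots> < (real q + 1) / p" using q(2) assms by (simp add: field_simps)
    finally have "real j < real q + 1"
      using assms(1) by (simp add: divide_less_cancel)
    then show "j \<in> {..<q + 1}" by simp
  qed
  ultimately have "q \<le> card S" "card S \<le> q + 1"
    using card_mono[of "{..<q+1}" S] card_mono[of S "{..<q}"] by (auto simp: S_def)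
  moreover have "(\<Sum>j<p. indicat_real {t j<..} y) = card S"
    by (simp add: S_def indicator_def sum.If_cases Int_def conj_commute)
  ultimately have "\<bar>p * y - (\<Sum>j<p. indicat_real {t j<..} y)\<bar> \<le> 1"
    using q by linarith
  then have "\<bar>p * y - (\<Sum>j<p. indicat_real {t j<..} y)\<bar> / p \<le> 1 / p"
    using assms by (intro divide_right_mono) auto
  moreover have "y - (\<Sum>j<p. indicat_real {t j<..} y) / p = (p * y - (\<Sum>j<p. indicat_real {t j<..} y)) / p"
    using assms(1) by (simp add: diff_divide_distrib)
  ultimately show ?thesis
    by (simp only: abs_divide abs_of_nat)
qed

text \<open>
  This trades an integral for finitely many measures of superlevel sets, with an error that
  depends on the total mass only. It serves three times: for weak neighbourhoods, for
  the \<open>\<tau>\<close>-continuity of integrals, and for randomized tests.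
\<close>

lemma integral_staircase:
  fixes f :: "'b \<Rightarrow> real"
  assumes "finite_measure M" "f \<in> borel_measurable M" "p > 0"
    and f: "\<And>x. x \<in> space M \<Longrightarrow> 0 \<le> f x \<and> f x \<le> 1"
    and t: "\<And>j. j < p \<Longrightarrow> real j / p \<le> t j \<and> t j < (real j + 1) / p"
  shows "\<bar>(\<integral>x. f x \<partial>M) - (\<Sum>j<p. measure M {x \<in> space M. t j < f x}) / p\<bar>
    \<le> measure M (space M) / p"
proof -
  interpret finite_measure M by fact
  note [measurable] = assms(2)
  let ?I = "\<lambda>j x. indicat_real {t j<..} (f x)"
  have int: "integrable M (?I j)" for j
    by (rule integrable_const_bound[of _ 1]) auto
  have intf: "integrable M f"
    using f by (intro integrable_const_bound[of _ 1]) auto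
  have "(\<integral>x. ?I j x \<partial>M) = measure M {x \<in> space M. t j < f x}" for j
  proof -
    have "(\<integral>x. ?I j x \<partial>M) = (\<integral>x. indicat_real {x \<in> space M. t j < f x} x \<partial>M)"
      by (rule Bochner_Integration.integral_cong) (auto simp: indicator_def)
    then show ?thesis
      by (simp add: Int_absorb1 subset_eq)
  qed
  then have "(\<integral>x. f x \<partial>M) - (\<Sum>j<p. measure M {x \<in> space M. t j < f x}) / p
      = (\<integral>x. f x - (\<Sum>j<p. ?I j x) / p \<partial>M)"
    using int intf by (simp add: Bochner_Integration.integral_sum)
  also have "\<bar>\<dots>\<bar> \<le> (\<integral>x. \<bar>f x - (\<Sum>j<p. ?I j x) / p\<bar> \<partial>M)"
    by (rule integral_abs_bound)
  also have "\<dots> \<le> (\<integral>x. 1 / p \<partial>M)"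
    using int intf f by (intro integral_mono staircase_approximation \<open>p > 0\<close> t) auto
  finally show ?thesis by simp
qed

text \<open>
  The continuous functions \<open>min 1 (m * g)\<close> increase to the indicator of the open set where \<open>g\<close> is
  positive. So integrals of continuous functions control measures of such open sets.
\<close>

lemma measure_positive_part_limit:
  assumes "finite_measure M" "g \<in> borel_measurable M" and g: "\<And>x. x \<in> space M \<Longrightarrow> 0 \<le> (g x :: real)"
  shows "(\<lambda>m. \<integral>x. min 1 (real m * g x) \<partial>M) \<longlonglongrightarrow> measure M {x \<in> space M. 0 < g x}"
proof -
  interpret finite_measure M by fact
  note [measurable] = assms(2)
  have "(\<lambda>m. \<integral>x. min 1 (real m * g x) \<partial>M) \<longlonglongrightarrow> (\<integral>x. indicat_real {x \<in> space M. 0 < g x} x \<partial>M)"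
  proof (rule integral_dominated_convergence[where w = "\<lambda>_. 1"])
    show "AE x in M. (\<lambda>m. min 1 (real m * g x)) \<longlonglongrightarrow> indicat_real {x \<in> space M. 0 < g x} x"
    proof (rule AE_I2)
      fix x assume x: "x \<in> space M"
      show "(\<lambda>m. min 1 (real m * g x)) \<longlonglongrightarrow> indicat_real {x \<in> space M. 0 < g x} x"
      proof (cases "0 < g x")
        case True
        then obtain k :: nat where k: "1 \<le> real k * g x"
          using reals_Archimedean3[of "g x"] less_imp_le by blast
        have "eventually (\<lambda>m. min 1 (real m * g x) = 1) sequentially"
          using eventually_ge_at_top[of k]
        proof eventually_elim
          case (elim m)
          then have "real k * g x \<le> real m * g x" using True by (intro mult_right_mono) auto
          with k show ?case by simp
        qed
        with True x show ?thesis by (simp add: tendsto_eventually)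
      next
        case False
        with g[OF x] x show ?thesis by simp
      qed
    qed
    show "AE x in M. norm (min 1 (real m * g x)) \<le> 1" for m
      using g by (intro AE_I2) (auto simp: min_def)
  qed auto
  then show ?thesis by (simp add: Int_absorb1 subset_eq)
qed

text \<open>
  The total mass is locally bounded, hence the staircase sums, which are \<open>\<tau>\<close>-continuous by
  definition, approximate the integral uniformly near each measure.
\<close>

lemma tau_integral_continuous:
  fixes f :: "'a::topological_space \<Rightarrow> real"
  assumes f: "f \<in> borel_measurable borel" "\<And>x. 0 \<le> f x \<and> f x \<le> 1"
  shows "continuous_map tau_topology euclideanreal (\<lambda>\<mu>. \<integral>x. f x \<partial>\<mu>)"
proof -
  have "\<exists>U. openin tau_topology U \<and> \<mu> \<in> U \<and> (\<forall>\<nu>\<in>U. \<bar>(\<integral>x. f x \<partial>\<nu>) - (\<integral>x. f x \<partial>\<mu>)\<bar> < e)"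
    if \<mu>: "\<mu> \<in> finite_measures" and "e > 0" for \<mu> :: "'a measure" and e :: real
  proof -
    define c where "c = measure \<mu> UNIV + 1"
    have "c > 0" by (simp add: c_def add_nonneg_pos)
    obtain p :: nat where p: "p > 4 * c / e" using reals_Archimedean2 by blast
    have "p > 0" using p \<open>c > 0\<close> \<open>e > 0\<close> by (metis divide_pos_pos gr0I less_asym mult_pos_pos of_nat_0 zero_less_numeral)
    define B where "B j = {x. real j / p < f x}" for j
    have B[measurable]: "B j \<in> sets borel" for j
      using f by (auto simp: B_def)
    define d where "d = e / 2"
    define U where "U = {\<nu> \<in> topspace tau_topology. \<bar>measure \<nu> UNIV - measure \<mu> UNIV\<bar> < 1} \<inter>
      {\<nu> \<in> topspace tau_topology. \<bar>(\<Sum>j<p. measure \<nu> (B j)) / p - (\<Sum>j<p. measure \<mu> (B j)) / p\<bar> < d}"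
    have "continuous_map tau_topology euclideanreal (\<lambda>\<nu>. (\<Sum>j<p. measure \<nu> (B j)) / p)"
      by (intro continuous_map_real_divide continuous_map_sum tau_measure_continuous B) (use \<open>p > 0\<close> in auto)
    then have "openin tau_topology U"
      unfolding U_def by (intro openin_Int openin_close_value tau_measure_continuous) auto
    moreover have "\<mu> \<in> U" using \<mu> \<open>e > 0\<close> by (simp add: U_def d_def)
    moreover have "\<bar>(\<integral>x. f x \<partial>\<nu>) - (\<integral>x. f x \<partial>\<mu>)\<bar> < e" if "\<nu> \<in> U" for \<nu>
    proof -
      have \<nu>: "\<nu> \<in> finite_measures" using that by (simp add: U_def)
      have approx: "\<bar>(\<integral>x. f x \<partial>\<rho>) - (\<Sum>j<p. measure \<rho> (B j)) / p\<bar> \<le> c / p"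
        if \<rho>: "\<rho> \<in> finite_measures" "measure \<rho> UNIV \<le> c" for \<rho>
      proof -
        have "f \<in> borel_measurable \<rho>"
          using f(1) measurable_cong_sets[OF finite_measuresD(1)[OF \<rho>(1)] refl] by blast
        from integral_staircase[OF finite_measuresD(3)[OF \<rho>(1)] this \<open>p > 0\<close>, of "\<lambda>j. real j / p"]
        have "\<bar>(\<integral>x. f x \<partial>\<rho>) - (\<Sum>j<p. measure \<rho> (B j)) / p\<bar> \<le> measure \<rho> UNIV / p"
          using f(2) \<open>p > 0\<close> finite_measuresD(2)[OF \<rho>(1)] by (auto simp: B_def divide_strict_right_mono)
        also have "\<dots> \<le> c / p" using \<rho> by (intro divide_right_mono) auto
        finally show ?thesis .
      qed
      have "c / p < e / 4" using p \<open>p > 0\<close> \<open>e > 0\<close> by (simp add: field_simps)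
      moreover have "measure \<nu> UNIV \<le> c" "measure \<mu> UNIV \<le> c" using that by (auto simp: U_def c_def)
      moreover have "\<bar>(\<Sum>j<p. measure \<nu> (B j)) / p - (\<Sum>j<p. measure \<mu> (B j)) / p\<bar> < e / 2"
        using that by (auto simp: U_def d_def)
      ultimately show ?thesis
        using approx[OF \<nu>] approx[OF \<mu>] by linarith
    qed
    ultimately show ?thesis by blast
  qed
  note ex = this
  show ?thesis
    unfolding continuous_map
  proof (intro conjI allI impI)
    fix V :: "real set" assume "openin euclideanreal V"
    then have "open V" by simp
    show "openin tau_topology {\<mu> \<in> topspace tau_topology. (\<integral>x. f x \<partial>\<mu>) \<in> V}"
    proof (subst openin_subopen, safe)
      fix \<mu> :: "'a measure" assume \<mu>: "\<mu> \<in> topspace tau_topology" "(\<integral>x. f x \<partial>\<mu>) \<in> V"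
      then obtain e where e: "e > 0" "ball (\<integral>x. f x \<partial>\<mu>) e \<subseteq> V"
        using \<open>open V\<close> open_contains_ball by blast
      from ex[of \<mu> e] \<mu> e obtain U where U: "openin tau_topology U" "\<mu> \<in> U"
        "\<forall>\<nu>\<in>U. \<bar>(\<integral>x. f x \<partial>\<nu>) - (\<integral>x. f x \<partial>\<mu>)\<bar> < e" by auto
      then have "U \<subseteq> {\<mu> \<in> topspace tau_topology. (\<integral>x. f x \<partial>\<mu>) \<in> V}"
        using e(2) openin_subset[OF U(1)] by (auto simp: dist_real_def subset_eq abs_minus_commute)
      with U show "\<exists>T. openin tau_topology T \<and> \<mu> \<in> T \<and> T \<subseteq> {\<mu> \<in> topspace tau_topology. (\<integral>x. f x \<partial>\<mu>) \<in> V}"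
        by blast
    qed
  qed auto
qed

section \<open>Weak neighbourhoods given by open sets\<close>

text \<open>
  On a metric space every Borel set with \<open>\<mu>\<close>-null boundary has this property, by the portmanteau theorem. The
  neighbourhood formulation makes sense without a metric.
\<close>

definition weakly_continuous_at :: "'a::topological_space measure \<Rightarrow> 'a set \<Rightarrow> bool" where
  "weakly_continuous_at \<mu> B \<longleftrightarrow>
     (\<forall>\<delta>>0. \<exists>W. openin weak_topology W \<and> \<mu> \<in> W \<and> (\<forall>\<nu>\<in>W. \<bar>measure \<nu> B - measure \<mu> B\<bar> < \<delta>))"

lemma borel_measurable_continuous_finite_measures:
  fixes f :: "'a::topological_space \<Rightarrow> real"
  assumes "\<mu> \<in> finite_measures" "continuous_on UNIV f"
  shows "f \<in> borel_measurable \<mu>"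
  using borel_measurable_continuous_onI[OF assms(2)]
    measurable_cong_sets[OF finite_measuresD(1)[OF assms(1)] refl] by blast

lemma continuous_level_sets:
  fixes f :: "'a::topological_space \<Rightarrow> real"
  assumes "continuous_on UNIV f"
  shows "open {x. t < f x}" "open {x. f x < t}" "closed {x. f x = t}"
  using assms by (auto intro!: open_Collect_less closed_Collect_eq continuous_on_const)

lemma weak_total_mass_continuous:
  fixes \<mu> :: "'a::topological_space measure"
  assumes "\<mu> \<in> finite_measures"
  shows "weakly_continuous_at \<mu> UNIV"
  unfolding weakly_continuous_at_def
proof (intro allI impI)
  fix \<delta> :: real assume "\<delta> > 0"
  have "continuous_map weak_topology euclideanreal (\<lambda>\<mu>::'a measure. \<integral>x. (1::real) \<partial>\<mu>)"
    by (rule weak_integral_continuous) auto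
  from openin_close_value[OF this, of "measure \<mu> UNIV" \<delta>]
  have "openin weak_topology {\<nu> :: 'a measure. \<nu> \<in> finite_measures \<and> \<bar>measure \<nu> UNIV - measure \<mu> UNIV\<bar> < \<delta>}"
    by (simp add: finite_measuresD(2) cong: conj_cong)
  with assms \<open>\<delta> > 0\<close> show "\<exists>W. openin weak_topology W \<and> \<mu> \<in> W \<and> (\<forall>\<nu>\<in>W. \<bar>measure \<nu> UNIV - measure \<mu> UNIV\<bar> < \<delta>)"
    by (intro exI[of _ "{\<nu> :: 'a measure. \<nu> \<in> finite_measures \<and> \<bar>measure \<nu> UNIV - measure \<mu> UNIV\<bar> < \<delta>}"]) auto
qed

lemma weak_lower_semicontinuous:
  fixes g :: "'a::topological_space \<Rightarrow> real"
  assumes \<mu>: "\<mu> \<in> finite_measures" and g: "continuous_on UNIV g" and "\<delta> > 0"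
  shows "\<exists>W. openin weak_topology W \<and> \<mu> \<in> W \<and>
    (\<forall>\<nu>\<in>W. measure \<nu> {x. 0 < g x} > measure \<mu> {x. 0 < g x} - \<delta>)"
proof -
  define h where "h m x = min 1 (real m * max 0 (g x))" for m x
  have cont: "continuous_on UNIV (h m)" for m
    unfolding h_def by (intro continuous_intros g)
  have h01: "0 \<le> h m x" "h m x \<le> 1" for m x by (auto simp: h_def)
  have bdd: "bounded (range (h m))" for m
    using h01 by (intro boundedI[of _ 1]) auto
  have pos: "{x. 0 < g x} = {x. 0 < max 0 (g x)}" by auto
  have "(\<lambda>m. \<integral>x. h m x \<partial>\<mu>) \<longlonglongrightarrow> measure \<mu> {x. 0 < g x}"
    unfolding h_def pos
    using measure_positive_part_limit[OF finite_measuresD(3)[OF \<mu>], of "\<lambda>x. max 0 (g x)"]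
      borel_measurable_continuous_finite_measures[OF \<mu> g] finite_measuresD(2)[OF \<mu>] by simp
  from order_tendstoD(1)[OF this, of "measure \<mu> {x. 0 < g x} - \<delta> / 2"] \<open>\<delta> > 0\<close>
  obtain m where m: "measure \<mu> {x. 0 < g x} - \<delta> / 2 < (\<integral>x. h m x \<partial>\<mu>)"
    by (auto simp: eventually_sequentially)
  define W where "W = {\<nu> \<in> topspace weak_topology. \<bar>(\<integral>x. h m x \<partial>\<nu>) - (\<integral>x. h m x \<partial>\<mu>)\<bar> < \<delta> / 2}"
  have "openin weak_topology W"
    unfolding W_def by (intro openin_close_value weak_integral_continuous cont bdd)
  moreover have "\<mu> \<in> W" using \<mu> \<open>\<delta> > 0\<close> by (simp add: W_def)
  moreover have "measure \<nu> {x. 0 < g x} > measure \<mu> {x. 0 < g x} - \<delta>" if "\<nu> \<in> W" for \<nu>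
  proof -
    have \<nu>: "\<nu> \<in> finite_measures" using that by (simp add: W_def)
    interpret finite_measure \<nu> using finite_measuresD(3)[OF \<nu>] .
    have S: "{x. 0 < g x} \<in> sets \<nu>"
      using continuous_level_sets(1)[OF g] finite_measuresD(1)[OF \<nu>] by auto
    have "(\<integral>x. h m x \<partial>\<nu>) \<le> (\<integral>x. indicat_real {x. 0 < g x} x \<partial>\<nu>)"
    proof (rule integral_mono)
      show "integrable \<nu> (h m)"
        using h01 borel_measurable_continuous_finite_measures[OF \<nu> cont]
        by (intro integrable_const_bound[of _ 1]) auto
      show "integrable \<nu> (indicat_real {x. 0 < g x})"
        using S by (intro integrable_const_bound[of _ 1]) auto
      show "h m x \<le> indicat_real {x. 0 < g x} x" for x
        by (auto simp: h_def indicator_def)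
    qed
    also have "\<dots> = measure \<nu> {x. 0 < g x}"
      using S finite_measuresD(2)[OF \<nu>] by simp
    moreover have "\<bar>(\<integral>x. h m x \<partial>\<nu>) - (\<integral>x. h m x \<partial>\<mu>)\<bar> < \<delta> / 2" using that by (simp add: W_def)
    ultimately show ?thesis using m by linarith
  qed
  ultimately show ?thesis by blast
qed

text \<open>
  Both \<open>{f > t}\<close> and \<open>{f < t}\<close> are open, so their measures are lower semicontinuous. Since the total
  mass is continuous and the level set is \<open>\<mu>\<close>-null, the second bound turns into an upper bound for
  the first set.
\<close>

lemma weakly_continuous_at_superlevel_set:
  fixes f :: "'a::topological_space \<Rightarrow> real"
  assumes \<mu>: "\<mu> \<in> finite_measures" and f: "continuous_on UNIV f" and t: "measure \<mu> {x. f x = t} = 0"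
  shows "weakly_continuous_at \<mu> {x. t < f x}"
  unfolding weakly_continuous_at_def
proof (intro allI impI)
  fix \<delta> :: real assume "\<delta> > 0"
  have split: "measure \<nu> {x. t < f x} = measure \<nu> UNIV - measure \<nu> {x. f x < t} - measure \<nu> {x. f x = t}"
    if "\<nu> \<in> finite_measures" for \<nu>
  proof -
    interpret finite_measure \<nu> using finite_measuresD(3)[OF that] .
    have [measurable]: "{x. t < f x} \<in> sets \<nu>" "{x. f x < t} \<in> sets \<nu>" "{x. f x = t} \<in> sets \<nu>"
      using continuous_level_sets[OF f] finite_measuresD(1)[OF that] by auto
    have "measure \<nu> ({x. t < f x} \<union> {x. f x < t} \<union> {x. f x = t})
        = measure \<nu> {x. t < f x} + measure \<nu> {x. f x < t} + measure \<nu> {x. f x = t}"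
      by (subst finite_measure_Union; (subst finite_measure_Union)?; auto)
    moreover have "{x. t < f x} \<union> {x. f x < t} \<union> {x. f x = t} = UNIV" by auto
    ultimately show ?thesis by simp
  qed
  obtain W1 where W1: "openin weak_topology W1" "\<mu> \<in> W1"
    "\<forall>\<nu>\<in>W1. measure \<nu> {x. 0 < f x - t} > measure \<mu> {x. 0 < f x - t} - \<delta>"
    using weak_lower_semicontinuous[OF \<mu>, of "\<lambda>x. f x - t" \<delta>] \<open>\<delta> > 0\<close>
      continuous_on_diff[OF f continuous_on_const] by auto
  obtain W2 where W2: "openin weak_topology W2" "\<mu> \<in> W2"
    "\<forall>\<nu>\<in>W2. measure \<nu> {x. 0 < t - f x} > measure \<mu> {x. 0 < t - f x} - \<delta> / 2"
    using weak_lower_semicontinuous[OF \<mu>, of "\<lambda>x. t - f x" "\<delta> / 2"] \<open>\<delta> > 0\<close>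
      continuous_on_diff[OF continuous_on_const f] by auto
  obtain W3 where W3: "openin weak_topology W3" "\<mu> \<in> W3"
    "\<forall>\<nu>\<in>W3. \<bar>measure \<nu> UNIV - measure \<mu> UNIV\<bar> < \<delta> / 2"
    using weak_total_mass_continuous[OF \<mu>] \<open>\<delta> > 0\<close> unfolding weakly_continuous_at_def
    by (meson half_gt_zero)
  have "\<bar>measure \<nu> {x. t < f x} - measure \<mu> {x. t < f x}\<bar> < \<delta>" if "\<nu> \<in> W1 \<inter> W2 \<inter> W3" for \<nu>
  proof -
    have "\<nu> \<in> finite_measures" using that openin_subset[OF W1(1)] by auto
    from split[OF this] split[OF \<mu>] t have
      "measure \<nu> {x. t < f x} \<le> measure \<nu> UNIV - measure \<nu> {x. f x < t}"
      "measure \<mu> {x. t < f x} = measure \<mu> UNIV - measure \<mu> {x. f x < t}"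
      using measure_nonneg[of \<nu> "{x. f x = t}"] by linarith+
    moreover have "measure \<nu> {x. t < f x} > measure \<mu> {x. t < f x} - \<delta>"
      "measure \<nu> {x. f x < t} > measure \<mu> {x. f x < t} - \<delta> / 2"
      "\<bar>measure \<nu> UNIV - measure \<mu> UNIV\<bar> < \<delta> / 2"
      using that W1(3) W2(3) W3(3) by auto
    ultimately show ?thesis by linarith
  qed
  with W1 W2 W3 show "\<exists>W. openin weak_topology W \<and> \<mu> \<in> W \<and>
      (\<forall>\<nu>\<in>W. \<bar>measure \<nu> {x. t < f x} - measure \<mu> {x. t < f x}\<bar> < \<delta>)"
    by (intro exI[of _ "W1 \<inter> W2 \<inter> W3"]) auto
qed

text \<open>
  The image of \<open>\<mu>\<close> under \<open>f\<close> is finite and has at most countably many atoms.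
\<close>

lemma null_level_exists:
  fixes f :: "'a::topological_space \<Rightarrow> real"
  assumes \<mu>: "\<mu> \<in> finite_measures" and f: "continuous_on UNIV f" and "a < (b::real)"
  shows "\<exists>t\<in>{a<..<b}. measure \<mu> {x. f x = t} = 0"
proof -
  note f' = borel_measurable_continuous_finite_measures[OF \<mu> f]
  interpret \<mu>: finite_measure \<mu> using finite_measuresD(3)[OF \<mu>] .
  interpret D: finite_measure "distr \<mu> borel f" by (rule \<mu>.finite_measure_distr) (fact f')
  have "{a<..<b} - {t. measure (distr \<mu> borel f) {t} \<noteq> 0} \<noteq> {}"
  proof
    assume "{a<..<b} - {t. measure (distr \<mu> borel f) {t} \<noteq> 0} = {}"
    then have "countable {a<..<b}"
      by (intro countable_subset[OF _ D.countable_support]) blast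
    with \<open>a < b\<close> show False using uncountable_open_interval[of a b] by blast
  qed
  then obtain t where t: "t \<in> {a<..<b}" "measure (distr \<mu> borel f) {t} = 0" by blast
  then have "measure \<mu> {x. f x = t} = 0"
    using f' finite_measuresD(2)[OF \<mu>] by (simp add: measure_distr vimage_def)
  with t show ?thesis by blast
qed

text \<open>
  After an affine change \<open>f\<close> has values in \<open>[0, 1]\<close>. The sets are the superlevel sets
  of a staircase with \<open>\<mu>\<close>-null levels, together with the whole space, which controls the total mass.
\<close>

lemma integral_controlled_by_open_sets:
  fixes f :: "'a::topological_space \<Rightarrow> real"
  assumes \<mu>: "\<mu> \<in> finite_measures" and f: "continuous_on UNIV f" "bounded (range f)" and "e > 0"
  shows "\<exists>\<B> d. finite \<B> \<and> d > 0 \<and> (\<forall>B\<in>\<B>. open B \<and> weakly_continuous_at \<mu> B) \<and>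
    (\<forall>\<nu>\<in>finite_measures. (\<forall>B\<in>\<B>. \<bar>measure \<nu> B - measure \<mu> B\<bar> < d) \<longrightarrow>
       \<bar>(\<integral>x. f x \<partial>\<nu>) - (\<integral>x. f x \<partial>\<mu>)\<bar> < e)"
proof -
  obtain b where b: "b > 0" "\<And>x. \<bar>f x\<bar> \<le> b"
    using f(2) unfolding bounded_pos by auto
  define g where "g x = (f x + b) / (2 * b)" for x
  have g: "continuous_on UNIV g"
    unfolding g_def using b by (intro continuous_intros f) auto
  have g01: "0 \<le> g x \<and> g x \<le> 1" for x
  proof -
    have "- b \<le> f x" "f x \<le> b" using b(2)[of x] by linarith+
    then show ?thesis using b(1) by (simp add: g_def)
  qed
  define c where "c = measure \<mu> UNIV + 1"
  have "c > 0" by (simp add: c_def add_nonneg_pos)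
  \<comment> \<open>The final error is \<open>4 * b * c / p + 3 * b * d\<close>, which these choices of \<open>p\<close> and \<open>d\<close> keep below \<open>e\<close>.\<close>
  obtain p :: nat where p: "p > 8 * b * c / e" using reals_Archimedean2 by blast
  have "0 < 8 * b * c / e" using b \<open>c > 0\<close> \<open>e > 0\<close> by simp
  with p have "p > 0" by (metis gr0I less_asym of_nat_0)
  have "\<exists>t\<in>{real j / p<..<(real j + 1) / p}. measure \<mu> {x. g x = t} = 0" for j
    using \<open>p > 0\<close> by (intro null_level_exists \<mu> g) (simp add: divide_strict_right_mono)
  then obtain t where t: "\<And>j. t j \<in> {real j / p<..<(real j + 1) / p}" "\<And>j. measure \<mu> {x. g x = t j} = 0"
    by metis
  define S where "S j = {x. t j < g x}" for j
  define \<B> where "\<B> = insert UNIV (S ` {..<p})"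
  define d where "d = min 1 (e / (6 * b))"
  have d: "d > 0" "d \<le> 1" "6 * b * d \<le> e" using b \<open>e > 0\<close> by (auto simp: d_def min_def field_simps)
  have "\<bar>(\<integral>x. f x \<partial>\<nu>) - (\<integral>x. f x \<partial>\<mu>)\<bar> < e"
    if \<nu>: "\<nu> \<in> finite_measures" and close: "\<forall>B\<in>\<B>. \<bar>measure \<nu> B - measure \<mu> B\<bar> < d" for \<nu>
  proof -
    have approx: "\<bar>(\<integral>x. g x \<partial>\<rho>) - (\<Sum>j<p. measure \<rho> (S j)) / p\<bar> \<le> c / p"
      and affine: "(\<integral>x. f x \<partial>\<rho>) = 2 * b * (\<integral>x. g x \<partial>\<rho>) - b * measure \<rho> UNIV"
      if \<rho>: "\<rho> \<in> finite_measures" "measure \<rho> UNIV \<le> c" for \<rho>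
    proof -
      interpret finite_measure \<rho> using finite_measuresD(3)[OF \<rho>(1)] .
      note [measurable] = borel_measurable_continuous_finite_measures[OF \<rho>(1) g]
      have "\<bar>(\<integral>x. g x \<partial>\<rho>) - (\<Sum>j<p. measure \<rho> {x \<in> space \<rho>. t j < g x}) / p\<bar> \<le> measure \<rho> (space \<rho>) / p"
        using t(1) by (intro integral_staircase \<open>p > 0\<close> g01 finite_measure_axioms) (auto intro: less_imp_le)
      also have "\<dots> \<le> c / p" using \<rho> finite_measuresD(2)[OF \<rho>(1)] by (intro divide_right_mono) auto
      finally show "\<bar>(\<integral>x. g x \<partial>\<rho>) - (\<Sum>j<p. measure \<rho> (S j)) / p\<bar> \<le> c / p"
        using finite_measuresD(2)[OF \<rho>(1)] by (simp add: S_def)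
      have "integrable \<rho> g"
        using g01 by (intro integrable_const_bound[of _ 1]) auto
      then have "(\<integral>x. 2 * b * g x - b \<partial>\<rho>) = 2 * b * (\<integral>x. g x \<partial>\<rho>) - b * measure \<rho> UNIV"
        using finite_measuresD(2)[OF \<rho>(1)] by simp
      moreover have "2 * b * g x - b = f x" for x using b by (simp add: g_def)
      ultimately show "(\<integral>x. f x \<partial>\<rho>) = 2 * b * (\<integral>x. g x \<partial>\<rho>) - b * measure \<rho> UNIV" by simp
    qed
    have U: "\<bar>measure \<nu> UNIV - measure \<mu> UNIV\<bar> < d" using close by (auto simp: \<B>_def)
    then have mass: "measure \<nu> UNIV \<le> c" "measure \<mu> UNIV \<le> c" using d(2) by (auto simp: c_def)
    have "\<bar>(\<Sum>j<p. measure \<nu> (S j)) - (\<Sum>j<p. measure \<mu> (S j))\<bar> \<le> (\<Sum>j<p. \<bar>measure \<nu> (S j) - measure \<mu> (S j)\<bar>)"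
      by (subst sum_subtractf[symmetric]) (rule sum_abs)
    also have "\<dots> \<le> (\<Sum>j<p. d)"
      using close by (intro sum_mono) (auto simp: \<B>_def intro: less_imp_le)
    finally have "\<bar>(\<Sum>j<p. measure \<nu> (S j)) / p - (\<Sum>j<p. measure \<mu> (S j)) / p\<bar> \<le> d"
      using \<open>p > 0\<close> by (simp add: field_simps flip: diff_divide_distrib)
    with approx[OF \<nu> mass(1)] approx[OF \<mu> mass(2)]
    have "\<bar>(\<integral>x. g x \<partial>\<nu>) - (\<integral>x. g x \<partial>\<mu>)\<bar> \<le> 2 * (c / p) + d" by linarith
    then have g_close: "2 * b * \<bar>(\<integral>x. g x \<partial>\<nu>) - (\<integral>x. g x \<partial>\<mu>)\<bar> \<le> 2 * b * (2 * (c / p) + d)"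
      using b by (intro mult_left_mono) auto
    have "(\<integral>x. f x \<partial>\<nu>) - (\<integral>x. f x \<partial>\<mu>)
        = 2 * b * ((\<integral>x. g x \<partial>\<nu>) - (\<integral>x. g x \<partial>\<mu>)) - b * (measure \<nu> UNIV - measure \<mu> UNIV)"
      by (simp add: affine[OF \<nu> mass(1)] affine[OF \<mu> mass(2)] algebra_simps)
    then have "\<bar>(\<integral>x. f x \<partial>\<nu>) - (\<integral>x. f x \<partial>\<mu>)\<bar>
        \<le> \<bar>2 * b * ((\<integral>x. g x \<partial>\<nu>) - (\<integral>x. g x \<partial>\<mu>))\<bar> + \<bar>b * (measure \<nu> UNIV - measure \<mu> UNIV)\<bar>"
      by linarith
    also have "\<dots> = 2 * b * \<bar>(\<integral>x. g x \<partial>\<nu>) - (\<integral>x. g x \<partial>\<mu>)\<bar> + b * \<bar>measure \<nu> UNIV - measure \<mu> UNIV\<bar>"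
      using b by (simp add: abs_mult)
    also have "\<dots> \<le> 2 * b * (2 * (c / p) + d) + b * d"
      using g_close U b by (intro add_mono mult_left_mono) auto
    also have "\<dots> = 4 * b * c / p + (6 * b * d) / 2" by (simp add: field_simps)
    also have "\<dots> < e / 2 + e / 2"
      using p \<open>p > 0\<close> \<open>e > 0\<close> d(3) by (intro add_less_le_mono) (auto simp: field_simps)
    finally show ?thesis by simp
  qed
  moreover have "open B \<and> weakly_continuous_at \<mu> B" if "B \<in> \<B>" for B
    using that weak_total_mass_continuous[OF \<mu>] t(2) continuous_level_sets(1)[OF g]
    by (auto simp: \<B>_def S_def intro!: weakly_continuous_at_superlevel_set \<mu> g)
  ultimately show ?thesis
    using d(1) by (intro exI[of _ \<B>] exI[of _ d]) (auto simp: \<B>_def)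
qed

lemma weak_neighbourhood_by_open_sets:
  assumes \<mu>: "\<mu> \<in> W" and W: "openin weak_topology W"
  shows "\<exists>\<B> d. finite \<B> \<and> d > 0 \<and> (\<forall>B\<in>\<B>. open B \<and> weakly_continuous_at \<mu> B) \<and>
    (\<forall>\<nu>\<in>finite_measures. (\<forall>B\<in>\<B>. \<bar>measure \<nu> B - measure \<mu> B\<bar> < d) \<longrightarrow> \<nu> \<in> W)"
proof -
  have \<mu>fm: "\<mu> \<in> finite_measures" using openin_subset[OF W] \<mu> by auto
  from initial_topology_neighbourhood[OF W[unfolded weak_topology_def] \<mu>]
  obtain G and e :: real where "finite G \<and> G \<subseteq> {\<lambda>\<mu>. \<integral>x. f x \<partial>\<mu> | f. continuous_on UNIV f \<and> bounded (range f)} \<and>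
    e > 0 \<and> (\<forall>\<nu>\<in>finite_measures. (\<forall>f\<in>G. \<bar>f \<nu> - f \<mu>\<bar> < e) \<longrightarrow> \<nu> \<in> W)"
    by (elim exE) (rule that)
  then have G: "finite G" "G \<subseteq> {\<lambda>\<mu>. \<integral>x. f x \<partial>\<mu> | f. continuous_on UNIV f \<and> bounded (range f)}" "e > 0"
    "\<And>\<nu>. \<nu> \<in> finite_measures \<Longrightarrow> (\<forall>f\<in>G. \<bar>f \<nu> - f \<mu>\<bar> < e) \<Longrightarrow> \<nu> \<in> W"
    by simp_all
  have "\<exists>\<B> d. finite \<B> \<and> d > 0 \<and> (\<forall>B\<in>\<B>. open B \<and> weakly_continuous_at \<mu> B) \<and>
    (\<forall>\<nu>\<in>finite_measures. (\<forall>B\<in>\<B>. \<bar>measure \<nu> B - measure \<mu> B\<bar> < d) \<longrightarrow> \<bar>F \<nu> - F \<mu>\<bar> < e)"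
    if "F \<in> G" for F
  proof -
    from G(2) that obtain f where "F = (\<lambda>\<mu>. \<integral>x. f x \<partial>\<mu>)" "continuous_on UNIV f" "bounded (range f)"
      by auto
    then show ?thesis
      using integral_controlled_by_open_sets[OF \<mu>fm _ _ \<open>e > 0\<close>, of f] by simp
  qed
  then obtain \<B> d where Bd: "\<And>F. F \<in> G \<Longrightarrow> finite (\<B> F) \<and> d F > (0::real) \<and>
    (\<forall>B\<in>\<B> F. open B \<and> weakly_continuous_at \<mu> B) \<and>
    (\<forall>\<nu>\<in>finite_measures. (\<forall>B\<in>\<B> F. \<bar>measure \<nu> B - measure \<mu> B\<bar> < d F) \<longrightarrow> \<bar>F \<nu> - F \<mu>\<bar> < e)"
    by metis
  define d' where "d' = Min (insert 1 (d ` G))"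
  have "d' > 0" using Bd G(1) by (auto simp: d'_def)
  have "d' \<le> d F" if "F \<in> G" for F using that G(1) by (auto simp: d'_def)
  note le = this
  have "\<nu> \<in> W" if \<nu>: "\<nu> \<in> finite_measures" "\<forall>B\<in>\<Union>(\<B> ` G). \<bar>measure \<nu> B - measure \<mu> B\<bar> < d'" for \<nu>
  proof (rule G(4)[OF \<nu>(1)], intro ballI)
    fix F assume F: "F \<in> G"
    have "\<forall>B\<in>\<B> F. \<bar>measure \<nu> B - measure \<mu> B\<bar> < d F"
      using \<nu>(2) F le[OF F] by fastforce
    then show "\<bar>F \<nu> - F \<mu>\<bar> < e" using Bd[OF F] \<nu>(1) by blast
  qed
  with \<open>d' > 0\<close> G(1) Bd show ?thesis
    by (intro exI[of _ "\<Union>(\<B> ` G)"] exI[of _ d']) auto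
qed

text \<open>
  Each point \<open>\<mu>\<close> of \<open>C\<close> has a neighbourhood that misses \<open>D\<close> and is given by finitely many open sets
  of weak continuity, with a margin \<open>2 * e\<close>. Compactness selects finitely many centres for which
  the half-size neighbourhoods still cover \<open>C\<close>. The gap between \<open>e\<close> and \<open>2 * e\<close> is what leaves room for
  the random fluctuations of the empirical measures.
\<close>

lemma compact_separation_by_open_sets:
  fixes C D :: "'a::topological_space measure set"
  assumes C: "compactin weak_topology C" and D: "D \<subseteq> finite_measures"
    and disj: "C \<inter> weak_topology closure_of D = {}"
  shows "\<exists>\<J>. finite \<J> \<and>
    (\<forall>(\<mu>, \<B>, e)\<in>\<J>. finite \<B> \<and> (\<forall>B\<in>\<B>. open B) \<and> (e::real) > 0 \<and>
        (\<forall>\<nu>\<in>D. \<exists>B\<in>\<B>. \<bar>measure \<nu> B - measure \<mu> B\<bar> \<ge> 2 * e)) \<and>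
    (\<forall>\<nu>\<in>C. \<exists>(\<mu>, \<B>, e)\<in>\<J>. \<forall>B\<in>\<B>. \<bar>measure \<nu> B - measure \<mu> B\<bar> < e)"
proof -
  have "\<exists>\<B> e W. finite \<B> \<and> (\<forall>B\<in>\<B>. open B) \<and> e > 0 \<and>
      (\<forall>\<nu>\<in>D. \<exists>B\<in>\<B>. \<bar>measure \<nu> B - measure \<mu> B\<bar> \<ge> 2 * e) \<and>
      openin weak_topology W \<and> \<mu> \<in> W \<and> (\<forall>\<nu>\<in>W. \<forall>B\<in>\<B>. \<bar>measure \<nu> B - measure \<mu> B\<bar> < e)"
    if "\<mu> \<in> C" for \<mu>
  proof -
    define V where "V = topspace weak_topology - weak_topology closure_of D"
    have "openin weak_topology V" unfolding V_def by (intro openin_diff openin_topspace closedin_closure_of)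
    moreover have "\<mu> \<in> V" using that disj compactin_subset_topspace[OF C] by (auto simp: V_def)
    ultimately obtain \<B> d where \<B>: "finite \<B>" "d > 0" "\<forall>B\<in>\<B>. open B \<and> weakly_continuous_at \<mu> B"
      "\<forall>\<nu>\<in>finite_measures. (\<forall>B\<in>\<B>. \<bar>measure \<nu> B - measure \<mu> B\<bar> < d) \<longrightarrow> \<nu> \<in> V"
      using weak_neighbourhood_by_open_sets[of \<mu> V] by (auto 0 0)
    have "\<nu> \<notin> V" if "\<nu> \<in> D" for \<nu>
      using that D closure_of_subset[of D weak_topology] by (auto simp: V_def)
    then have far: "\<forall>\<nu>\<in>D. \<exists>B\<in>\<B>. \<bar>measure \<nu> B - measure \<mu> B\<bar> \<ge> 2 * (d / 2)"
      using \<B>(4) D by fastforce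
    have "\<forall>B\<in>\<B>. \<exists>W. openin weak_topology W \<and> \<mu> \<in> W \<and> (\<forall>\<nu>\<in>W. \<bar>measure \<nu> B - measure \<mu> B\<bar> < d / 2)"
      using \<B>(2,3) unfolding weakly_continuous_at_def by (meson half_gt_zero)
    then obtain W where W: "\<And>B. B \<in> \<B> \<Longrightarrow> openin weak_topology (W B) \<and> \<mu> \<in> W B \<and>
        (\<forall>\<nu>\<in>W B. \<bar>measure \<nu> B - measure \<mu> B\<bar> < d / 2)" by metis
    have "openin weak_topology (topspace weak_topology \<inter> \<Inter>(W ` \<B>))"
      using \<B>(1) W openin_topspace[of weak_topology]
      by (cases "\<B> = {}") (auto intro!: openin_Int openin_Inter simp del: topspace_weak_topology)
    moreover have "\<mu> \<in> topspace weak_topology \<inter> \<Inter>(W ` \<B>)"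
      using W that compactin_subset_topspace[OF C] by auto
    ultimately show ?thesis
      using \<B>(1-3) far W
      by (intro exI[of _ \<B>] exI[of _ "d / 2"] exI[of _ "topspace weak_topology \<inter> \<Inter>(W ` \<B>)"]) auto
  qed
  then obtain \<B> e W where sep: "\<And>\<mu>. \<mu> \<in> C \<Longrightarrow> finite (\<B> \<mu>) \<and> (\<forall>B\<in>\<B> \<mu>. open B) \<and> e \<mu> > (0::real) \<and>
      (\<forall>\<nu>\<in>D. \<exists>B\<in>\<B> \<mu>. \<bar>measure \<nu> B - measure \<mu> B\<bar> \<ge> 2 * e \<mu>) \<and>
      openin weak_topology (W \<mu>) \<and> \<mu> \<in> W \<mu> \<and> (\<forall>\<nu>\<in>W \<mu>. \<forall>B\<in>\<B> \<mu>. \<bar>measure \<nu> B - measure \<mu> B\<bar> < e \<mu>)"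
    by metis
  have "C \<subseteq> \<Union>(W ` C)" using sep by blast
  then obtain \<F> where \<F>: "finite \<F>" "\<F> \<subseteq> W ` C" "C \<subseteq> \<Union>\<F>"
    using C sep unfolding compactin_def by (metis (no_types, lifting) imageE)
  then obtain C' where C': "finite C'" "C' \<subseteq> C" "\<F> = W ` C'"
    by (meson finite_subset_image)
  show ?thesis
  proof (intro exI[of _ "(\<lambda>\<mu>. (\<mu>, \<B> \<mu>, e \<mu>)) ` C'"] conjI ballI)
    fix \<nu> assume "\<nu> \<in> C"
    with \<F>(3) C' obtain \<mu> where "\<mu> \<in> C'" "\<nu> \<in> W \<mu>" by auto
    with sep[of \<mu>] C' show "\<exists>(\<mu>, \<B>, e)\<in>(\<lambda>\<mu>. (\<mu>, \<B> \<mu>, e \<mu>)) ` C'. \<forall>B\<in>\<B>. \<bar>measure \<nu> B - measure \<mu> B\<bar> < e"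
      by (intro bexI[of _ "(\<mu>, \<B> \<mu>, e \<mu>)"]) auto
  qed (use sep C' in auto)
qed

lemma separated_vectors_closures_disjoint:
  assumes k: "k \<ge> 1" and "\<delta> > 0"
    and sep: "\<And>\<mu> \<nu>. \<mu> \<in> \<Theta>0 \<Longrightarrow> \<nu> \<in> \<Theta>1 \<Longrightarrow> \<exists>i<k. \<bar>measure \<mu> (B i) - measure \<nu> (B i)\<bar> \<ge> \<delta>"
  shows "Euclidean_space k closure_of (measure_vector k B ` \<Theta>0) \<inter>
    Euclidean_space k closure_of (measure_vector k B ` \<Theta>1) = {}"
proof (rule ccontr)
  assume "\<not> ?thesis"
  then obtain v where v: "v \<in> Euclidean_space k closure_of (measure_vector k B ` \<Theta>0)"
    "v \<in> Euclidean_space k closure_of (measure_vector k B ` \<Theta>1)" by blast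
  let ?E = "Euclidean_space k"
  define U where "U = (\<Inter>i<k. {w \<in> topspace ?E. \<bar>w i - v i\<bar> < \<delta> / 2})"
  have "continuous_map ?E euclideanreal (\<lambda>w. w i)" for i
    unfolding Euclidean_space_def
    by (intro continuous_map_from_subtopology continuous_map_product_projection) auto
  then have "openin ?E {w \<in> topspace ?E. \<bar>w i - v i\<bar> < \<delta> / 2}" for i
    by (rule openin_close_value)
  moreover have "{..<k} \<noteq> {}" using k by (auto simp: lessThan_empty_iff)
  ultimately have "openin ?E U"
    unfolding U_def by (intro openin_Inter) blast+
  moreover have "v \<in> U"
    using v(1) in_closure_of[of v ?E] \<open>\<delta> > 0\<close> by (auto simp: U_def)
  ultimately obtain \<mu> \<nu> where "\<mu> \<in> \<Theta>0" "measure_vector k B \<mu> \<in> U" "\<nu> \<in> \<Theta>1" "measure_vector k B \<nu> \<in> U"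
    using v unfolding in_closure_of by blast
  moreover from sep[OF this(1,3)] obtain i where i: "i < k" "\<bar>measure \<mu> (B i) - measure \<nu> (B i)\<bar> \<ge> \<delta>" by blast
  ultimately have "\<bar>measure \<mu> (B i) - v i\<bar> < \<delta> / 2" "\<bar>measure \<nu> (B i) - v i\<bar> < \<delta> / 2"
    by (auto simp: U_def measure_vector_def)
  with i(2) show False by linarith
qed

text \<open>
  A measure in \<open>\<Theta>0\<close> is \<open>e\<close>-close to some centre on all sets attached to it, whereas a measure in \<open>\<Theta>1\<close> is
  \<open>2 * e\<close>-far from the same centre on one of them. So the two vectors differ by at least \<open>e\<close> in a coordinate.
\<close>

lemma open_sets_separating_closures:
  fixes \<Theta>0 \<Theta>1 :: "'a::topological_space measure set"
  assumes sub: "\<Theta>0 \<subseteq> finite_measures" "\<Theta>1 \<subseteq> finite_measures"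
    and comp: "relatively_compact_in weak_topology \<Theta>0"
    and disj: "weak_topology closure_of \<Theta>0 \<inter> weak_topology closure_of \<Theta>1 = {}"
  shows "\<exists>(k::nat) (B :: nat \<Rightarrow> 'a set). k \<ge> 1 \<and> (\<forall>i<k. open (B i)) \<and>
           Euclidean_space k closure_of (measure_vector k B ` \<Theta>0) \<inter>
           Euclidean_space k closure_of (measure_vector k B ` \<Theta>1) = {}"
proof -
  from compact_separation_by_open_sets[OF comp[unfolded relatively_compact_in_def] sub(2) disj]
  obtain \<J> where J': "finite \<J>"
    "\<forall>(\<mu>, \<B>, e)\<in>\<J>. finite \<B> \<and> (\<forall>B\<in>\<B>. open B) \<and> (e::real) > 0 \<and>
        (\<forall>\<nu>\<in>\<Theta>1. \<exists>B\<in>\<B>. \<bar>measure \<nu> B - measure \<mu> B\<bar> \<ge> 2 * e)"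
    "\<forall>\<nu>\<in>weak_topology closure_of \<Theta>0.
      \<exists>(\<mu>, \<B>, e)\<in>\<J>. \<forall>B\<in>\<B>. \<bar>measure \<nu> B - measure \<mu> B\<bar> < e"
    by (elim exE conjE) (rule that)
  have J: "finite \<J>"
    "\<And>\<mu> \<B> e. (\<mu>, \<B>, e) \<in> \<J> \<Longrightarrow> finite \<B> \<and> (\<forall>B\<in>\<B>. open B) \<and> e > 0 \<and>
        (\<forall>\<nu>\<in>\<Theta>1. \<exists>B\<in>\<B>. \<bar>measure \<nu> B - measure \<mu> B\<bar> \<ge> 2 * e)"
    "\<And>\<nu>. \<nu> \<in> weak_topology closure_of \<Theta>0 \<Longrightarrow>
      \<exists>(\<mu>, \<B>, e)\<in>\<J>. \<forall>B\<in>\<B>. \<bar>measure \<nu> B - measure \<mu> B\<bar> < e"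
    using J' by (fast, fast, fast)
  define \<A> where "\<A> = insert UNIV (\<Union>(\<mu>, \<B>, e)\<in>\<J>. \<B>)"
  have "finite \<A>" using J(1,2) by (auto simp: \<A>_def)
  then obtain B where B: "bij_betw B {0..<card \<A>} \<A>"
    using ex_bij_betw_nat_finite by blast
  define \<delta> where "\<delta> = Min (insert 1 ((\<lambda>(\<mu>, \<B>, e). e) ` \<J>))"
  have "\<delta> > 0" using J(1,2) by (auto simp: \<delta>_def)
  have \<delta>: "\<delta> \<le> e" if "(\<mu>, \<B>, e) \<in> \<J>" for \<mu> \<B> e
    using that J(1) unfolding \<delta>_def by (intro Min_le) (auto intro!: image_eqI[of _ _ "(\<mu>, \<B>, e)"])
  have "1 \<le> card \<A>"
    using \<open>finite \<A>\<close> by (auto simp: \<A>_def Suc_le_eq card_gt_0_iff)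
  moreover have "open A" if "A \<in> \<A>" for A using that J(2) by (auto simp: \<A>_def)
  then have "\<forall>i<card \<A>. open (B i)" using bij_betw_apply[OF B] by auto
  moreover have "\<exists>i<card \<A>. \<delta> \<le> \<bar>measure \<mu>0 (B i) - measure \<mu>1 (B i)\<bar>"
    if \<mu>: "\<mu>0 \<in> \<Theta>0" "\<mu>1 \<in> \<Theta>1" for \<mu>0 \<mu>1
  proof -
    have "\<mu>0 \<in> weak_topology closure_of \<Theta>0"
      using closure_of_subset[of \<Theta>0 weak_topology] sub \<mu> by auto
    from J(3)[OF this] obtain \<mu> \<B> e where j: "(\<mu>, \<B>, e) \<in> \<J>" "\<forall>B\<in>\<B>. \<bar>measure \<mu>0 B - measure \<mu> B\<bar> < e"
      by auto
    from J(2)[OF j(1)] \<mu>(2) obtain A where A: "A \<in> \<B>" "\<bar>measure \<mu>1 A - measure \<mu> A\<bar> \<ge> 2 * e" by blast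
    have "A \<in> \<A>" using A(1) j(1) by (force simp: \<A>_def)
    then obtain i where "i < card \<A>" "A = B i"
      using B by (metis atLeastLessThan_iff bij_betw_def imageE)
    moreover have "\<bar>measure \<mu>0 A - measure \<mu>1 A\<bar> \<ge> \<delta>"
      using A(2) bspec[OF j(2) A(1)] \<delta>[OF j(1)] by linarith
    ultimately show ?thesis by auto
  qed
  ultimately show ?thesis
    using separated_vectors_closures_disjoint[OF _ \<open>\<delta> > 0\<close>, of "card \<A>" \<Theta>0 \<Theta>1 B] by blast
qed

section \<open>Countably many functions that determine a finite measure\<close>

definition separating_functions :: "(nat \<Rightarrow> 'a::topological_space \<Rightarrow> real) \<Rightarrow> bool" where
  "separating_functions f \<longleftrightarrow> (\<forall>i. continuous_on UNIV (f i) \<and> (\<forall>x. 0 \<le> f i x \<and> f i x \<le> 1)) \<and>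
     (\<forall>\<mu>\<in>finite_measures. \<forall>\<nu>\<in>finite_measures. (\<forall>i. (\<integral>x. f i x \<partial>\<mu>) = (\<integral>x. f i x \<partial>\<nu>)) \<longrightarrow> \<mu> = \<nu>)"

lemma finite_measures_eqI_open:
  fixes \<mu> \<nu> :: "'a::topological_space measure"
  assumes \<mu>: "\<mu> \<in> finite_measures" and \<nu>: "\<nu> \<in> finite_measures"
    and eq: "\<And>G. open G \<Longrightarrow> measure \<mu> G = measure \<nu> G"
  shows "\<mu> = \<nu>"
proof -
  interpret \<mu>: finite_measure \<mu> using finite_measuresD(3)[OF \<mu>] .
  interpret \<nu>: finite_measure \<nu> using finite_measuresD(3)[OF \<nu>] .
  show ?thesis
  proof (rule measure_eqI_generator_eq[where E = "Collect open" and \<Omega> = UNIV and A = "\<lambda>_. UNIV"])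
    show "sets \<mu> = sigma_sets UNIV (Collect open)" "sets \<nu> = sigma_sets UNIV (Collect open)"
      using finite_measuresD(1)[OF \<mu>] finite_measuresD(1)[OF \<nu>] by (simp_all add: borel_def)
  qed (auto simp: Int_stable_def \<mu>.emeasure_eq_measure \<nu>.emeasure_eq_measure eq)
qed

text \<open>
  Balls with centres in a countable dense set and radii \<open>1/(n+1)\<close> form a base. The functions
  \<open>min 1 (m * F)\<close>, with \<open>F\<close> positive exactly on a given finite union of such balls, determine the
  measure of that union as \<open>m\<close> grows. Every open set is an increasing union of these finite unions.
\<close>

lemma Polish_separating_functions:
  assumes "Polish_topology (euclidean :: 'a::t2_space topology)"
  shows "\<exists>f :: nat \<Rightarrow> 'a \<Rightarrow> real. separating_functions f"
proof -
  from assms obtain S where S: "countable S" "euclidean closure_of S = (UNIV :: 'a set)"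
    by (auto simp: Polish_topology_def separable_space_def)
  have "metrizable_space (euclidean :: 'a topology)"
    using assms by (auto simp: Polish_topology_def completely_metrizable_imp_metrizable_space)
  then obtain M d where "Metric_space M d" "(euclidean :: 'a topology) = Metric_space.mtopology M d"
    unfolding metrizable_space_def by blast
  moreover from this have "M = UNIV"
    using Metric_space.topspace_mtopology by (metis topspace_euclidean)
  ultimately have "Metric_space UNIV d" and top: "(euclidean :: 'a topology) = Metric_space.mtopology UNIV d"
    by auto
  interpret Metric_space UNIV d by fact
  have "S \<noteq> {}" using S(2) by auto
  then obtain s :: "nat \<Rightarrow> 'a" where s: "S = range s"
    using S(1) by (metis range_from_nat_into)
  have open_iff: "open G \<longleftrightarrow> (\<forall>x\<in>G. \<exists>r>0. \<forall>y. d x y < r \<longrightarrow> y \<in> G)" for G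
    using openin_mtopology[of G] by (simp flip: top add: subset_eq Ball_def)
  have dcont: "continuous_on UNIV (d a)" for a
    unfolding continuous_on_open_vimage[OF open_UNIV]
  proof (intro allI impI)
    fix V :: "real set" assume "open V"
    show "open (d a -` V \<inter> UNIV)"
      unfolding open_iff
    proof
      fix x assume "x \<in> d a -` V \<inter> UNIV"
      with \<open>open V\<close> obtain e where e: "e > 0" "ball (d a x) e \<subseteq> V"
        using open_contains_ball[of V] by auto
      have "d a y \<in> V" if "d x y < e" for y
      proof -
        have "\<bar>d a x - d a y\<bar> \<le> d x y"
          using triangle[of a x y] triangle[of a y x] by (simp add: commute)
        with that e(2) show ?thesis by (auto simp: dist_real_def subset_eq)
      qed
      with e(1) show "\<exists>r>0. \<forall>y. d x y < r \<longrightarrow> y \<in> d a -` V \<inter> UNIV" by auto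
    qed
  qed
  define bump where "bump p x = max 0 (1 / real (Suc (snd p)) - d (s (fst p)) x)" for p :: "nat \<times> nat" and x
  define F where "F L x = (\<Sum>p\<in>set L. bump p x)" for L x
  define f where "f i x = (let (L, m) = from_nat i in min 1 (real (m::nat) * F L x))" for i x
  have Fcont: "continuous_on UNIV (F L)" for L
    unfolding F_def bump_def by (intro continuous_intros dcont)
  have F0: "F L x \<ge> 0" for L x by (auto simp: F_def bump_def intro: sum_nonneg)
  have Fpos: "F L x > 0 \<longleftrightarrow> (\<exists>p\<in>set L. d (s (fst p)) x < 1 / Suc (snd p))" for L x
  proof -
    have "F L x = 0 \<longleftrightarrow> (\<forall>p\<in>set L. bump p x = 0)"
      unfolding F_def by (intro sum_nonneg_eq_0_iff) (auto simp: bump_def)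
    then have "F L x > 0 \<longleftrightarrow> (\<exists>p\<in>set L. bump p x \<noteq> 0)" using F0[of L x] by fastforce
    moreover have "bump p x \<noteq> 0 \<longleftrightarrow> d (s (fst p)) x < 1 / Suc (snd p)" for p
      unfolding bump_def by linarith
    ultimately show ?thesis by simp
  qed
  have "separating_functions f"
    unfolding separating_functions_def
  proof (intro conjI allI ballI impI)
    fix i x
    obtain L :: "(nat \<times> nat) list" and m :: nat where Lm: "from_nat i = (L, m)" by fastforce
    then have fi: "f i = (\<lambda>x. min 1 (real m * F L x))" by (auto simp: f_def)
    show "continuous_on UNIV (f i)" unfolding fi by (intro continuous_intros Fcont)
    show "0 \<le> f i x" "f i x \<le> 1" using F0 by (auto simp: fi)
  next
    fix \<mu> \<nu> :: "'a measure"
    assume \<mu>: "\<mu> \<in> finite_measures" and \<nu>: "\<nu> \<in> finite_measures"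
      and eq: "\<forall>i. (\<integral>x. f i x \<partial>\<mu>) = (\<integral>x. f i x \<partial>\<nu>)"
    interpret \<mu>: finite_measure \<mu> using finite_measuresD(3)[OF \<mu>] .
    interpret \<nu>: finite_measure \<nu> using finite_measuresD(3)[OF \<nu>] .
    have lim: "(\<lambda>m. \<integral>x. min 1 (real m * F L x) \<partial>\<rho>) \<longlonglongrightarrow> measure \<rho> {x. 0 < F L x}"
      if "\<rho> \<in> finite_measures" for L \<rho>
      using measure_positive_part_limit[OF finite_measuresD(3)[OF that]
          borel_measurable_continuous_finite_measures[OF that Fcont] F0] finite_measuresD(2)[OF that] by simp
    have "(\<integral>x. min 1 (real m * F L x) \<partial>\<mu>) = (\<integral>x. min 1 (real m * F L x) \<partial>\<nu>)" for m L
    proof -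
      have "f (to_nat (L, m)) = (\<lambda>x. min 1 (real m * F L x))" by (simp add: f_def fun_eq_iff)
      with eq[rule_format, of "to_nat (L, m)"] show ?thesis by simp
    qed
    then have eqF: "measure \<mu> {x. 0 < F L x} = measure \<nu> {x. 0 < F L x}" for L
      using lim[OF \<mu>, of L] lim[OF \<nu>, of L] LIMSEQ_unique by simp
    show "\<mu> = \<nu>"
    proof (rule finite_measures_eqI_open[OF \<mu> \<nu>])
      fix G :: "'a set" assume "open G"
      define A where "A = {p. \<forall>x. d (s (fst p)) x < 1 / Suc (snd p) \<longrightarrow> x \<in> G}"
      have "\<exists>L. set L = A \<inter> {..N} \<times> {..N}" for N
        by (intro finite_list) auto
      then obtain L where L: "\<And>N. set (L N) = A \<inter> {..N} \<times> {..N}" by metis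
      have sub: "(\<Union>N. {x. 0 < F (L N) x}) = G"
      proof (intro equalityI subsetI)
        fix x assume "x \<in> (\<Union>N. {x. 0 < F (L N) x})"
        then show "x \<in> G" by (auto simp: Fpos L A_def)
      next
        fix x assume "x \<in> G"
        with \<open>open G\<close> obtain r where r: "r > 0" "\<And>y. d x y < r \<Longrightarrow> y \<in> G"
          unfolding open_iff by blast
        then obtain n where n: "1 / real (Suc n) < r / 2"
          using nat_approx_posE[of "r / 2"] by (auto simp: field_simps)
        have "x \<in> euclidean closure_of S" using S by simp
        moreover have "openin euclidean (mball x (1 / Suc n))"
          using openin_mball by (simp flip: top)
        moreover have "x \<in> mball x (1 / Suc n)" by simp
        ultimately have "\<exists>y\<in>S. y \<in> mball x (1 / Suc n)" unfolding in_closure_of by blast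
        then obtain i where i: "d x (s i) < 1 / Suc n" using s by auto
        have "(i, n) \<in> A"
          unfolding A_def
        proof (intro CollectI allI impI)
          fix y assume "d (s (fst (i, n))) y < 1 / real (Suc (snd (i, n)))"
          then have "d x y < r" using i n triangle[of x "s i" y] by simp
          then show "y \<in> G" by (rule r)
        qed
        then have "(i, n) \<in> set (L (max i n))" by (auto simp: L)
        then have "0 < F (L (max i n)) x"
          unfolding Fpos using i by (intro bexI[of _ "(i, n)"]) (auto simp: commute)
        then show "x \<in> (\<Union>N. {x. 0 < F (L N) x})" by blast
      qed
      have inc: "incseq (\<lambda>N. {x. 0 < F (L N) x})"
        by (intro monoI) (fastforce simp: Fpos L)
      have "open {x. 0 < F (L N) x}" for N by (rule continuous_level_sets(1)[OF Fcont])
      then have meas: "range (\<lambda>N. {x. 0 < F (L N) x}) \<subseteq> sets \<mu>" "range (\<lambda>N. {x. 0 < F (L N) x}) \<subseteq> sets \<nu>"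
        using finite_measuresD(1)[OF \<mu>] finite_measuresD(1)[OF \<nu>] by auto
      show "measure \<mu> G = measure \<nu> G"
        using \<mu>.finite_Lim_measure_incseq[OF meas(1) inc] \<nu>.finite_Lim_measure_incseq[OF meas(2) inc]
        unfolding sub eqF by (rule LIMSEQ_unique)
    qed
  qed
  then show ?thesis by blast
qed

text \<open>
  One parameter \<open>k\<close> bounds the number of functions and the size of the gap at the same time, so that the
  relation becomes weaker as \<open>k\<close> grows.
\<close>

definition integral_gap :: "(nat \<Rightarrow> 'a \<Rightarrow> real) \<Rightarrow> nat \<Rightarrow> 'a measure \<Rightarrow> 'a measure \<Rightarrow> bool" where
  "integral_gap f k \<mu> \<nu> \<longleftrightarrow> (\<exists>i<k. \<bar>(\<integral>x. f i x \<partial>\<nu>) - (\<integral>x. f i x \<partial>\<mu>)\<bar> \<ge> 1 / Suc k)"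

lemma integral_gap_Suc: "integral_gap f k \<mu> \<nu> \<Longrightarrow> integral_gap f (Suc k) \<mu> \<nu>"
proof -
  assume "integral_gap f k \<mu> \<nu>"
  then obtain i where "i < k" "\<bar>(\<integral>x. f i x \<partial>\<nu>) - (\<integral>x. f i x \<partial>\<mu>)\<bar> \<ge> 1 / Suc k"
    by (auto simp: integral_gap_def)
  moreover have "1 / real (Suc (Suc k)) \<le> 1 / real (Suc k)" by (intro divide_left_mono) auto
  ultimately show ?thesis unfolding integral_gap_def by (intro exI[of _ i]) auto
qed

lemma integral_gap_mono: "integral_gap f k \<mu> \<nu> \<Longrightarrow> k \<le> l \<Longrightarrow> integral_gap f l \<mu> \<nu>"
  by (rotate_tac 1, induction rule: dec_induct) (auto intro: integral_gap_Suc)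

text \<open>
  For fixed \<open>\<mu>\<close>, the points separated from \<open>\<mu>\<close> with parameter \<open>k\<close> contain an increasing sequence of open
  sets, whose union contains every point other than \<open>\<mu>\<close>. The topology is left open because the lemma is
  applied to the weak topology and to the \<open>\<tau>\<close>-topology.
\<close>

lemma compact_integral_gap:
  assumes f: "separating_functions f"
    and T: "topspace T = finite_measures" "\<And>i. continuous_map T euclideanreal (\<lambda>\<mu>. \<integral>x. f i x \<partial>\<mu>)"
    and C: "compactin T C" and \<mu>: "\<mu> \<in> finite_measures" "\<mu> \<notin> C"
  shows "\<exists>k. \<forall>\<nu>\<in>C. integral_gap f k \<mu> \<nu>"
proof -
  define O' where "O' k = (\<Union>i<k. {\<nu> \<in> topspace T. (\<integral>x. f i x \<partial>\<nu>) \<in> {y. \<bar>y - (\<integral>x. f i x \<partial>\<mu>)\<bar> > 1 / Suc k}})" for k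
  have "openin T {\<nu> \<in> topspace T. (\<integral>x. f i x \<partial>\<nu>) \<in> {y. \<bar>y - (\<integral>x. f i x \<partial>\<mu>)\<bar> > 1 / Suc k}}" for i k
    by (intro openin_continuous_map_preimage[OF T(2)])
      (auto intro!: open_Collect_less continuous_intros)
  then have "openin T (O' k)" for k
    unfolding O'_def by (intro openin_Union) blast
  moreover have "C \<subseteq> \<Union>(range O')"
  proof
    fix \<nu> assume "\<nu> \<in> C"
    then have \<nu>: "\<nu> \<in> finite_measures" "\<nu> \<noteq> \<mu>" using compactin_subset_topspace[OF C] T(1) \<mu> by auto
    then obtain i where i: "(\<integral>x. f i x \<partial>\<nu>) \<noteq> (\<integral>x. f i x \<partial>\<mu>)"
      using f \<mu>(1) unfolding separating_functions_def by blast
    then have "\<bar>(\<integral>x. f i x \<partial>\<nu>) - (\<integral>x. f i x \<partial>\<mu>)\<bar> > 0" by simp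
    then obtain n where n: "1 / real (Suc n) < \<bar>(\<integral>x. f i x \<partial>\<nu>) - (\<integral>x. f i x \<partial>\<mu>)\<bar>"
      using nat_approx_posE by blast
    define k where "k = Suc (max i n)"
    have "1 / real (Suc k) \<le> 1 / real (Suc n)" unfolding k_def by (intro divide_left_mono) auto
    with n have "1 / real (Suc k) < \<bar>(\<integral>x. f i x \<partial>\<nu>) - (\<integral>x. f i x \<partial>\<mu>)\<bar>" by linarith
    moreover have "i < k" by (simp add: k_def)
    ultimately have "\<nu> \<in> O' k" using \<nu>(1) T(1) by (auto simp: O'_def)
    then show "\<nu> \<in> \<Union>(range O')" by blast
  qed
  ultimately obtain \<F> where \<F>: "finite \<F>" "\<F> \<subseteq> range O'" "C \<subseteq> \<Union>\<F>"
    using C unfolding compactin_def by (metis (no_types, lifting) imageE)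
  then obtain I where I: "finite I" "\<F> = O' ` I" by (meson finite_subset_image)
  have "integral_gap f (Max (insert 0 I)) \<mu> \<nu>" if "\<nu> \<in> C" for \<nu>
  proof -
    from that \<F> I obtain k where k: "k \<in> I" "\<nu> \<in> O' k" by auto
    then have "integral_gap f k \<mu> \<nu>" by (force simp: O'_def integral_gap_def)
    then show ?thesis by (rule integral_gap_mono) (use k I in auto)
  qed
  then show ?thesis by blast
qed

lemma separating_functions_bounded: "separating_functions f \<Longrightarrow> bounded (range (f i))"
  unfolding separating_functions_def by (intro boundedI[of _ 1]) auto

text \<open>
  A uniform gap between \<open>\<mu>\<close> and the \<open>\<tau>\<close>-compact set \<open>M\<close> in finitely many integrals of continuous functions
  defines a weak neighbourhood of \<open>\<mu>\<close> that misses \<open>M\<close>. Thus a \<open>\<tau>\<close>-compact set is weakly closed.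
\<close>

lemma weak_closure_in_tau_compact:
  fixes M :: "'a::t2_space measure set"
  assumes "Polish_topology (euclidean :: 'a topology)"
    and M: "compactin tau_topology M" "\<Theta> \<subseteq> M"
  shows "weak_topology closure_of \<Theta> \<subseteq> M"
proof (rule subsetI, rule ccontr)
  fix \<mu> assume \<mu>: "\<mu> \<in> weak_topology closure_of \<Theta>" "\<mu> \<notin> M"
  obtain f :: "nat \<Rightarrow> 'a \<Rightarrow> real" where f: "separating_functions f"
    using Polish_separating_functions[OF assms(1)] by blast
  then have fc: "continuous_on UNIV (f i)" and f01: "0 \<le> f i x \<and> f i x \<le> 1" for i x
    by (auto simp: separating_functions_def)
  have \<mu>fm: "\<mu> \<in> finite_measures" using \<mu>(1) by (auto simp: in_closure_of)
  obtain k where k: "\<forall>\<nu>\<in>M. integral_gap f k \<mu> \<nu>"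
    using compact_integral_gap[OF f _ _ M(1) \<mu>fm \<mu>(2)]
      tau_integral_continuous[OF borel_measurable_continuous_onI[OF fc] f01] by auto
  define W where "W = topspace weak_topology \<inter> (\<Inter>i\<in>{..k}. {\<nu> \<in> topspace weak_topology. \<bar>(\<integral>x. f i x \<partial>\<nu>) - (\<integral>x. f i x \<partial>\<mu>)\<bar> < 1 / Suc k})"
  have "openin weak_topology W"
    unfolding W_def
    by (intro openin_Int openin_topspace openin_Inter)
      (auto intro!: openin_close_value weak_integral_continuous fc separating_functions_bounded f simp del: topspace_weak_topology)
  moreover have "\<mu> \<in> W" using \<mu>fm by (auto simp: W_def)
  ultimately obtain \<nu> where "\<nu> \<in> \<Theta>" "\<nu> \<in> W" using \<mu>(1) unfolding in_closure_of by blast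
  with k M(2) have "integral_gap f k \<mu> \<nu>" by blast
  then obtain i where i: "i < k" "\<bar>(\<integral>x. f i x \<partial>\<nu>) - (\<integral>x. f i x \<partial>\<mu>)\<bar> \<ge> 1 / Suc k"
    by (auto simp: integral_gap_def)
  have "\<bar>(\<integral>x. f i x \<partial>\<nu>) - (\<integral>x. f i x \<partial>\<mu>)\<bar> < 1 / Suc k"
    using \<open>\<nu> \<in> W\<close> i(1) unfolding W_def by fastforce
  with i(2) show False by linarith
qed

section \<open>Cylinder events of finitely many point configurations\<close>

lemma measurable_count [measurable]:
  assumes "B \<in> sets borel"
  shows "(\<lambda>\<nu>. measure \<nu> B) \<in> borel_measurable config_space"
proof -
  have "(\<lambda>\<nu>. emeasure \<nu> B) \<in> borel_measurable config_space"
    unfolding config_space_def using assms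
    by (intro measurable_SUP1[where i = B] measurable_vimage_algebra1) auto
  then show ?thesis unfolding measure_def by measurable
qed

abbreviation samples :: "nat \<Rightarrow> (nat \<Rightarrow> 'a::topological_space measure) measure" where
  "samples n \<equiv> Pi\<^sub>M {..<n} (\<lambda>_. config_space)"

lemma space_samples: "space (samples n) = {..<n} \<rightarrow>\<^sub>E counting_measures"
  by (simp add: space_PiM space_config_space)

lemma measurable_sample_count:
  assumes "i < n" "B \<in> sets borel"
  shows "(\<lambda>x. measure (x i) B) \<in> borel_measurable (samples n)"
  using assms by (intro measurable_compose[where f = "\<lambda>x. x i" and g = "\<lambda>\<nu>. measure \<nu> B" and N = config_space]
      measurable_component_singleton measurable_count) auto

lemma counting_measuresD:
  assumes "\<nu> \<in> counting_measures"
  shows "\<nu> \<in> finite_measures" "B \<in> sets borel \<Longrightarrow> \<exists>k. measure \<nu> B = real k"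
  using assms by (auto simp: counting_measures_def Nats_def)

definition determined_by :: "nat \<Rightarrow> 'a::topological_space set set \<Rightarrow> (nat \<Rightarrow> 'a measure) set \<Rightarrow> bool" where
  "determined_by n \<B> A \<longleftrightarrow> A \<subseteq> space (samples n) \<and>
     (\<forall>x\<in>A. \<forall>y\<in>space (samples n). (\<forall>i<n. \<forall>B\<in>\<B>. measure (x i) B = measure (y i) B) \<longrightarrow> y \<in> A)"

definition cylinders :: "nat \<Rightarrow> (nat \<Rightarrow> 'a::topological_space measure) set set" where
  "cylinders n = {A. \<exists>\<B>. finite \<B> \<and> \<B> \<subseteq> sets borel \<and> determined_by n \<B> A}"

lemma cylinder_space: "space (samples n) \<in> cylinders n"
  by (auto simp: cylinders_def determined_by_def intro!: exI[of _ "{}"])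

lemma cylinder_Diff:
  assumes "A \<in> cylinders n"
  shows "space (samples n) - A \<in> cylinders n"
proof -
  from assms obtain \<B> where \<B>: "finite \<B>" "\<B> \<subseteq> sets borel" "determined_by n \<B> A"
    by (auto simp: cylinders_def)
  then have "determined_by n \<B> (space (samples n) - A)"
    unfolding determined_by_def by (metis Diff_iff Diff_subset)
  with \<B> show ?thesis by (auto simp: cylinders_def)
qed

lemma cylinder_Int:
  assumes "A \<in> cylinders n" "A' \<in> cylinders n"
  shows "A \<inter> A' \<in> cylinders n"
proof -
  from assms obtain \<B> \<B>' where \<B>: "finite \<B>" "\<B> \<subseteq> sets borel" "determined_by n \<B> A"
    and \<B>': "finite \<B>'" "\<B>' \<subseteq> sets borel" "determined_by n \<B>' A'"
    by (auto simp: cylinders_def)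
  then have "determined_by n (\<B> \<union> \<B>') (A \<inter> A')"
    unfolding determined_by_def by (metis (no_types, lifting) IntD1 IntD2 IntI UnI1 UnI2 inf.coboundedI1)
  with \<B> \<B>' show ?thesis by (auto simp: cylinders_def intro!: exI[of _ "\<B> \<union> \<B>'"])
qed

lemma cylinder_Un:
  assumes "A \<in> cylinders n" "A' \<in> cylinders n"
  shows "A \<union> A' \<in> cylinders n"
proof -
  have "A \<subseteq> space (samples n)" "A' \<subseteq> space (samples n)"
    using assms by (auto simp: cylinders_def determined_by_def)
  then have "A \<union> A' = space (samples n) - ((space (samples n) - A) \<inter> (space (samples n) - A'))"
    by blast
  then show ?thesis using assms by (simp add: cylinder_Diff cylinder_Int)
qed

lemma borel_partition:
  assumes "finite \<B>" "\<B> \<subseteq> sets (borel :: 'a::topological_space measure)"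
  shows "\<exists>\<P>. finite \<P> \<and> \<P> \<subseteq> sets borel \<and> disjoint \<P> \<and> \<Union>\<P> = UNIV \<and>
    (\<forall>B\<in>\<B>. B = \<Union>{P\<in>\<P>. P \<subseteq> B})"
proof -
  define atom where "atom x = {y. \<forall>B\<in>\<B>. y \<in> B \<longleftrightarrow> x \<in> B}" for x
  have "atom x = (\<lambda>S. {y. \<forall>B\<in>\<B>. y \<in> B \<longleftrightarrow> B \<in> S}) {B\<in>\<B>. x \<in> B}" for x
    by (auto simp: atom_def)
  then have "range atom \<subseteq> (\<lambda>S. {y. \<forall>B\<in>\<B>. y \<in> B \<longleftrightarrow> B \<in> S}) ` Pow \<B>"
    by blast
  then have "finite (range atom)"
    using finite_subset assms(1) by blast
  moreover have "atom x \<in> sets borel" for x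
  proof -
    have "atom x = (\<Inter>B\<in>\<B>. if x \<in> B then B else - B) \<inter> UNIV"
      by (auto simp: atom_def split: if_splits)
    also have "\<dots> \<in> sets borel"
    proof (cases "\<B> = {}")
      case False
      have "(\<Inter>B\<in>\<B>. if x \<in> B then B else - B) \<in> sets borel"
        using assms by (intro sets.finite_INT False) (auto split: if_splits)
      then show ?thesis by simp
    qed simp
    finally show ?thesis .
  qed
  moreover have "disjoint (range atom)"
    by (auto simp: disjoint_def atom_def)
  moreover have "x \<in> atom x" for x by (simp add: atom_def)
  moreover have "x \<in> B \<Longrightarrow> B \<in> \<B> \<Longrightarrow> atom x \<subseteq> B" for x B by (auto simp: atom_def)
  ultimately show ?thesis
    by (intro exI[of _ "range atom"]) blast
qed

text \<open>
  The counts of the atoms of the finite algebra generated by \<open>\<B>\<close> determine the counts of the sets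
  in \<open>\<B>\<close>. For disjoint sets the counts are independent, which gives the law explicitly.
\<close>

lemma cylinder_partition:
  assumes "A \<in> cylinders n"
  shows "\<exists>\<P>. finite \<P> \<and> \<P> \<subseteq> sets borel \<and> disjoint \<P> \<and> \<Union>\<P> = UNIV \<and> determined_by n \<P> A"
proof -
  from assms obtain \<B> where \<B>: "finite \<B>" "\<B> \<subseteq> sets borel" "determined_by n \<B> A"
    by (auto simp: cylinders_def)
  obtain \<P> where \<P>: "finite \<P>" "\<P> \<subseteq> sets borel" "disjoint \<P>" "\<Union>\<P> = UNIV"
    "\<And>B. B \<in> \<B> \<Longrightarrow> B = \<Union>{P\<in>\<P>. P \<subseteq> B}"
    using borel_partition[OF \<B>(1,2)] by metis
  have sum: "measure \<nu> B = (\<Sum>P\<in>{P\<in>\<P>. P \<subseteq> B}. measure \<nu> P)" if "\<nu> \<in> finite_measures" "B \<in> \<B>" for \<nu> B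
  proof -
    interpret finite_measure \<nu> using finite_measuresD(3)[OF that(1)] .
    have "measure \<nu> (\<Union>P\<in>{P\<in>\<P>. P \<subseteq> B}. P) = (\<Sum>P\<in>{P\<in>\<P>. P \<subseteq> B}. measure \<nu> P)"
      using \<P> finite_measuresD(1)[OF that(1)]
      by (intro finite_measure_finite_Union) (auto simp: disjoint_family_on_def disjoint_def)
    then show ?thesis using \<P>(5)[OF that(2)] by simp
  qed
  have "determined_by n \<P> A"
    unfolding determined_by_def
  proof (intro conjI ballI impI)
    show "A \<subseteq> space (samples n)" using \<B>(3) by (simp add: determined_by_def)
    fix x y assume xy: "x \<in> A" "y \<in> space (samples n)" "\<forall>i<n. \<forall>B\<in>\<P>. measure (x i) B = measure (y i) B"
    then have x: "x \<in> space (samples n)" using \<B>(3) by (auto simp: determined_by_def)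
    have "measure (x i) B = measure (y i) B" if "i < n" "B \<in> \<B>" for i B
    proof -
      have "x i \<in> finite_measures" "y i \<in> finite_measures"
        using x xy(2) \<open>i < n\<close> by (auto simp: space_samples PiE_iff intro!: counting_measuresD(1))
      then show ?thesis using xy(3) that by (simp add: sum)
    qed
    then show "y \<in> A" using \<B>(3) xy unfolding determined_by_def by blast
  qed
  with \<P> show ?thesis by blast
qed

definition count_atom :: "nat \<Rightarrow> 'a::topological_space set set \<Rightarrow> (nat \<times> 'a set \<Rightarrow> nat) \<Rightarrow> (nat \<Rightarrow> 'a measure) set" where
  "count_atom n \<P> c = {x \<in> space (samples n). \<forall>i<n. \<forall>B\<in>\<P>. measure (x i) B = real (c (i, B))}"

lemma count_atom_sets:
  assumes "finite \<P>" "\<P> \<subseteq> sets borel"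
  shows "count_atom n \<P> c \<in> sets (samples n)"
proof -
  have "{x \<in> space (samples n). measure (x i) B = real k} \<in> sets (samples n)"
    if "i < n" "B \<in> \<P>" for i B k
  proof -
    have "(\<lambda>x. measure (x i) B) \<in> borel_measurable (samples n)"
      using that assms(2) by (intro measurable_sample_count) auto
    then show ?thesis by measurable
  qed
  then have "{x \<in> space (samples n). \<forall>i\<in>{..<n}. \<forall>B\<in>\<P>. measure (x i) B = real (c (i, B))} \<in> sets (samples n)"
    by (intro sets.sets_Collect_finite_All assms(1)) auto
  moreover have "count_atom n \<P> c = {x \<in> space (samples n). \<forall>i\<in>{..<n}. \<forall>B\<in>\<P>. measure (x i) B = real (c (i, B))}"
    unfolding count_atom_def by blast
  ultimately show ?thesis by (simp only:)
qed

text \<open>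
  The counts are natural numbers, hence only countably many values of the count vector occur.
\<close>

lemma cylinder_atoms:
  assumes "finite \<P>" "\<P> \<subseteq> sets borel" "determined_by n \<P> A"
  shows "\<exists>S. countable S \<and> S \<subseteq> ({..<n} \<times> \<P> \<rightarrow>\<^sub>E UNIV) \<and> A = (\<Union>c\<in>S. count_atom n \<P> c) \<and>
    disjoint_family_on (count_atom n \<P>) S \<and> (\<forall>c\<in>S. count_atom n \<P> c \<noteq> {})"
proof -
  define X where "X x = (\<lambda>(i, B)\<in>{..<n} \<times> \<P>. nat \<lfloor>measure (x i) B\<rfloor>)" for x :: "nat \<Rightarrow> 'a measure"
  have X: "measure (x i) B = real (X x (i, B))" if "x \<in> space (samples n)" "i < n" "B \<in> \<P>" for x i B
  proof -
    have "x i \<in> counting_measures" using that by (auto simp: space_samples)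
    moreover have "B \<in> sets borel" using that assms(2) by blast
    ultimately obtain k where "measure (x i) B = real k" using counting_measuresD(2)[of "x i" B] by auto
    then show ?thesis using that by (simp add: X_def)
  qed
  have A: "A \<subseteq> space (samples n)" using assms(3) by (simp add: determined_by_def)
  have atomX: "x \<in> count_atom n \<P> (X x)" if "x \<in> space (samples n)" for x
    using that X by (auto simp: count_atom_def)
  have "X x \<in> ({..<n} \<times> \<P> \<rightarrow>\<^sub>E UNIV)" for x
    unfolding X_def by (subst restrict_PiE_iff) auto
  then have sub: "X ` A \<subseteq> ({..<n} \<times> \<P> \<rightarrow>\<^sub>E UNIV)" by blast
  have "countable ({..<n} \<times> \<P> \<rightarrow>\<^sub>E (UNIV :: nat set))"
    using assms(1) by (intro countable_PiE) auto
  then have "countable (X ` A)" using sub countable_subset by blast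
  moreover have "A = (\<Union>c\<in>X ` A. count_atom n \<P> c)"
  proof (intro equalityI subsetI)
    fix y assume "y \<in> (\<Union>c\<in>X ` A. count_atom n \<P> c)"
    then obtain x where x: "x \<in> A" "y \<in> count_atom n \<P> (X x)" by auto
    then have "\<forall>i<n. \<forall>B\<in>\<P>. measure (x i) B = measure (y i) B" "y \<in> space (samples n)"
      using X A by (auto simp: count_atom_def)
    then show "y \<in> A" using x(1) assms(3) unfolding determined_by_def by blast
  qed (use atomX A in blast)
  moreover have "disjoint_family_on (count_atom n \<P>) (X ` A)"
    unfolding disjoint_family_on_def
  proof (intro ballI impI)
    fix c c' assume cc: "c \<in> X ` A" "c' \<in> X ` A" "c \<noteq> c'"
    then obtain p where "p \<in> {..<n} \<times> \<P>" "c p \<noteq> c' p"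
      using PiE_ext[OF subsetD[OF sub cc(1)] subsetD[OF sub cc(2)]] by blast
    then show "count_atom n \<P> c \<inter> count_atom n \<P> c' = {}"
      by (force simp: count_atom_def)
  qed
  moreover have "\<forall>c\<in>X ` A. count_atom n \<P> c \<noteq> {}" using atomX A by blast
  ultimately show ?thesis using sub by (intro exI[of _ "X ` A"]) simp
qed

lemma cylinder_sets: "cylinders n \<subseteq> sets (samples n)"
proof
  fix A :: "(nat \<Rightarrow> 'a measure) set" assume "A \<in> cylinders n"
  then obtain \<B> where \<B>: "finite \<B>" "\<B> \<subseteq> sets borel" "determined_by n \<B> A"
    by (auto simp: cylinders_def)
  from cylinder_atoms[OF this] obtain S where "countable S" "A = (\<Union>c\<in>S. count_atom n \<B> c)" by blast
  then show "A \<in> sets (samples n)"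
    using count_atom_sets[OF \<B>(1,2)] by (auto intro: sets.countable_UN')
qed

text \<open>
  The evaluations that generate the \<open>\<sigma>\<close>-field of configurations have countably many values, and the sets
  on which such a value is taken are cylinder events.
\<close>

lemma sets_samples:
  "sets (samples n :: (nat \<Rightarrow> 'a::topological_space measure) measure) = sigma_sets (space (samples n)) (cylinders n)"
proof
  have sub: "cylinders n \<subseteq> Pow (space (samples n :: (nat \<Rightarrow> 'a measure) measure))"
    by (auto simp: cylinders_def determined_by_def)
  define G :: "(nat \<Rightarrow> 'a measure) measure" where "G = sigma (space (samples n)) (cylinders n)"
  have G: "space G = space (samples n)" "sets G = sigma_sets (space (samples n)) (cylinders n)"
    unfolding G_def by (simp_all add: space_measure_of_conv sets_measure_of[OF sub])
  have count: "(\<lambda>x. emeasure (x i) B) \<in> borel_measurable G" if "i < n" "B \<in> sets borel" for i B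
  proof -
    have eq: "emeasure (x i) B = ennreal (real (nat \<lfloor>measure (x i) B\<rfloor>))" "measure (x i) B = real (nat \<lfloor>measure (x i) B\<rfloor>)"
      if "x \<in> space G" for x
    proof -
      have x: "x i \<in> counting_measures" using that \<open>i < n\<close> by (auto simp: G space_samples)
      obtain k where k: "measure (x i) B = real k" using counting_measuresD(2)[OF x \<open>B \<in> sets borel\<close>] by blast
      interpret finite_measure "x i" using finite_measuresD(3)[OF counting_measuresD(1)[OF x]] .
      show "emeasure (x i) B = ennreal (real (nat \<lfloor>measure (x i) B\<rfloor>))" "measure (x i) B = real (nat \<lfloor>measure (x i) B\<rfloor>)"
        using k by (simp_all add: emeasure_eq_measure)
    qed
    have "(\<lambda>x. nat \<lfloor>measure (x i) B\<rfloor>) \<in> measurable G (count_space UNIV)"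
      unfolding measurable_count_space_eq2_countable
    proof (intro conjI ballI)
      fix k :: nat
      have "determined_by n {B} ((\<lambda>x. nat \<lfloor>measure (x i) B\<rfloor>) -` {k} \<inter> space G)"
        using \<open>i < n\<close> unfolding determined_by_def G by auto
      then have "(\<lambda>x. nat \<lfloor>measure (x i) B\<rfloor>) -` {k} \<inter> space G \<in> cylinders n"
        unfolding cylinders_def using that by (auto intro!: exI[of _ "{B}"])
      then show "(\<lambda>x. nat \<lfloor>measure (x i) B\<rfloor>) -` {k} \<inter> space G \<in> sets G"
        by (simp add: G)
    qed auto
    then have "(\<lambda>x. ennreal (real (nat \<lfloor>measure (x i) B\<rfloor>))) \<in> borel_measurable G"
      by measurable
    then show ?thesis
      by (subst measurable_cong[OF eq(1)])
  qed
  have "(\<lambda>x. x) \<in> measurable G (samples n)"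
  proof (rule measurable_PiM_single')
    show "(\<lambda>x. x) \<in> space G \<rightarrow> (\<Pi>\<^sub>E i\<in>{..<n}. space config_space)"
      by (auto simp: G space_PiM)
    fix i assume "i \<in> {..<n}"
    then have i: "i < n" by simp
    show "(\<lambda>x. x i) \<in> measurable G config_space"
      unfolding config_space_def
    proof (rule measurable_SUP2)
      fix B :: "'a set" assume "B \<in> sets borel"
      then show "(\<lambda>x. x i) \<in> measurable G (vimage_algebra counting_measures (\<lambda>\<nu>. emeasure \<nu> B) borel)"
        using i by (intro measurable_vimage_algebra2 count) (auto simp: G space_samples)
    qed auto
  qed
  then have id: "(\<lambda>x. x) -` A \<inter> space G \<in> sets G" if "A \<in> sets (samples n)" for A
    using that by (rule measurable_sets)
  show "sets (samples n :: (nat \<Rightarrow> 'a measure) measure) \<subseteq> sigma_sets (space (samples n)) (cylinders n)"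
  proof
    fix A :: "(nat \<Rightarrow> 'a measure) set" assume A: "A \<in> sets (samples n)"
    then have "(\<lambda>x. x) -` A \<inter> space G = A" using sets.sets_into_space[OF A] by (auto simp: G)
    with id[OF A] show "A \<in> sigma_sets (space (samples n)) (cylinders n)" by (simp add: G)
  qed
  show "sigma_sets (space (samples n)) (cylinders n) \<subseteq> sets (samples n :: (nat \<Rightarrow> 'a measure) measure)"
    by (rule sets.sigma_sets_subset[OF cylinder_sets])
qed

section \<open>The law of a Poisson sample\<close>

definition poisson_weight :: "real \<Rightarrow> nat \<Rightarrow> real" where
  "poisson_weight m k = m ^ k / fact k * exp (- m)"

abbreviation atom_weight :: "nat \<Rightarrow> 'a set set \<Rightarrow> 'a measure \<Rightarrow> (nat \<times> 'a set \<Rightarrow> nat) \<Rightarrow> real" where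
  "atom_weight n \<P> \<mu> c \<equiv> \<Prod>i<n. \<Prod>B\<in>\<P>. poisson_weight (measure \<mu> B) (c (i, B))"

lemma poisson_weight_nonneg: "0 \<le> m \<Longrightarrow> 0 \<le> poisson_weight m k"
  by (simp add: poisson_weight_def)

lemma poisson_process_joint_counts:
  assumes "prob_space P" and pp: "poisson_process P \<xi> \<mu>"
    and \<P>: "finite \<P>" "\<P> \<subseteq> sets borel" "disjoint \<P>"
  shows "measure P {s \<in> space P. \<forall>B\<in>\<P>. measure (\<xi> s) B = real (c B)} = (\<Prod>B\<in>\<P>. poisson_weight (measure \<mu> B) (c B))"
proof (cases "\<P> = {}")
  case True
  then show ?thesis using prob_space.prob_space[OF assms(1)] by simp
next
  case False
  interpret prob_space P by fact
  define m where "m = card \<P>"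
  obtain b where b: "bij_betw b {..<m} \<P>"
    using ex_bij_betw_nat_finite[OF \<P>(1)] by (auto simp: m_def atLeast0LessThan)
  then have b\<P>: "b i \<in> \<P>" if "i < m" for i using that by (auto simp: bij_betw_def)
  have "disjoint_family_on b {..<m}"
    unfolding disjoint_family_on_def
    using b\<P> inj_onD[OF bij_betw_imp_inj_on[OF b]] disjointD[OF \<P>(3)] by (metis lessThan_iff)
  then have ind: "indep_vars (\<lambda>_. borel) (\<lambda>i s. measure (\<xi> s) (b i)) {..<m}"
    using pp b\<P> \<P>(2) unfolding poisson_process_def by (meson lessThan_iff subsetD)
  have "{..<m} \<noteq> {}" using b False by (auto simp: bij_betw_def)
  have \<P>b: "\<P> = b ` {..<m}" using b by (simp add: bij_betw_def)
  have "{s \<in> space P. \<forall>B\<in>\<P>. measure (\<xi> s) B = real (c B)}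
      = (\<Inter>i\<in>{..<m}. (\<lambda>s. measure (\<xi> s) (b i)) -` {real (c (b i))} \<inter> space P)"
    using \<open>{..<m} \<noteq> {}\<close> unfolding \<P>b by auto
  also have "prob \<dots> = (\<Prod>i<m. prob ((\<lambda>s. measure (\<xi> s) (b i)) -` {real (c (b i))} \<inter> space P))"
    using \<open>{..<m} \<noteq> {}\<close> by (intro indep_varsD_finite[OF ind]) auto
  also have "\<dots> = (\<Prod>i<m. poisson_weight (measure \<mu> (b i)) (c (b i)))"
  proof (rule prod.cong[OF refl])
    fix i assume "i \<in> {..<m}"
    then have "b i \<in> sets borel" using b\<P> \<P>(2) by auto
    moreover have "(\<lambda>s. measure (\<xi> s) (b i)) -` {real (c (b i))} \<inter> space P
        = {s \<in> space P. measure (\<xi> s) (b i) = real (c (b i))}" by auto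
    ultimately show "prob ((\<lambda>s. measure (\<xi> s) (b i)) -` {real (c (b i))} \<inter> space P) = poisson_weight (measure \<mu> (b i)) (c (b i))"
      using pp unfolding poisson_process_def poisson_weight_def by simp
  qed
  also have "\<dots> = (\<Prod>B\<in>\<P>. poisson_weight (measure \<mu> B) (c B))"
    by (rule prod.reindex_bij_betw[OF b])
  finally show ?thesis .
qed

text \<open>
  Blocks of later observations are subsamples as well as the sample itself, so that one statement
  about laws covers all of them.
\<close>

definition subsample :: "(nat \<Rightarrow> 's \<Rightarrow> 'a measure) \<Rightarrow> (nat \<Rightarrow> nat) \<Rightarrow> nat \<Rightarrow> 's \<Rightarrow> nat \<Rightarrow> 'a measure" where
  "subsample \<kappa> \<sigma> n s = (\<lambda>i\<in>{..<n}. \<kappa> (\<sigma> i) s)"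

lemma sample_eq_subsample: "sample \<kappa> n = subsample \<kappa> (\<lambda>i. i) n"
  by (simp add: fun_eq_iff sample_def subsample_def)

locale poisson_model =
  fixes Pr :: "'a::topological_space measure \<Rightarrow> 's measure" and \<kappa> :: "nat \<Rightarrow> 's \<Rightarrow> 'a measure"
  assumes model: "poisson_sampling Pr \<kappa>"
begin

lemma
  assumes "\<mu> \<in> finite_measures"
  shows prob_space_Pr: "prob_space (Pr \<mu>)"
    and indep_observations: "prob_space.indep_vars (Pr \<mu>) (\<lambda>_. config_space) \<kappa> UNIV"
    and poisson_observation: "poisson_process (Pr \<mu>) (\<kappa> i) \<mu>"
    and measurable_observation: "\<kappa> i \<in> measurable (Pr \<mu>) config_space"
  using model assms by (auto simp: poisson_sampling_def poisson_process_def)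

lemma measurable_subsample:
  assumes "\<mu> \<in> finite_measures"
  shows "subsample \<kappa> \<sigma> n \<in> measurable (Pr \<mu>) (samples n)"
  unfolding subsample_def by (intro measurable_restrict measurable_observation assms)

lemma subsample_in_space:
  assumes "\<mu> \<in> finite_measures" "s \<in> space (Pr \<mu>)"
  shows "subsample \<kappa> \<sigma> n s \<in> space (samples n)"
  using measurable_space[OF measurable_subsample[OF assms(1)] assms(2)] .

definition sample_law :: "'a measure \<Rightarrow> nat \<Rightarrow> (nat \<Rightarrow> 'a measure) measure" where
  "sample_law \<mu> n = distr (Pr \<mu>) (samples n) (sample \<kappa> n)"

lemma subsample_atom_probability:
  assumes \<mu>: "\<mu> \<in> finite_measures" and "inj \<sigma>"
    and \<P>: "finite \<P>" "\<P> \<subseteq> sets borel" "disjoint \<P>"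
  shows "emeasure (distr (Pr \<mu>) (samples n) (subsample \<kappa> \<sigma> n)) (count_atom n \<P> c)
    = ennreal (atom_weight n \<P> \<mu> c)"
proof -
  interpret prob_space "Pr \<mu>" by (rule prob_space_Pr[OF \<mu>])
  note [measurable] = measurable_observation[OF \<mu>]
  define E where "E i = {\<nu> \<in> space config_space. \<forall>B\<in>\<P>. measure \<nu> B = real (c (i, B))}" for i
  have E: "E i \<in> sets config_space" for i
    unfolding E_def
    by (intro sets.sets_Collect_finite_All \<P>(1)) (use \<P>(2) measurable_count in \<open>auto intro!: borel_measurable_eq\<close>)
  have pre: "\<kappa> j -` E i \<inter> space (Pr \<mu>) = {s \<in> space (Pr \<mu>). \<forall>B\<in>\<P>. measure (\<kappa> j s) B = real (c (i, B))}" for i j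
    using measurable_space[OF measurable_observation[OF \<mu>]] by (auto simp: E_def)
  have "emeasure (distr (Pr \<mu>) (samples n) (subsample \<kappa> \<sigma> n)) (count_atom n \<P> c)
      = emeasure (Pr \<mu>) (subsample \<kappa> \<sigma> n -` count_atom n \<P> c \<inter> space (Pr \<mu>))"
    by (intro emeasure_distr measurable_subsample \<mu> count_atom_sets \<P>)
  also have "subsample \<kappa> \<sigma> n -` count_atom n \<P> c \<inter> space (Pr \<mu>) =
      {s \<in> space (Pr \<mu>). \<forall>i<n. s \<in> \<kappa> (\<sigma> i) -` E i \<inter> space (Pr \<mu>)}"
    using subsample_in_space[OF \<mu>, of _ \<sigma> n] by (auto simp: count_atom_def pre subsample_def)
  also have "emeasure (Pr \<mu>) \<dots> = ennreal (\<Prod>i<n. prob (\<kappa> (\<sigma> i) -` E i \<inter> space (Pr \<mu>)))"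
  proof (cases "n = 0")
    case True
    then show ?thesis by (simp add: emeasure_space_1)
  next
    case False
    define E' where "E' j = E (inv \<sigma> j)" for j
    have E': "E' (\<sigma> i) = E i" for i using \<open>inj \<sigma>\<close> by (simp add: E'_def)
    have "{s \<in> space (Pr \<mu>). \<forall>i<n. s \<in> \<kappa> (\<sigma> i) -` E i \<inter> space (Pr \<mu>)}
        = (\<Inter>j\<in>\<sigma> ` {..<n}. \<kappa> j -` E' j \<inter> space (Pr \<mu>))"
      using False by (auto simp: E')
    also have "prob \<dots> = (\<Prod>j\<in>\<sigma> ` {..<n}. prob (\<kappa> j -` E' j \<inter> space (Pr \<mu>)))"
      using False by (intro indep_varsD[OF indep_observations[OF \<mu>]]) (auto simp: E'_def E lessThan_empty_iff)
    also have "\<dots> = (\<Prod>i<n. prob (\<kappa> (\<sigma> i) -` E i \<inter> space (Pr \<mu>)))"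
      using inj_on_subset[OF \<open>inj \<sigma>\<close>] by (subst prod.reindex) (auto simp: E')
    finally show ?thesis by (simp add: emeasure_eq_measure)
  qed
  also have "(\<Prod>i<n. prob (\<kappa> (\<sigma> i) -` E i \<inter> space (Pr \<mu>)))
      = (atom_weight n \<P> \<mu> c)"
    unfolding pre
    by (intro prod.cong refl poisson_process_joint_counts[OF prob_space_axioms poisson_observation[OF \<mu>] \<P>, of _ "\<lambda>B. c (_, B)"])
  finally show ?thesis .
qed

text \<open>
  On count atoms both laws are the same product of Poisson weights, and a
  cylinder event is a countable disjoint union of atoms. The cylinder events generate the \<open>\<sigma>\<close>-field.
\<close>

lemma subsample_law:
  assumes \<mu>: "\<mu> \<in> finite_measures" and "inj \<sigma>"
  shows "distr (Pr \<mu>) (samples n) (subsample \<kappa> \<sigma> n) = sample_law \<mu> n"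
proof (rule measure_eqI_generator_eq[where E = "cylinders n" and \<Omega> = "space (samples n)" and A = "\<lambda>_. space (samples n)"])
  interpret prob_space "Pr \<mu>" by (rule prob_space_Pr[OF \<mu>])
  show "Int_stable (cylinders n)" by (auto simp: Int_stable_def cylinder_Int)
  show "cylinders n \<subseteq> Pow (space (samples n))" by (auto simp: cylinders_def determined_by_def)
  fix A :: "(nat \<Rightarrow> 'a measure) set" assume "A \<in> cylinders n"
  then obtain \<P> where \<P>: "finite \<P>" "\<P> \<subseteq> sets borel" "disjoint \<P>" "determined_by n \<P> A"
    using cylinder_partition[of A n] by auto
  from cylinder_atoms[OF \<P>(1,2,4)] obtain S where S: "countable S" "A = (\<Union>c\<in>S. count_atom n \<P> c)"
    "disjoint_family_on (count_atom n \<P>) S" by blast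
  have *: "emeasure (distr (Pr \<mu>) (samples n) (subsample \<kappa> \<sigma> n)) A
      = (\<integral>\<^sup>+c. ennreal (atom_weight n \<P> \<mu> c) \<partial>count_space S)"
    if "inj \<sigma>" for \<sigma>
    unfolding S(2)
    by (subst emeasure_UN_countable[OF _ S(1,3)])
      (simp_all add: count_atom_sets \<P> subsample_atom_probability[OF \<mu> that])
  show "emeasure (distr (Pr \<mu>) (samples n) (subsample \<kappa> \<sigma> n)) A = emeasure (sample_law \<mu> n) A"
    unfolding sample_law_def sample_eq_subsample using *[OF \<open>inj \<sigma>\<close>] *[of "\<lambda>i. i"] by simp
next
  interpret prob_space "Pr \<mu>" by (rule prob_space_Pr[OF \<mu>])
  show "emeasure (distr (Pr \<mu>) (samples n) (subsample \<kappa> \<sigma> n)) (space (samples n)) \<noteq> \<infinity>"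
    using finite_measure.emeasure_finite[OF finite_measure_distr[OF measurable_subsample[OF \<mu>]]] by simp
qed (auto simp: sets_samples[symmetric] sample_law_def cylinder_space)

lemma prob_space_sample_law: "\<mu> \<in> finite_measures \<Longrightarrow> prob_space (sample_law \<mu> n)"
  unfolding sample_law_def sample_eq_subsample
  by (intro prob_space.prob_space_distr prob_space_Pr measurable_subsample)

lemma sets_sample_law [simp]: "sets (sample_law \<mu> n) = sets (samples n)"
  and space_sample_law [simp]: "space (sample_law \<mu> n) = space (samples n)"
  by (simp_all add: sample_law_def)

lemma sample_law_atom:
  assumes "\<mu> \<in> finite_measures" "finite \<P>" "\<P> \<subseteq> sets borel" "disjoint \<P>"
  shows "emeasure (sample_law \<mu> n) (count_atom n \<P> c)
    = ennreal (atom_weight n \<P> \<mu> c)"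
  using subsample_atom_probability[OF assms(1) _ assms(2-4), of "\<lambda>i. i"]
  by (simp add: sample_law_def sample_eq_subsample)

lemma nn_integral_subsample:
  assumes "\<mu> \<in> finite_measures" "inj \<sigma>" "f \<in> borel_measurable (samples n)"
  shows "(\<integral>\<^sup>+s. f (subsample \<kappa> \<sigma> n s) \<partial>Pr \<mu>) = (\<integral>\<^sup>+x. f x \<partial>sample_law \<mu> n)"
  using assms by (subst subsample_law[OF assms(1,2), symmetric]) (simp add: nn_integral_distr measurable_subsample)

lemma nn_integral_sample:
  assumes "\<mu> \<in> finite_measures" "f \<in> borel_measurable (samples n)"
  shows "(\<integral>\<^sup>+s. f (sample \<kappa> n s) \<partial>Pr \<mu>) = (\<integral>\<^sup>+x. f x \<partial>sample_law \<mu> n)"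
  using nn_integral_subsample[OF assms(1) _ assms(2), of "\<lambda>i. i"] by (simp add: sample_eq_subsample)

end

section \<open>Exponential tail bounds\<close>

text \<open>
  Markov's inequality for the exponential of the sum, which factorizes by independence.
\<close>

lemma (in prob_space) exponential_Markov_indep:
  fixes Z :: "'i \<Rightarrow> 'a \<Rightarrow> real"
  assumes ind: "indep_vars (\<lambda>_. borel) Z I" and "finite I"
  shows "emeasure M {s \<in> space M. a \<le> (\<Sum>i\<in>I. Z i s)}
    \<le> ennreal (exp (- a)) * (\<Prod>i\<in>I. \<integral>\<^sup>+s. ennreal (exp (Z i s)) \<partial>M)"
proof -
  have [measurable]: "Z i \<in> borel_measurable M" if "i \<in> I" for i
    using ind that by (auto simp: indep_vars_def)
  have sum: "(\<lambda>s. \<Sum>i\<in>I. Z i s) \<in> borel_measurable M" by (intro borel_measurable_sum) auto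
  have prod: "(\<lambda>s. \<Prod>i\<in>I. ennreal (exp (Z i s))) \<in> borel_measurable M"
    by (intro borel_measurable_prod_ennreal) auto
  have "emeasure M {s \<in> space M. a \<le> (\<Sum>i\<in>I. Z i s)}
      = (\<integral>\<^sup>+s. indicator {s \<in> space M. a \<le> (\<Sum>i\<in>I. Z i s)} s \<partial>M)"
    using sum by (intro nn_integral_indicator[symmetric]) measurable
  also have "\<dots> \<le> (\<integral>\<^sup>+s. ennreal (exp (- a)) * (\<Prod>i\<in>I. ennreal (exp (Z i s))) \<partial>M)"
  proof (rule nn_integral_mono)
    fix s assume "s \<in> space M"
    have "(\<Prod>i\<in>I. ennreal (exp (Z i s))) = ennreal (exp (\<Sum>i\<in>I. Z i s))"
      by (simp add: prod_ennreal exp_sum \<open>finite I\<close>)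
    then have "ennreal (exp (- a)) * (\<Prod>i\<in>I. ennreal (exp (Z i s))) = ennreal (exp ((\<Sum>i\<in>I. Z i s) - a))"
      by (simp add: ennreal_mult[symmetric] exp_add[symmetric])
    then show "indicator {s \<in> space M. a \<le> (\<Sum>i\<in>I. Z i s)} s \<le> ennreal (exp (- a)) * (\<Prod>i\<in>I. ennreal (exp (Z i s)))"
      by (auto simp: indicator_def)
  qed
  also have "\<dots> = ennreal (exp (- a)) * (\<integral>\<^sup>+s. (\<Prod>i\<in>I. ennreal (exp (Z i s))) \<partial>M)"
    using prod by (rule nn_integral_cmult)
  also have "(\<integral>\<^sup>+s. (\<Prod>i\<in>I. ennreal (exp (Z i s))) \<partial>M) = (\<Prod>i\<in>I. \<integral>\<^sup>+s. ennreal (exp (Z i s)) \<partial>M)"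
    by (intro indep_vars_nn_integral \<open>finite I\<close> indep_vars_compose2[OF ind]) auto
  finally show ?thesis .
qed

definition block :: "(nat \<Rightarrow> 's \<Rightarrow> 'a measure) \<Rightarrow> nat \<Rightarrow> nat \<Rightarrow> 's \<Rightarrow> nat \<Rightarrow> 'a measure" where
  "block \<kappa> m j = subsample \<kappa> (\<lambda>i. j * m + i) m"

context poisson_model
begin

lemma indep_blocks:
  assumes \<mu>: "\<mu> \<in> finite_measures" and Z: "Z \<in> borel_measurable (samples m)"
  shows "prob_space.indep_vars (Pr \<mu>) (\<lambda>_. borel) (\<lambda>j s. Z (block \<kappa> m j s)) I"
proof -
  interpret prob_space "Pr \<mu>" by (rule prob_space_Pr[OF \<mu>])
  define J where "J j = {j * m..<j * m + m}" for j
  have disj: "disjoint_family J"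
  proof -
    have "j = j'" if "x \<in> J j" "x \<in> J j'" for x j j'
    proof -
      have "j = x div m" if "x \<in> J j" for j
        using that by (auto simp: J_def intro!: div_nat_eqI[symmetric] simp: mult.commute)
      then show ?thesis using that by blast
    qed
    then show ?thesis by (auto simp: disjoint_family_on_def)
  qed
  have "indep_vars (\<lambda>j. Pi\<^sub>M (J j) (\<lambda>_. config_space)) (\<lambda>j s. restrict (\<lambda>i. \<kappa> i s) (J j)) UNIV"
    using disj by (intro indep_vars_restrict[OF indep_observations[OF \<mu>]]) auto
  then have "indep_vars (\<lambda>j. Pi\<^sub>M (J j) (\<lambda>_. config_space)) (\<lambda>j s. restrict (\<lambda>i. \<kappa> i s) (J j)) I"
    by (rule indep_vars_subset) simp
  then have "indep_vars (\<lambda>_. borel) (\<lambda>j s. Z (\<lambda>i\<in>{..<m}. (restrict (\<lambda>i. \<kappa> i s) (J j)) (j * m + i))) I"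
  proof (rule indep_vars_compose2)
    fix j
    have "(\<lambda>x. \<lambda>i\<in>{..<m}. x (j * m + i)) \<in> measurable (Pi\<^sub>M (J j) (\<lambda>_. config_space)) (samples m)"
      by (intro measurable_restrict measurable_component_singleton) (auto simp: J_def)
    then show "(\<lambda>x. Z (\<lambda>i\<in>{..<m}. x (j * m + i))) \<in> borel_measurable (Pi\<^sub>M (J j) (\<lambda>_. config_space))"
      using Z by (rule measurable_compose)
  qed
  moreover have "(\<lambda>i\<in>{..<m}. (restrict (\<lambda>i. \<kappa> i s) (J j)) (j * m + i)) = block \<kappa> m j s" for j s
    by (auto simp: block_def subsample_def J_def fun_eq_iff)
  ultimately show ?thesis by simp
qed

lemma block_sum_tail:
  assumes \<mu>: "\<mu> \<in> finite_measures" and Z: "Z \<in> borel_measurable (samples m)"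
  shows "emeasure (Pr \<mu>) {s \<in> space (Pr \<mu>). a \<le> (\<Sum>j<r. Z (block \<kappa> m j s))}
    \<le> ennreal (exp (- a)) * (\<integral>\<^sup>+x. ennreal (exp (Z x)) \<partial>sample_law \<mu> m) ^ r"
proof -
  interpret prob_space "Pr \<mu>" by (rule prob_space_Pr[OF \<mu>])
  note [measurable] = Z
  have "(\<integral>\<^sup>+s. ennreal (exp (Z (block \<kappa> m j s))) \<partial>Pr \<mu>) = (\<integral>\<^sup>+x. ennreal (exp (Z x)) \<partial>sample_law \<mu> m)" for j
    unfolding block_def
    by (rule nn_integral_subsample[where f = "\<lambda>x. ennreal (exp (Z x))", OF \<mu>]) (auto intro: injI)
  then show ?thesis
    using exponential_Markov_indep[OF indep_blocks[OF \<mu> Z], of "{..<r}" a] by simp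
qed

text \<open>
  The exponential series in \<open>b * exp t\<close>, where \<open>b\<close> is the mean.
\<close>

lemma poisson_exponential_moment:
  assumes \<mu>: "\<mu> \<in> finite_measures" and B: "B \<in> sets borel"
  shows "(\<integral>\<^sup>+s. ennreal (exp (t * measure (\<kappa> i s) B)) \<partial>Pr \<mu>) = ennreal (exp (measure \<mu> B * (exp t - 1)))"
proof -
  interpret prob_space "Pr \<mu>" by (rule prob_space_Pr[OF \<mu>])
  define X where "X s = measure (\<kappa> i s) B" for s
  define b where "b = measure \<mu> B"
  have "b \<ge> 0" by (simp add: b_def)
  have [measurable]: "X \<in> borel_measurable (Pr \<mu>)"
    unfolding X_def using measurable_compose[OF measurable_observation[OF \<mu>] measurable_count[OF B]] .
  have X: "\<exists>k. X s = real k" if "s \<in> space (Pr \<mu>)" for s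
    using measurable_space[OF measurable_observation[OF \<mu>] that, of i] B
    unfolding X_def space_config_space by (intro counting_measuresD(2))
  have "(\<integral>\<^sup>+s. ennreal (exp (t * X s)) \<partial>Pr \<mu>)
      = (\<integral>\<^sup>+s. (\<Sum>k. ennreal (exp (t * real k)) * indicator {s \<in> space (Pr \<mu>). X s = real k} s) \<partial>Pr \<mu>)"
  proof (rule nn_integral_cong)
    fix s assume s: "s \<in> space (Pr \<mu>)"
    then obtain k where k: "X s = real k" using X by blast
    have "(\<Sum>k. ennreal (exp (t * real k)) * indicator {s \<in> space (Pr \<mu>). X s = real k} s)
        = (\<Sum>k\<in>{k}. ennreal (exp (t * real k)) * indicator {s \<in> space (Pr \<mu>). X s = real k} s)"
      using k by (intro suminf_finite) auto
    then show "ennreal (exp (t * X s)) = (\<Sum>k. ennreal (exp (t * real k)) * indicator {s \<in> space (Pr \<mu>). X s = real k} s)"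
      using k s by simp
  qed
  also have "\<dots> = (\<Sum>k. ennreal (exp (t * real k)) * emeasure (Pr \<mu>) {s \<in> space (Pr \<mu>). X s = real k})"
    by (subst nn_integral_suminf) (auto simp: nn_integral_cmult_indicator)
  also have "\<dots> = (\<Sum>k. ennreal ((b * exp t) ^ k / fact k * exp (- b)))"
  proof (rule suminf_cong)
    fix k
    have "emeasure (Pr \<mu>) {s \<in> space (Pr \<mu>). X s = real k} = ennreal (b ^ k / fact k * exp (- b))"
      using poisson_observation[OF \<mu>, of i] B by (simp add: emeasure_eq_measure poisson_process_def X_def b_def)
    then show "ennreal (exp (t * real k)) * emeasure (Pr \<mu>) {s \<in> space (Pr \<mu>). X s = real k}
        = ennreal ((b * exp t) ^ k / fact k * exp (- b))"
      by (simp add: ennreal_mult'[symmetric] power_mult_distrib exp_of_nat_mult[symmetric] mult_ac)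
  qed
  also have "\<dots> = ennreal (exp (b * exp t) * exp (- b))"
  proof (rule suminf_ennreal_eq)
    show "0 \<le> (b * exp t) ^ k / fact k * exp (- b)" for k using \<open>b \<ge> 0\<close> by simp
    show "(\<lambda>k. (b * exp t) ^ k / fact k * exp (- b)) sums (exp (b * exp t) * exp (- b))"
      using exp_converges[of "b * exp t"] by (intro sums_mult2) (simp add: scaleR_conv_of_real field_simps)
  qed
  also have "exp (b * exp t) * exp (- b) = exp (b * (exp t - 1))"
    by (simp add: exp_add[symmetric] algebra_simps)
  finally show ?thesis by (simp add: X_def b_def)
qed

lemma count_sum_tail:
  assumes \<mu>: "\<mu> \<in> finite_measures" and B: "B \<in> sets borel"
  shows "emeasure (Pr \<mu>) {s \<in> space (Pr \<mu>). a \<le> (\<Sum>j<n. t * measure (\<kappa> j s) B)}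
    \<le> ennreal (exp (real n * (measure \<mu> B * (exp t - 1)) - a))"
proof -
  interpret prob_space "Pr \<mu>" by (rule prob_space_Pr[OF \<mu>])
  have "indep_vars (\<lambda>_. borel) (\<lambda>j s. t * measure (\<kappa> j s) B) {..<n}"
    by (rule indep_vars_compose2[OF indep_vars_subset[OF indep_observations[OF \<mu>]]])
      (auto intro!: borel_measurable_times measurable_count B)
  from exponential_Markov_indep[OF this, of a]
  have "emeasure (Pr \<mu>) {s \<in> space (Pr \<mu>). a \<le> (\<Sum>j<n. t * measure (\<kappa> j s) B)}
    \<le> ennreal (exp (- a)) * ennreal (exp (measure \<mu> B * (exp t - 1))) ^ n"
    by (simp add: poisson_exponential_moment[OF \<mu> B])
  also have "\<dots> = ennreal (exp (real n * (measure \<mu> B * (exp t - 1)) - a))"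
    by (simp add: ennreal_power ennreal_mult[symmetric] exp_of_nat_mult[symmetric] exp_add[symmetric])
  finally show ?thesis .
qed

definition sample_mean :: "nat \<Rightarrow> 'a set \<Rightarrow> (nat \<Rightarrow> 'a measure) \<Rightarrow> real" where
  "sample_mean n B x = (\<Sum>j<n. measure (x j) B) / real n"

lemma sample_mean_sum:
  "real n * sample_mean n B (sample \<kappa> n s) = (\<Sum>j<n. measure (\<kappa> j s) B)"
  by (simp add: sample_mean_def sample_def)

lemma exp_quadratic_bounds:
  fixes t :: real
  assumes "0 \<le> t" "t \<le> 1"
  shows "\<bar>exp t - 1 - t\<bar> \<le> t\<^sup>2" "\<bar>exp (- t) - 1 + t\<bar> \<le> t\<^sup>2"
proof -
  show "\<bar>exp t - 1 - t\<bar> \<le> t\<^sup>2"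
    using exp_bound[OF assms] exp_ge_add_one_self[of t] by linarith
  have "0 \<le> t ^ 3" using assms by simp
  then have "1 \<le> (1 - t + t\<^sup>2) * (1 + t)" by (simp add: algebra_simps power2_eq_square power3_eq_cube)
  also have "\<dots> \<le> (1 - t + t\<^sup>2) * exp t"
    using assms by (intro mult_left_mono) auto
  finally have "exp (- t) \<le> 1 - t + t\<^sup>2" by (simp add: exp_minus field_simps)
  then show "\<bar>exp (- t) - 1 + t\<bar> \<le> t\<^sup>2"
    using exp_ge_add_one_self[of "- t"] by linarith
qed

definition deviation_rate :: "real \<Rightarrow> real \<Rightarrow> real \<Rightarrow> bool" where
  "deviation_rate \<rho> h a \<longleftrightarrow> (\<forall>\<mu>\<in>finite_measures. \<forall>B\<in>sets borel. \<forall>n.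
    (measure \<mu> B \<le> a \<longrightarrow> emeasure (Pr \<mu>) {s \<in> space (Pr \<mu>). a + h \<le> sample_mean n B (sample \<kappa> n s)} \<le> ennreal (exp (- \<rho> * n))) \<and>
    (a \<le> measure \<mu> B \<longrightarrow> emeasure (Pr \<mu>) {s \<in> space (Pr \<mu>). sample_mean n B (sample \<kappa> n s) \<le> a - h} \<le> ennreal (exp (- \<rho> * n))))"

definition discrimination_rate :: "real \<Rightarrow> real \<Rightarrow> real \<Rightarrow> bool" where
  "discrimination_rate \<rho> a e \<longleftrightarrow> (\<forall>\<mu>\<in>finite_measures. \<forall>B\<in>sets borel. \<forall>n.
    (\<bar>measure \<mu> B - a\<bar> < e \<longrightarrow> emeasure (Pr \<mu>) {s \<in> space (Pr \<mu>). 3 / 2 * e \<le> \<bar>sample_mean n B (sample \<kappa> n s) - a\<bar>}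
      \<le> ennreal (2 * exp (- \<rho> * n))) \<and>
    (2 * e \<le> \<bar>measure \<mu> B - a\<bar> \<longrightarrow> emeasure (Pr \<mu>) {s \<in> space (Pr \<mu>). \<bar>sample_mean n B (sample \<kappa> n s) - a\<bar> < 3 / 2 * e}
      \<le> ennreal (2 * exp (- \<rho> * n))))"

text \<open>
  The exponents \<open>b * (exp t - 1)\<close> and \<open>b * (exp (- t) - 1)\<close> are monotone in the mean \<open>b\<close>, in the favourable direction
  for the upper and for the lower tail. So the rate at the threshold \<open>a\<close> serves all means on the relevant
  side of \<open>a\<close>, and unbounded means need no separate treatment.
\<close>

lemma sample_mean_deviation:
  assumes "h > 0"
  shows "\<exists>\<rho>>0. deviation_rate \<rho> h a"
proof -
  \<comment> \<open>With this \<open>t\<close> the quadratic error \<open>\<bar>a\<bar> * t\<^sup>2\<close> takes up at most half of the gain \<open>t * h\<close>.\<close>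
  define t where "t = min 1 (h / (2 * (\<bar>a\<bar> + 1)))"
  have t: "0 < t" "t \<le> 1" using assms by (auto simp: t_def)
  have "t \<le> h / (2 * (\<bar>a\<bar> + 1))" by (simp add: t_def)
  then have "t * (2 * (\<bar>a\<bar> + 1)) \<le> h" by (subst (asm) pos_le_divide_eq) auto
  then have "t * \<bar>a\<bar> \<le> h / 2" using t by (simp add: algebra_simps)
  then have "\<bar>a\<bar> * t\<^sup>2 \<le> t * h / 2"
    using mult_left_mono[of "t * \<bar>a\<bar>" "h / 2" t] t by (simp add: power2_eq_square mult_ac)
  then have quad: "a * x \<le> t * h / 2" if "\<bar>x\<bar> \<le> t\<^sup>2" for x
    using mult_left_mono[OF that, of "\<bar>a\<bar>"] by (simp flip: abs_mult)
  define \<rho> where "\<rho> = t * h / 2"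
  have "\<rho> > 0" using t assms by (simp add: \<rho>_def)
  show ?thesis
    unfolding deviation_rate_def
  proof (intro exI[of _ \<rho>] conjI ballI allI impI)
    fix \<mu> :: "'a measure" and B :: "'a set" and n :: nat
    assume \<mu>: "\<mu> \<in> finite_measures" and B: "B \<in> sets borel"
    interpret prob_space "Pr \<mu>" by (rule prob_space_Pr[OF \<mu>])
    have meas: "(\<lambda>s. \<Sum>j<n. u * measure (\<kappa> j s) B) \<in> borel_measurable (Pr \<mu>)" for u
      by (intro borel_measurable_sum borel_measurable_times borel_measurable_const
          measurable_compose[OF measurable_observation[OF \<mu>] measurable_count[OF B]])
    have ev: "{s \<in> space (Pr \<mu>). b \<le> (\<Sum>j<n. u * measure (\<kappa> j s) B)} \<in> sets (Pr \<mu>)" for b u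
      using meas by measurable
    {
      assume le: "measure \<mu> B \<le> a"
      have "emeasure (Pr \<mu>) {s \<in> space (Pr \<mu>). a + h \<le> sample_mean n B (sample \<kappa> n s)}
        \<le> emeasure (Pr \<mu>) {s \<in> space (Pr \<mu>). t * (n * (a + h)) \<le> (\<Sum>j<n. t * measure (\<kappa> j s) B)}"
        using t(1) by (intro emeasure_mono ev)
          (auto simp flip: sum_distrib_left sample_mean_sum intro!: mult_left_mono)
      also have "\<dots> \<le> ennreal (exp (n * (measure \<mu> B * (exp t - 1)) - t * (n * (a + h))))"
        by (rule count_sum_tail[OF \<mu> B])
      also have "\<dots> \<le> ennreal (exp (- \<rho> * n))"
      proof (intro ennreal_leI, simp only: exp_le_cancel_iff)
        have "measure \<mu> B * (exp t - 1) \<le> a * (exp t - 1)" using le t by (intro mult_right_mono) auto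
        also have "\<dots> - t * (a + h) = a * (exp t - 1 - t) - t * h" by (simp add: algebra_simps)
        finally have "measure \<mu> B * (exp t - 1) - t * (a + h) \<le> - \<rho>"
          using quad[OF exp_quadratic_bounds(1)] t unfolding \<rho>_def by (simp add: algebra_simps)
        from mult_left_mono[OF this, of "real n"]
        show "n * (measure \<mu> B * (exp t - 1)) - t * (n * (a + h)) \<le> - \<rho> * n"
          by (simp add: algebra_simps)
      qed
      finally show "emeasure (Pr \<mu>) {s \<in> space (Pr \<mu>). a + h \<le> sample_mean n B (sample \<kappa> n s)} \<le> ennreal (exp (- \<rho> * n))" .
    }
    {
      assume le: "a \<le> measure \<mu> B"
      have "emeasure (Pr \<mu>) {s \<in> space (Pr \<mu>). sample_mean n B (sample \<kappa> n s) \<le> a - h}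
        \<le> emeasure (Pr \<mu>) {s \<in> space (Pr \<mu>). (- t) * (n * (a - h)) \<le> (\<Sum>j<n. (- t) * measure (\<kappa> j s) B)}"
      proof (intro emeasure_mono ev Collect_mono impI, elim conjE, intro conjI)
        fix s assume "sample_mean n B (sample \<kappa> n s) \<le> a - h"
        then have "real n * sample_mean n B (sample \<kappa> n s) \<le> n * (a - h)" by (rule mult_left_mono) simp
        then have "(- t) * (n * (a - h)) \<le> (- t) * (real n * sample_mean n B (sample \<kappa> n s))"
          by (rule mult_left_mono_neg) (use t in simp)
        then show "(- t) * (n * (a - h)) \<le> (\<Sum>j<n. (- t) * measure (\<kappa> j s) B)"
          by (simp only: sample_mean_sum sum_distrib_left)
      qed
      also have "\<dots> \<le> ennreal (exp (n * (measure \<mu> B * (exp (- t) - 1)) - (- t) * (n * (a - h))))"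
        by (rule count_sum_tail[OF \<mu> B])
      also have "\<dots> \<le> ennreal (exp (- \<rho> * n))"
      proof (intro ennreal_leI, simp only: exp_le_cancel_iff)
        have "measure \<mu> B * (exp (- t) - 1) \<le> a * (exp (- t) - 1)" using le t by (intro mult_right_mono_neg) auto
        also have "\<dots> + t * (a - h) = a * (exp (- t) - 1 + t) - t * h" by (simp add: algebra_simps)
        finally have "measure \<mu> B * (exp (- t) - 1) + t * (a - h) \<le> - \<rho>"
          using quad[OF exp_quadratic_bounds(2)] t unfolding \<rho>_def by (simp add: algebra_simps)
        from mult_left_mono[OF this, of "real n"]
        show "n * (measure \<mu> B * (exp (- t) - 1)) - (- t) * (n * (a - h)) \<le> - \<rho> * n"
          by (simp add: algebra_simps)
      qed
      finally show "emeasure (Pr \<mu>) {s \<in> space (Pr \<mu>). sample_mean n B (sample \<kappa> n s) \<le> a - h} \<le> ennreal (exp (- \<rho> * n))" .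
    }
  qed fact
qed

text \<open>
  The level \<open>3/2 * e\<close> halves the gap between \<open>e\<close> and \<open>2 * e\<close>. Each of the four comparisons is a one-sided
  deviation by \<open>e / 2\<close> from one of \<open>a + e\<close>, \<open>a - e\<close>, \<open>a + 2 * e\<close>, \<open>a - 2 * e\<close>, whence a common rate.
\<close>

lemma sample_mean_discriminates:
  assumes "e > 0"
  shows "\<exists>\<rho>>0. discrimination_rate \<rho> a e"
proof -
  let ?dev = "\<lambda>\<rho> c. deviation_rate \<rho> (e / 2) c"
  have mono: "?dev \<rho>' c" if "?dev \<rho> c" "\<rho>' \<le> \<rho>" for \<rho> \<rho>' c
  proof -
    have "ennreal (exp (- \<rho> * n)) \<le> ennreal (exp (- \<rho>' * n))" for n :: nat
      using that(2) by (intro ennreal_leI) (simp add: mult_right_mono)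
    then show ?thesis using that(1) unfolding deviation_rate_def by (meson order_trans)
  qed
  have "\<exists>\<rho>>0. ?dev \<rho> c" for c
    using sample_mean_deviation[of "e / 2" c] assms by simp
  then obtain r where r: "\<And>c. r c > 0" "\<And>c. ?dev (r c) c" by metis
  define \<rho> where "\<rho> = Min (r ` {a + e, a - e, a + 2 * e, a - 2 * e})"
  have "\<rho> > 0" using r(1) by (auto simp: \<rho>_def)
  have dev: "?dev \<rho> c" if "c \<in> {a + e, a - e, a + 2 * e, a - 2 * e}" for c
    using that by (intro mono[OF r(2)]) (auto simp: \<rho>_def)
  show ?thesis
    unfolding discrimination_rate_def
  proof (intro exI[of _ \<rho>] conjI ballI allI impI)
    fix \<mu> :: "'a measure" and B :: "'a set" and n :: nat
    assume \<mu>: "\<mu> \<in> finite_measures" and B: "B \<in> sets borel"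
    define Y where "Y s = sample_mean n B (sample \<kappa> n s)" for s
    have "Y = (\<lambda>s. (\<Sum>j<n. measure (\<kappa> j s) B) / real n)"
      by (simp add: fun_eq_iff Y_def sample_mean_def sample_def)
    then have Y: "Y \<in> borel_measurable (Pr \<mu>)"
      by (auto intro!: borel_measurable_sum borel_measurable_divide measurable_compose[OF measurable_observation[OF \<mu>] measurable_count[OF B]])
    have Y_ge: "{s \<in> space (Pr \<mu>). c \<le> Y s} \<in> sets (Pr \<mu>)" for c using Y by measurable
    have Y_le: "{s \<in> space (Pr \<mu>). Y s \<le> c} \<in> sets (Pr \<mu>)" for c using Y by measurable
    have bound: "ennreal (exp (- \<rho> * n)) + ennreal (exp (- \<rho> * n)) = ennreal (2 * exp (- \<rho> * n))"
      by (simp add: ennreal_plus[symmetric] del: ennreal_plus)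
    have bound1: "ennreal (exp (- \<rho> * n)) \<le> ennreal (2 * exp (- \<rho> * n))"
      by (intro ennreal_leI) simp
    {
      assume close: "\<bar>measure \<mu> B - a\<bar> < e"
      have "{s \<in> space (Pr \<mu>). 3 / 2 * e \<le> \<bar>Y s - a\<bar>}
        \<subseteq> {s \<in> space (Pr \<mu>). (a + e) + e / 2 \<le> Y s} \<union> {s \<in> space (Pr \<mu>). Y s \<le> (a - e) - e / 2}"
      proof
        fix s assume "s \<in> {s \<in> space (Pr \<mu>). 3 / 2 * e \<le> \<bar>Y s - a\<bar>}"
        then have s: "s \<in> space (Pr \<mu>)" "3 / 2 * e \<le> \<bar>Y s - a\<bar>" by blast+
        from s(2) have "(a + e) + e / 2 \<le> Y s \<or> Y s \<le> (a - e) - e / 2" by linarith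
        with s(1) show "s \<in> {s \<in> space (Pr \<mu>). (a + e) + e / 2 \<le> Y s} \<union> {s \<in> space (Pr \<mu>). Y s \<le> (a - e) - e / 2}" by blast
      qed
      then have "emeasure (Pr \<mu>) {s \<in> space (Pr \<mu>). 3 / 2 * e \<le> \<bar>Y s - a\<bar>}
        \<le> emeasure (Pr \<mu>) ({s \<in> space (Pr \<mu>). (a + e) + e / 2 \<le> Y s} \<union> {s \<in> space (Pr \<mu>). Y s \<le> (a - e) - e / 2})"
        by (intro emeasure_mono sets.Un Y_ge Y_le)
      also have "\<dots> \<le> emeasure (Pr \<mu>) {s \<in> space (Pr \<mu>). (a + e) + e / 2 \<le> Y s} + emeasure (Pr \<mu>) {s \<in> space (Pr \<mu>). Y s \<le> (a - e) - e / 2}"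
        by (intro emeasure_subadditive Y_ge Y_le)
      also have "\<dots> \<le> ennreal (exp (- \<rho> * n)) + ennreal (exp (- \<rho> * n))"
      proof (intro add_mono)
        show "emeasure (Pr \<mu>) {s \<in> space (Pr \<mu>). (a + e) + e / 2 \<le> Y s} \<le> ennreal (exp (- \<rho> * n))"
          using dev[of "a + e"] close \<mu> B unfolding deviation_rate_def Y_def by (auto simp del: add_le_cancel_left)
        show "emeasure (Pr \<mu>) {s \<in> space (Pr \<mu>). Y s \<le> (a - e) - e / 2} \<le> ennreal (exp (- \<rho> * n))"
          using dev[of "a - e"] close \<mu> B unfolding deviation_rate_def Y_def by auto
      qed
      finally show "emeasure (Pr \<mu>) {s \<in> space (Pr \<mu>). 3 / 2 * e \<le> \<bar>sample_mean n B (sample \<kappa> n s) - a\<bar>} \<le> ennreal (2 * exp (- \<rho> * n))"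
        unfolding bound Y_def .
    }
    {
      assume far: "2 * e \<le> \<bar>measure \<mu> B - a\<bar>"
      have "emeasure (Pr \<mu>) {s \<in> space (Pr \<mu>). \<bar>Y s - a\<bar> < 3 / 2 * e} \<le> ennreal (exp (- \<rho> * n))"
      proof (cases "measure \<mu> B \<ge> a")
        case True
        with far have "a + 2 * e \<le> measure \<mu> B" by linarith
        then have "emeasure (Pr \<mu>) {s \<in> space (Pr \<mu>). Y s \<le> (a + 2 * e) - e / 2} \<le> ennreal (exp (- \<rho> * n))"
          using dev[of "a + 2 * e"] \<mu> B unfolding deviation_rate_def Y_def by auto
        moreover have "{s \<in> space (Pr \<mu>). \<bar>Y s - a\<bar> < 3 / 2 * e} \<subseteq> {s \<in> space (Pr \<mu>). Y s \<le> (a + 2 * e) - e / 2}"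
          by safe linarith
        ultimately show ?thesis using Y_le by (meson emeasure_mono order_trans)
      next
        case False
        with far have "measure \<mu> B \<le> a - 2 * e" by linarith
        then have "emeasure (Pr \<mu>) {s \<in> space (Pr \<mu>). (a - 2 * e) + e / 2 \<le> Y s} \<le> ennreal (exp (- \<rho> * n))"
          using dev[of "a - 2 * e"] \<mu> B unfolding deviation_rate_def Y_def by auto
        moreover have "{s \<in> space (Pr \<mu>). \<bar>Y s - a\<bar> < 3 / 2 * e} \<subseteq> {s \<in> space (Pr \<mu>). (a - 2 * e) + e / 2 \<le> Y s}"
          by safe linarith
        ultimately show ?thesis using Y_ge by (meson emeasure_mono order_trans)
      qed
      with bound1 show "emeasure (Pr \<mu>) {s \<in> space (Pr \<mu>). \<bar>sample_mean n B (sample \<kappa> n s) - a\<bar> < 3 / 2 * e} \<le> ennreal (2 * exp (- \<rho> * n))"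
        unfolding Y_def by (rule order_trans[rotated])
    }
  qed fact
qed

end

section \<open>Zero-one tests with summable error bounds\<close>

lemma measurable_test_function:
  "is_test n K \<Longrightarrow> K \<in> borel_measurable (samples n)"
  by (simp add: is_test_def)

context poisson_model
begin

abbreviation error_prob :: "'a measure \<Rightarrow> nat \<Rightarrow> ((nat \<Rightarrow> 'a measure) \<Rightarrow> real) \<Rightarrow> real \<Rightarrow> ennreal" where
  "error_prob \<mu> n K v \<equiv> emeasure (Pr \<mu>) {s \<in> space (Pr \<mu>). K (sample \<kappa> n s) \<noteq> v}"

text \<open>
  The bounds are required for all \<open>n\<close>. Bounds that hold from some \<open>n\<close> on fit in by
  putting \<open>\<epsilon> = 1\<close> before.
\<close>

definition zero_one_tests ::
    "'a measure set \<Rightarrow> 'a measure set \<Rightarrow> (nat \<Rightarrow> (nat \<Rightarrow> 'a measure) \<Rightarrow> real) \<Rightarrow> (nat \<Rightarrow> real) \<Rightarrow> bool" where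
  "zero_one_tests \<Theta>0 \<Theta>1 K \<epsilon> \<longleftrightarrow>
     (\<forall>n. is_test n (K n)) \<and> (\<forall>n x. K n x = 0 \<or> K n x = 1) \<and>
     (\<forall>n. \<forall>\<mu>\<in>\<Theta>0. error_prob \<mu> n (K n) 0 \<le> ennreal (\<epsilon> n)) \<and>
     (\<forall>n. \<forall>\<mu>\<in>\<Theta>1. error_prob \<mu> n (K n) 1 \<le> ennreal (\<epsilon> n))"

definition exponentially_separable :: "'a measure set \<Rightarrow> 'a measure set \<Rightarrow> bool" where
  "exponentially_separable \<Theta>0 \<Theta>1 \<longleftrightarrow> (\<exists>K A c. c > 0 \<and> zero_one_tests \<Theta>0 \<Theta>1 K (\<lambda>n. A * exp (- c * real n)))"

lemma zero_one_tests_swap: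
  assumes "zero_one_tests \<Theta>0 \<Theta>1 K \<epsilon>"
  shows "zero_one_tests \<Theta>1 \<Theta>0 (\<lambda>n x. 1 - K n x) \<epsilon>"
  using assms unfolding zero_one_tests_def is_test_def by (auto intro!: borel_measurable_diff)

lemma exponentially_separable_swap:
  "exponentially_separable \<Theta>0 \<Theta>1 \<Longrightarrow> exponentially_separable \<Theta>1 \<Theta>0"
  unfolding exponentially_separable_def using zero_one_tests_swap by blast

lemma measurable_test:
  assumes "\<mu> \<in> finite_measures" "is_test n K"
  shows "(\<lambda>s. K (sample \<kappa> n s)) \<in> borel_measurable (Pr \<mu>)"
  using measurable_compose[OF measurable_subsample[OF assms(1)] measurable_test_function[OF assms(2)]]
  by (simp add: sample_eq_subsample)

lemma test_event_sets:
  assumes "\<mu> \<in> finite_measures" "is_test n K"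
  shows "{s \<in> space (Pr \<mu>). K (sample \<kappa> n s) \<noteq> v} \<in> sets (Pr \<mu>)"
  using measurable_test[OF assms] by measurable

lemma zero_one_tests_alpha_beta:
  assumes K: "zero_one_tests \<Theta>0 \<Theta>1 K \<epsilon>" and sub: "\<Theta>0 \<subseteq> finite_measures" "\<Theta>1 \<subseteq> finite_measures"
  shows "test_alpha Pr \<kappa> \<Theta>0 n (K n) \<le> ennreal (\<epsilon> n)" "test_beta Pr \<kappa> \<Theta>1 n (K n) \<le> ennreal (\<epsilon> n)"
proof -
  have K01: "K n x = 0 \<or> K n x = 1" "is_test n (K n)" for x
    using K by (auto simp: zero_one_tests_def)
  have "(\<integral>\<^sup>+s. ennreal (K n (sample \<kappa> n s)) \<partial>Pr \<mu>) \<le> ennreal (\<epsilon> n)" if "\<mu> \<in> \<Theta>0" for \<mu>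
  proof -
    have "(\<integral>\<^sup>+s. ennreal (K n (sample \<kappa> n s)) \<partial>Pr \<mu>)
        = (\<integral>\<^sup>+s. indicator {s \<in> space (Pr \<mu>). K n (sample \<kappa> n s) \<noteq> 0} s \<partial>Pr \<mu>)"
      using K01(1) by (intro nn_integral_cong) (auto simp: indicator_def)
    also have "\<dots> \<le> ennreal (\<epsilon> n)"
      using K that sub K01 test_event_sets[of \<mu> n "K n" 0] by (auto simp: zero_one_tests_def)
    finally show ?thesis .
  qed
  then show "test_alpha Pr \<kappa> \<Theta>0 n (K n) \<le> ennreal (\<epsilon> n)"
    unfolding test_alpha_def by (rule SUP_least)
  have "(\<integral>\<^sup>+s. ennreal (1 - K n (sample \<kappa> n s)) \<partial>Pr \<mu>) \<le> ennreal (\<epsilon> n)" if "\<mu> \<in> \<Theta>1" for \<mu>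
  proof -
    have "(\<integral>\<^sup>+s. ennreal (1 - K n (sample \<kappa> n s)) \<partial>Pr \<mu>)
        = (\<integral>\<^sup>+s. indicator {s \<in> space (Pr \<mu>). K n (sample \<kappa> n s) \<noteq> 1} s \<partial>Pr \<mu>)"
      using K01(1) by (intro nn_integral_cong) (auto simp: indicator_def)
    also have "\<dots> \<le> ennreal (\<epsilon> n)"
      using K that sub K01 test_event_sets[of \<mu> n "K n" 1] by (auto simp: zero_one_tests_def)
    finally show ?thesis .
  qed
  then show "test_beta Pr \<kappa> \<Theta>1 n (K n) \<le> ennreal (\<epsilon> n)"
    unfolding test_beta_def by (rule SUP_least)
qed

lemma exponentially_separable_imp_tests:
  assumes sep: "exponentially_separable \<Theta>0 \<Theta>1"
    and sub: "\<Theta>0 \<subseteq> finite_measures" "\<Theta>1 \<subseteq> finite_measures"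
  shows "distinguishable Pr \<kappa> \<Theta>0 \<Theta>1"
    and "\<exists>K (c::real) (n0::nat). (\<forall>n. is_test n (K n)) \<and> c > 0 \<and>
           (\<forall>n>n0. test_alpha Pr \<kappa> \<Theta>0 n (K n) \<le> ennreal (exp (- c * real n)) \<and>
                   test_beta Pr \<kappa> \<Theta>1 n (K n) \<le> ennreal (exp (- c * real n)))"
proof -
  from sep obtain K A c where c: "c > 0" and K: "zero_one_tests \<Theta>0 \<Theta>1 K (\<lambda>n. A * exp (- c * real n))"
    unfolding exponentially_separable_def by blast
  then have test: "is_test n (K n)" for n by (auto simp: zero_one_tests_def)
  note ab = zero_one_tests_alpha_beta[OF K sub]
  have lim: "(\<lambda>n. A * exp (- c' * real n)) \<longlonglongrightarrow> 0" if "c' > 0" for c'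
  proof -
    have "(\<lambda>n. A * exp (- c') ^ n) \<longlonglongrightarrow> A * 0"
      using that by (intro tendsto_mult tendsto_const LIMSEQ_power_zero) auto
    then show ?thesis by (simp add: exp_of_nat_mult[symmetric] mult.commute)
  qed
  show "distinguishable Pr \<kappa> \<Theta>0 \<Theta>1"
    unfolding distinguishable_def
  proof (intro allI impI)
    fix a :: real assume a: "0 < a \<and> a < 1"
    \<comment> \<open>The finitely many sample sizes with a useless bound are served by the test that never rejects.\<close>
    define K' where "K' n = (if A * exp (- c * real n) < a then K n else (\<lambda>_. 0))" for n
    have "is_test n (K' n)" for n
      using test[of n] by (auto simp: K'_def is_test_def)
    moreover have "test_alpha Pr \<kappa> \<Theta>0 n (K' n) < ennreal a" for n
    proof (cases "A * exp (- c * real n) < a")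
      case True
      then have "ennreal (A * exp (- c * real n)) < ennreal a" using a by (intro ennreal_lessI) auto
      with ab(1)[of n] show ?thesis using True by (simp add: K'_def)
    next
      case False
      then have "test_alpha Pr \<kappa> \<Theta>0 n (K' n) \<le> 0"
        unfolding test_alpha_def K'_def by (intro SUP_least) simp
      then show ?thesis using a by (simp add: order.strict_trans1)
    qed
    moreover have "(\<lambda>n. test_beta Pr \<kappa> \<Theta>1 n (K' n)) \<longlonglongrightarrow> 0"
    proof (rule tendsto_sandwich[where f = "\<lambda>_. 0"])
      show "(\<lambda>n. ennreal (A * exp (- c * real n))) \<longlonglongrightarrow> 0"
        using tendsto_ennrealI[OF lim[OF c]] by simp
      have "\<forall>\<^sub>F n in sequentially. A * exp (- c * real n) < a"
        using order_tendstoD(2)[OF lim[OF c]] a by blast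
      then show "\<forall>\<^sub>F n in sequentially. test_beta Pr \<kappa> \<Theta>1 n (K' n) \<le> ennreal (A * exp (- c * real n))"
        by eventually_elim (use ab(2) in \<open>simp add: K'_def\<close>)
    qed auto
    ultimately show "\<exists>K. (\<forall>n. is_test n (K n) \<and> test_alpha Pr \<kappa> \<Theta>0 n (K n) < ennreal a) \<and>
        (\<lambda>n. test_beta Pr \<kappa> \<Theta>1 n (K n)) \<longlonglongrightarrow> 0" by blast
  qed
  have "\<forall>\<^sub>F n in sequentially. A * exp (- (c / 2) * real n) < 1"
    using order_tendstoD(2)[OF lim[of "c / 2"]] c by simp
  then obtain n0 where n0: "\<And>n. n \<ge> n0 \<Longrightarrow> A * exp (- (c / 2) * real n) < 1"
    by (auto simp: eventually_sequentially)
  have "ennreal (A * exp (- c * real n)) \<le> ennreal (exp (- (c / 2) * real n))" if "n > n0" for n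
  proof (intro ennreal_leI)
    have "A * exp (- c * real n) = (A * exp (- (c / 2) * real n)) * exp (- (c / 2) * real n)"
      by (simp add: mult.assoc exp_add[symmetric] field_simps)
    also have "\<dots> \<le> 1 * exp (- (c / 2) * real n)"
      using n0[of n] that by (intro mult_right_mono) auto
    finally show "A * exp (- c * real n) \<le> exp (- (c / 2) * real n)" by simp
  qed
  then show "\<exists>K (c::real) (n0::nat). (\<forall>n. is_test n (K n)) \<and> c > 0 \<and>
           (\<forall>n>n0. test_alpha Pr \<kappa> \<Theta>0 n (K n) \<le> ennreal (exp (- c * real n)) \<and>
                   test_beta Pr \<kappa> \<Theta>1 n (K n) \<le> ennreal (exp (- c * real n)))"
    using test c ab by (intro exI[of _ K] exI[of _ "c / 2"] exI[of _ n0]) (meson half_gt_zero order_trans)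
qed

section \<open>Tests based on the empirical measures of finitely many sets\<close>

lemma sample_mean_measurable:
  assumes "B \<in> sets borel"
  shows "sample_mean n B \<in> borel_measurable (samples n)"
  unfolding sample_mean_def[abs_def]
  by (intro borel_measurable_divide borel_measurable_sum borel_measurable_const measurable_sample_count assms) auto

text \<open>
  The hypothesis is accepted when, for one of the finitely many centres, all the empirical means are within
  \<open>3/2 * e\<close> of the values at the centre. Under \<open>\<Theta>0\<close> a rejection needs a large deviation on some set
  of a suitable centre; under \<open>\<Theta>1\<close> an acceptance needs one on the separating set of some centre.
\<close>

lemma compact_imp_exponentially_separable:
  assumes sub: "\<Theta>0 \<subseteq> finite_measures" "\<Theta>1 \<subseteq> finite_measures"
    and comp: "relatively_compact_in weak_topology \<Theta>0"
    and disj: "weak_topology closure_of \<Theta>0 \<inter> weak_topology closure_of \<Theta>1 = {}"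
  shows "exponentially_separable \<Theta>0 \<Theta>1"
proof -
  from compact_separation_by_open_sets[OF comp[unfolded relatively_compact_in_def] sub(2) disj]
  obtain \<J> where J': "finite \<J>"
    "\<forall>(\<mu>, \<B>, e)\<in>\<J>. finite \<B> \<and> (\<forall>B\<in>\<B>. open B) \<and> (e::real) > 0 \<and>
        (\<forall>\<nu>\<in>\<Theta>1. \<exists>B\<in>\<B>. \<bar>measure \<nu> B - measure \<mu> B\<bar> \<ge> 2 * e)"
    "\<forall>\<nu>\<in>weak_topology closure_of \<Theta>0.
      \<exists>(\<mu>, \<B>, e)\<in>\<J>. \<forall>B\<in>\<B>. \<bar>measure \<nu> B - measure \<mu> B\<bar> < e"
    by (elim exE conjE) (rule that)
  have J2: "finite \<B> \<and> \<B> \<subseteq> sets borel \<and> e > 0 \<and>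
        (\<forall>\<nu>\<in>\<Theta>1. \<exists>B\<in>\<B>. \<bar>measure \<nu> B - measure \<mu> B\<bar> \<ge> 2 * e)" if "(\<mu>, \<B>, e) \<in> \<J>" for \<mu> \<B> e
    using bspec[OF J'(2) that] by (simp add: subset_eq)
  have J3: "\<exists>(\<mu>, \<B>, e)\<in>\<J>. \<forall>B\<in>\<B>. \<bar>measure \<nu> B - measure \<mu> B\<bar> < e"
    if "\<nu> \<in> weak_topology closure_of \<Theta>0" for \<nu>
    using bspec[OF J'(3) that] .
  note J = J'(1) J2 J3
  define I where "I = (\<Union>(\<mu>, \<B>, e)\<in>\<J>. (\<lambda>B. (\<mu>, B, e)) ` \<B>)"
  have "finite I" using J(1,2) by (auto simp: I_def)
  have inI: "(\<mu>, B, e) \<in> I" if "(\<mu>, \<B>, e) \<in> \<J>" "B \<in> \<B>" for \<mu> \<B> e B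
    using that by (force simp: I_def)
  have rate_mono: "discrimination_rate r' a e" if "discrimination_rate r a e" "r' \<le> r" for r r' a e
  proof -
    have "ennreal (2 * exp (- r * n)) \<le> ennreal (2 * exp (- r' * n))" for n :: nat
      using that(2) by (intro ennreal_leI) (simp add: mult_right_mono)
    then show ?thesis using that(1) unfolding discrimination_rate_def by (meson order_trans)
  qed
  have "\<exists>r>0. discrimination_rate r (measure \<mu> B) e" if "(\<mu>, B, e) \<in> I" for \<mu> B e
  proof -
    have "e > 0" using that J(2) by (auto simp: I_def)
    then show ?thesis using sample_mean_discriminates[of e "measure \<mu> B"] by simp
  qed
  then have "\<forall>i\<in>I. \<exists>r>0. discrimination_rate r (measure (fst i) (fst (snd i))) (snd (snd i))" by auto
  then obtain r where r: "\<And>i. i \<in> I \<Longrightarrow> r i > 0 \<and> discrimination_rate (r i) (measure (fst i) (fst (snd i))) (snd (snd i))"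
    by metis
  define \<rho> where "\<rho> = Min (insert 1 (r ` I))"
  have "\<rho> > 0" using r \<open>finite I\<close> by (auto simp: \<rho>_def)
  have rate: "discrimination_rate \<rho> (measure \<mu> B) e" if "(\<mu>, B, e) \<in> I" for \<mu> B e
  proof (rule rate_mono)
    show "discrimination_rate (r (\<mu>, B, e)) (measure \<mu> B) e" using r[OF that] by simp
    show "\<rho> \<le> r (\<mu>, B, e)" using that \<open>finite I\<close> by (simp add: \<rho>_def)
  qed
  define near where "near n \<mu> B e x \<longleftrightarrow> \<bar>sample_mean n B x - measure \<mu> B\<bar> < 3 / 2 * e"
    for n and \<mu> :: "'a measure" and B e x
  define K where "K n x = (if \<exists>(\<mu>, \<B>, e)\<in>\<J>. \<forall>B\<in>\<B>. near n \<mu> B e x then 0 else 1 :: real)" for n x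
  have near_sets: "{x \<in> space (samples n). near n \<mu> B e x} \<in> sets (samples n)" if "B \<in> sets borel" for n \<mu> B e
    using sample_mean_measurable[OF that, of n] unfolding near_def by measurable
  have test: "is_test n (K n)" for n
  proof -
    have "{x \<in> space (samples n). \<exists>(\<mu>, \<B>, e)\<in>\<J>. \<forall>B\<in>\<B>. near n \<mu> B e x}
        = (\<Union>(\<mu>, \<B>, e)\<in>\<J>. {x \<in> space (samples n). \<forall>B\<in>\<B>. near n \<mu> B e x})" by auto
    also have "\<dots> \<in> sets (samples n)"
    proof (intro sets.finite_UN J(1))
      fix j assume "j \<in> \<J>"
      obtain \<mu> \<B> e where j1: "j = (\<mu>, \<B>, e)" by (cases j)
      with \<open>j \<in> \<J>\<close> J(2)[of \<mu> \<B> e] have j: "j = (\<mu>, \<B>, e)" "finite \<B>" "\<B> \<subseteq> sets borel"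
        by simp_all
      have "{x \<in> space (samples n). \<forall>B\<in>\<B>. near n \<mu> B e x} \<in> sets (samples n)"
        using j(2,3) by (intro sets.sets_Collect_finite_All near_sets) auto
      then show "(case j of (\<mu>, \<B>, e) \<Rightarrow> {x \<in> space (samples n). \<forall>B\<in>\<B>. near n \<mu> B e x}) \<in> sets (samples n)"
        by (simp add: j(1))
    qed
    finally have [measurable]: "Measurable.pred (samples n) (\<lambda>x. \<exists>(\<mu>, \<B>, e)\<in>\<J>. \<forall>B\<in>\<B>. near n \<mu> B e x)"
      by (simp add: pred_def)
    have "K n \<in> borel_measurable (samples n)" unfolding K_def[abs_def] by measurable
    then show ?thesis by (auto simp: is_test_def K_def)
  qed
  define N where "N = 2 * (real (card I) + real (card \<J>))"
  have "zero_one_tests \<Theta>0 \<Theta>1 K (\<lambda>n. N * exp (- \<rho> * real n))"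
    unfolding zero_one_tests_def
  proof (intro conjI allI ballI)
    fix n \<nu> assume \<nu>: "\<nu> \<in> \<Theta>0"
    then have \<nu>fm: "\<nu> \<in> finite_measures" using sub by blast
    have near_ev: "{s \<in> space (Pr \<nu>). \<not> near n \<mu> B e (sample \<kappa> n s)} \<in> sets (Pr \<nu>)" if "B \<in> sets borel" for \<mu> B e
      using measurable_compose[OF measurable_subsample[OF \<nu>fm] sample_mean_measurable[OF that, of n], of "\<lambda>i. i"]
      unfolding near_def sample_eq_subsample by measurable
    have "\<nu> \<in> weak_topology closure_of \<Theta>0"
      using closure_of_subset[of \<Theta>0 weak_topology] sub \<nu> by auto
    from J(3)[OF this] obtain \<mu> \<B> e where j: "(\<mu>, \<B>, e) \<in> \<J>" "\<forall>B\<in>\<B>. \<bar>measure \<nu> B - measure \<mu> B\<bar> < e"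
      by auto
    have \<B>: "finite \<B>" "\<B> \<subseteq> sets borel" using J(2)[OF j(1)] by auto
    have sub': "{s \<in> space (Pr \<nu>). K n (sample \<kappa> n s) \<noteq> 0} \<subseteq> (\<Union>B\<in>\<B>. {s \<in> space (Pr \<nu>). \<not> near n \<mu> B e (sample \<kappa> n s)})"
      using j(1) by (auto simp: K_def split: if_splits)
    have "error_prob \<nu> n (K n) 0
        \<le> emeasure (Pr \<nu>) (\<Union>B\<in>\<B>. {s \<in> space (Pr \<nu>). \<not> near n \<mu> B e (sample \<kappa> n s)})"
      using sub' \<B> near_ev by (intro emeasure_mono sets.finite_UN) auto
    also have "\<dots> \<le> (\<Sum>B\<in>\<B>. emeasure (Pr \<nu>) {s \<in> space (Pr \<nu>). \<not> near n \<mu> B e (sample \<kappa> n s)})"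
      using \<B> near_ev by (intro emeasure_subadditive_finite) auto
    also have "\<dots> \<le> (\<Sum>B\<in>\<B>. ennreal (2 * exp (- \<rho> * n)))"
    proof (rule sum_mono)
      fix B assume B: "B \<in> \<B>"
      show "emeasure (Pr \<nu>) {s \<in> space (Pr \<nu>). \<not> near n \<mu> B e (sample \<kappa> n s)} \<le> ennreal (2 * exp (- \<rho> * n))"
        using rate[OF inI[OF j(1) B]] B \<B>(2) j(2) \<nu>fm unfolding discrimination_rate_def near_def not_less by blast
    qed
    also have "\<dots> = ennreal (real (card \<B>) * (2 * exp (- \<rho> * n)))"
      by (simp add: ennreal_mult' ennreal_of_nat_eq_real_of_nat)
    also have "\<dots> \<le> ennreal (N * exp (- \<rho> * n))"
    proof (intro ennreal_leI)
      have "card \<B> = card ((\<lambda>B. (\<mu>, B, e)) ` \<B>)" by (subst card_image) (auto simp: inj_on_def)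
      also have "\<dots> \<le> card I" using inI[OF j(1)] by (intro card_mono \<open>finite I\<close>) auto
      finally have "real (card \<B>) * 2 \<le> N" by (simp add: N_def)
      from mult_right_mono[OF this, of "exp (- \<rho> * n)"]
      show "real (card \<B>) * (2 * exp (- \<rho> * n)) \<le> N * exp (- \<rho> * n)" by (simp add: mult.assoc)
    qed
    finally show "error_prob \<nu> n (K n) 0 \<le> ennreal (N * exp (- \<rho> * real n))" .
  next
    fix n \<nu> assume \<nu>: "\<nu> \<in> \<Theta>1"
    then have \<nu>fm: "\<nu> \<in> finite_measures" using sub by blast
    have near_ev: "{s \<in> space (Pr \<nu>). near n \<mu> B e (sample \<kappa> n s)} \<in> sets (Pr \<nu>)" if "B \<in> sets borel" for \<mu> B e
      using measurable_compose[OF measurable_subsample[OF \<nu>fm] sample_mean_measurable[OF that, of n], of "\<lambda>i. i"]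
      unfolding near_def sample_eq_subsample by measurable
    have "\<forall>j\<in>\<J>. \<exists>B\<in>fst (snd j). \<bar>measure \<nu> B - measure (fst j) B\<bar> \<ge> 2 * snd (snd j)"
      using J(2) \<nu> by auto
    then obtain b where b: "\<And>j. j \<in> \<J> \<Longrightarrow> b j \<in> fst (snd j) \<and> \<bar>measure \<nu> (b j) - measure (fst j) (b j)\<bar> \<ge> 2 * snd (snd j)"
      by metis
    have b_borel: "b j \<in> sets borel" if "j \<in> \<J>" for j
      using b[OF that] J(2)[of "fst j" "fst (snd j)" "snd (snd j)"] that by auto
    define E where "E j = {s \<in> space (Pr \<nu>). near n (fst j) (b j) (snd (snd j)) (sample \<kappa> n s)}" for j
    have sub': "{s \<in> space (Pr \<nu>). K n (sample \<kappa> n s) \<noteq> 1} \<subseteq> (\<Union>j\<in>\<J>. E j)"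
    proof
      fix s assume "s \<in> {s \<in> space (Pr \<nu>). K n (sample \<kappa> n s) \<noteq> 1}"
      then have s: "s \<in> space (Pr \<nu>)" "\<exists>(\<mu>, \<B>, e)\<in>\<J>. \<forall>B\<in>\<B>. near n \<mu> B e (sample \<kappa> n s)"
        by (auto simp: K_def split: if_splits)
      then obtain j where j: "j \<in> \<J>" "\<forall>B\<in>fst (snd j). near n (fst j) B (snd (snd j)) (sample \<kappa> n s)" by force
      then have "s \<in> E j" using b[OF j(1)] s(1) by (auto simp: E_def)
      with j(1) show "s \<in> (\<Union>j\<in>\<J>. E j)" by blast
    qed
    have Esets: "E j \<in> sets (Pr \<nu>)" if "j \<in> \<J>" for j
      unfolding E_def using near_ev b_borel[OF that] by blast
    have "error_prob \<nu> n (K n) 1 \<le> emeasure (Pr \<nu>) (\<Union>j\<in>\<J>. E j)"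
      using sub' J(1) Esets by (intro emeasure_mono sets.finite_UN) auto
    also have "\<dots> \<le> (\<Sum>j\<in>\<J>. emeasure (Pr \<nu>) (E j))"
      using J(1) Esets by (intro emeasure_subadditive_finite) auto
    also have "\<dots> \<le> (\<Sum>j\<in>\<J>. ennreal (2 * exp (- \<rho> * n)))"
    proof (rule sum_mono)
      fix j assume j: "j \<in> \<J>"
      have "(fst j, b j, snd (snd j)) \<in> I" using b[OF j] j by (intro inI[of _ "fst (snd j)"]) auto
      from rate[OF this] b_borel[OF j] b[OF j] \<nu>fm
      show "emeasure (Pr \<nu>) (E j) \<le> ennreal (2 * exp (- \<rho> * n))"
        unfolding discrimination_rate_def near_def E_def by blast
    qed
    also have "\<dots> = ennreal (real (card \<J>) * (2 * exp (- \<rho> * n)))"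
      by (simp add: ennreal_mult' ennreal_of_nat_eq_real_of_nat)
    also have "\<dots> \<le> ennreal (N * exp (- \<rho> * n))"
    proof (intro ennreal_leI)
      have "real (card \<J>) * 2 \<le> N" by (simp add: N_def)
      from mult_right_mono[OF this, of "exp (- \<rho> * n)"]
      show "real (card \<J>) * (2 * exp (- \<rho> * n)) \<le> N * exp (- \<rho> * n)" by (simp add: mult.assoc)
    qed
    finally show "error_prob \<nu> n (K n) 1 \<le> ennreal (N * exp (- \<rho> * real n))" .
  qed (auto simp: test K_def)
  with \<open>\<rho> > 0\<close> show ?thesis unfolding exponentially_separable_def by blast
qed

section \<open>Majority votes over blocks\<close>

text \<open>
  On \<open>[0, 1]\<close> the exponential is at most \<open>1 + 2 * z\<close>, so a mean of at most \<open>1/8\<close> gives \<open>1 + 2/8 = 5/4\<close>.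
\<close>

lemma exp_integral_bound:
  assumes \<mu>: "\<mu> \<in> finite_measures" and Z: "Z \<in> borel_measurable (samples m)"
    and Z01: "\<And>x. x \<in> space (samples m) \<Longrightarrow> 0 \<le> Z x \<and> Z x \<le> (1::real)"
    and small: "(\<integral>\<^sup>+x. ennreal (Z x) \<partial>sample_law \<mu> m) \<le> ennreal (1 / 8)"
  shows "(\<integral>\<^sup>+x. ennreal (exp (Z x)) \<partial>sample_law \<mu> m) \<le> ennreal (5 / 4)"
proof -
  interpret Q: prob_space "sample_law \<mu> m" by (rule prob_space_sample_law[OF \<mu>])
  have Zm: "Z \<in> borel_measurable (sample_law \<mu> m)"
    using Z measurable_cong_sets[OF sets_sample_law refl] by blast
  have "(\<integral>\<^sup>+x. ennreal (exp (Z x)) \<partial>sample_law \<mu> m) \<le> (\<integral>\<^sup>+x. 1 + 2 * ennreal (Z x) \<partial>sample_law \<mu> m)"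
  proof (rule nn_integral_mono)
    fix x assume "x \<in> space (sample_law \<mu> m)"
    then have x: "0 \<le> Z x" "Z x \<le> 1" using Z01 by auto
    have "exp (Z x) \<le> 1 + Z x + (Z x)\<^sup>2" using x by (rule exp_bound)
    also have "(Z x)\<^sup>2 \<le> Z x" using x mult_left_mono[OF x(2) x(1)] by (simp add: power2_eq_square)
    finally have "ennreal (exp (Z x)) \<le> ennreal (1 + 2 * Z x)" by (intro ennreal_leI) simp
    then show "ennreal (exp (Z x)) \<le> 1 + 2 * ennreal (Z x)" using x by (simp add: ennreal_mult')
  qed
  also have "\<dots> = 1 + 2 * (\<integral>\<^sup>+x. ennreal (Z x) \<partial>sample_law \<mu> m)"
    using Zm by (simp add: nn_integral_add nn_integral_cmult Q.emeasure_space_1[simplified])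
  also have "\<dots> \<le> 1 + 2 * ennreal (1 / 8)" using small by (intro add_mono mult_left_mono) auto
  also have "\<dots> = ennreal 1 + ennreal 2 * ennreal (1 / 8)" by simp
  also have "\<dots> = ennreal (5 / 4)" by (simp only: ennreal_mult'[symmetric] ennreal_plus[symmetric]) simp
  finally show ?thesis .
qed

text \<open>
  Each block contributes a factor of at most \<open>exp (- 1/2) * 5/4\<close>, which is below \<open>5/6\<close>.
\<close>

lemma half_majority_tail:
  assumes \<mu>: "\<mu> \<in> finite_measures" and Z: "Z \<in> borel_measurable (samples m)"
    and Z01: "\<And>x. x \<in> space (samples m) \<Longrightarrow> 0 \<le> Z x \<and> Z x \<le> (1::real)"
    and small: "(\<integral>\<^sup>+x. ennreal (Z x) \<partial>sample_law \<mu> m) \<le> ennreal (1 / 8)"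
  shows "emeasure (Pr \<mu>) {s \<in> space (Pr \<mu>). real r / 2 \<le> (\<Sum>j<r. Z (block \<kappa> m j s))} \<le> ennreal ((5 / 6) ^ r)"
proof -
  have "emeasure (Pr \<mu>) {s \<in> space (Pr \<mu>). real r / 2 \<le> (\<Sum>j<r. Z (block \<kappa> m j s))}
    \<le> ennreal (exp (- (real r / 2))) * (\<integral>\<^sup>+x. ennreal (exp (Z x)) \<partial>sample_law \<mu> m) ^ r"
    by (rule block_sum_tail[OF \<mu> Z])
  also have "\<dots> \<le> ennreal (exp (- (real r / 2))) * ennreal (5 / 4) ^ r"
    by (intro mult_left_mono power_mono exp_integral_bound[OF assms]) auto
  also have "exp (- (real r / 2)) = exp (- (1 / 2)) ^ r"
    by (simp add: exp_of_nat_mult[symmetric])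
  also have "ennreal (exp (- (1 / 2)) ^ r) * ennreal (5 / 4) ^ r = ennreal ((exp (- (1 / 2)) * (5 / 4)) ^ r)"
    by (simp only: ennreal_power ennreal_mult[symmetric] power_mult_distrib zero_le_power exp_ge_zero)
  also have "\<dots> \<le> ennreal ((5 / 6) ^ r)"
  proof (intro ennreal_leI power_mono)
    have "3 / 2 \<le> exp (1 / 2 :: real)" using exp_ge_add_one_self[of "1 / 2 :: real"] by simp
    then have "exp (- (1 / 2) :: real) \<le> 2 / 3" by (simp add: exp_minus field_simps)
    then show "exp (- (1 / 2)) * (5 / 4) \<le> (5 / 6 :: real)" by simp
  qed simp
  finally show ?thesis .
qed

text \<open>
  The sum of the values of \<open>K\<close> over the \<open>n div m\<close> complete blocks is compared with half the number of
  blocks. Reaching the wrong side has a probability that is geometric in the number of blocks.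
\<close>

lemma amplify_test:
  assumes sub: "\<Theta>0 \<subseteq> finite_measures" "\<Theta>1 \<subseteq> finite_measures" and m: "m > 0" and K: "is_test m K"
    and \<alpha>: "test_alpha Pr \<kappa> \<Theta>0 m K \<le> ennreal (1 / 8)" and \<beta>: "test_beta Pr \<kappa> \<Theta>1 m K \<le> ennreal (1 / 8)"
  shows "exponentially_separable \<Theta>0 \<Theta>1"
proof -
  have Km: "K \<in> borel_measurable (samples m)" and K01: "\<And>x. x \<in> space (samples m) \<Longrightarrow> 0 \<le> K x \<and> K x \<le> 1"
    using K by (auto simp: is_test_def)
  define blk where "blk j x = (\<lambda>i\<in>{..<m}. x (j * m + i))" for j and x :: "nat \<Rightarrow> 'a measure"
  define L where "L n x = (if real (n div m) / 2 \<le> (\<Sum>j<n div m. K (blk j x)) then 1 else 0 :: real)" for n x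
  \<comment> \<open>The blocks that are used lie within the first \<open>n\<close> observations.\<close>
  have inside: "j * m + i < n" if "j < n div m" "i < m" for i j n
  proof -
    have "j * m + i < (j + 1) * m" using that by simp
    also have "\<dots> \<le> (n div m) * m" using that by (intro mult_le_mono1) simp
    also have "\<dots> \<le> n" by simp
    finally show ?thesis .
  qed
  have blk: "blk j (sample \<kappa> n s) = block \<kappa> m j s" if "j < n div m" for j n s
    using inside[OF that] by (auto simp: blk_def block_def subsample_def sample_def fun_eq_iff)
  have test: "is_test n (L n)" for n
  proof -
    have "blk j \<in> measurable (samples n) (samples m)" if "j < n div m" for j
      unfolding blk_def using inside[OF that] by (intro measurable_restrict measurable_component_singleton) auto
    then have [measurable]: "(\<lambda>x. \<Sum>j<n div m. K (blk j x)) \<in> borel_measurable (samples n)"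
      by (intro borel_measurable_sum measurable_compose[OF _ Km]) auto
    have "L n \<in> borel_measurable (samples n)" unfolding L_def[abs_def] by measurable
    then show ?thesis by (auto simp: is_test_def L_def)
  qed
  define c where "c = ln (6 / 5) / m"
  have "c > 0" using m by (simp add: c_def)
  have bound: "(5 / 6) ^ (n div m) \<le> (6 / 5) * exp (- c * real n)" for n
  proof -
    have "real n < real (n div m) * m + m"
      using m by (metis add.commute add_less_cancel_left div_mult_mod_eq mod_less_divisor of_nat_add of_nat_less_iff of_nat_mult)
    then have "c * n \<le> c * (real (n div m) * m + m)" using \<open>c > 0\<close> by simp
    also have "\<dots> = real (n div m) * ln (6 / 5) + ln (6 / 5)" using m by (simp add: c_def field_simps)
    finally have "- (real (n div m) * ln (6 / 5)) \<le> ln (6 / 5) + - c * n" by simp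
    then have "exp (- (real (n div m) * ln (6 / 5))) \<le> exp (ln (6 / 5) + - c * n)"
      by (simp only: exp_le_cancel_iff)
    also have "\<dots> = exp (ln (6 / 5)) * exp (- c * n)" by (rule exp_add)
    finally have "exp (- (real (n div m) * ln (6 / 5))) \<le> exp (ln (6 / 5)) * exp (- c * n)" .
    moreover have "exp (- (real (n div m) * ln (6 / 5))) = (5 / 6) ^ (n div m)"
      by (simp add: exp_minus exp_of_nat_mult power_inverse[symmetric])
    ultimately show ?thesis by simp
  qed
  have "zero_one_tests \<Theta>0 \<Theta>1 L (\<lambda>n. (6 / 5) * exp (- c * real n))"
    unfolding zero_one_tests_def
  proof (intro conjI allI ballI)
    fix n \<mu> assume "\<mu> \<in> \<Theta>0"
    then have \<mu>: "\<mu> \<in> finite_measures" using sub by blast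
    have "(\<integral>\<^sup>+x. ennreal (K x) \<partial>sample_law \<mu> m) \<le> test_alpha Pr \<kappa> \<Theta>0 m K"
      unfolding test_alpha_def using Km \<open>\<mu> \<in> \<Theta>0\<close>
      by (subst nn_integral_sample[OF \<mu>, symmetric]) (auto intro: SUP_upper)
    then have "(\<integral>\<^sup>+x. ennreal (K x) \<partial>sample_law \<mu> m) \<le> ennreal (1 / 8)" using \<alpha> by (rule order_trans)
    from half_majority_tail[OF \<mu> Km K01 this, of "n div m"]
    have "emeasure (Pr \<mu>) {s \<in> space (Pr \<mu>). real (n div m) / 2 \<le> (\<Sum>j<n div m. K (block \<kappa> m j s))} \<le> ennreal ((5 / 6) ^ (n div m))"
      by simp
    also have "{s \<in> space (Pr \<mu>). real (n div m) / 2 \<le> (\<Sum>j<n div m. K (block \<kappa> m j s))}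
        = {s \<in> space (Pr \<mu>). L n (sample \<kappa> n s) \<noteq> 0}"
      by (auto simp: L_def blk)
    finally show "error_prob \<mu> n (L n) 0 \<le> ennreal (6 / 5 * exp (- c * real n))"
      using ennreal_leI[OF bound[of n]] by (rule order_trans)
  next
    fix n \<mu> assume "\<mu> \<in> \<Theta>1"
    then have \<mu>: "\<mu> \<in> finite_measures" using sub by blast
    have Km': "(\<lambda>x. 1 - K x) \<in> borel_measurable (samples m)" using Km by measurable
    have "(\<integral>\<^sup>+x. ennreal (1 - K x) \<partial>sample_law \<mu> m) \<le> test_beta Pr \<kappa> \<Theta>1 m K"
      unfolding test_beta_def using Km' \<open>\<mu> \<in> \<Theta>1\<close>
      by (subst nn_integral_sample[OF \<mu>, symmetric]) (auto intro: SUP_upper)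
    then have "(\<integral>\<^sup>+x. ennreal (1 - K x) \<partial>sample_law \<mu> m) \<le> ennreal (1 / 8)" using \<beta> by (rule order_trans)
    from half_majority_tail[OF \<mu> Km' _ this, of "n div m"] K01
    have "emeasure (Pr \<mu>) {s \<in> space (Pr \<mu>). real (n div m) / 2 \<le> (\<Sum>j<n div m. 1 - K (block \<kappa> m j s))} \<le> ennreal ((5 / 6) ^ (n div m))"
      by auto
    note le = order_trans[OF this ennreal_leI[OF bound[of n]]]
    have "{s \<in> space (Pr \<mu>). real (n div m) / 2 \<le> (\<Sum>j<n div m. 1 - K (block \<kappa> m j s))} \<in> sets (Pr \<mu>)"
      unfolding block_def
      by (intro borel_measurable_le borel_measurable_const borel_measurable_sum
          measurable_compose[OF measurable_subsample[OF \<mu>] Km'])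
    moreover have "{s \<in> space (Pr \<mu>). L n (sample \<kappa> n s) \<noteq> 1}
        \<subseteq> {s \<in> space (Pr \<mu>). real (n div m) / 2 \<le> (\<Sum>j<n div m. 1 - K (block \<kappa> m j s))}"
      by (auto simp: L_def blk sum_subtractf split: if_splits)
    ultimately show "error_prob \<mu> n (L n) 1 \<le> ennreal (6 / 5 * exp (- c * real n))"
      using le by (meson emeasure_mono order_trans)
  qed (auto simp: test L_def)
  with \<open>c > 0\<close> show ?thesis unfolding exponentially_separable_def by blast
qed

lemma distinguishable_imp_exponentially_separable:
  assumes sub: "\<Theta>0 \<subseteq> finite_measures" "\<Theta>1 \<subseteq> finite_measures"
    and dist: "distinguishable Pr \<kappa> \<Theta>0 \<Theta>1"
  shows "exponentially_separable \<Theta>0 \<Theta>1"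
proof -
  have "0 < (1 / 8 :: real) \<and> (1 / 8 :: real) < 1" by simp
  with dist obtain K where K: "\<And>n. is_test n (K n)" "\<And>n. test_alpha Pr \<kappa> \<Theta>0 n (K n) < ennreal (1 / 8)"
    "(\<lambda>n. test_beta Pr \<kappa> \<Theta>1 n (K n)) \<longlonglongrightarrow> 0"
    unfolding distinguishable_def by metis
  have "eventually (\<lambda>n. test_beta Pr \<kappa> \<Theta>1 n (K n) < ennreal (1 / 8)) sequentially"
    by (rule order_tendstoD(2)[OF K(3)]) simp
  then obtain n0 where "\<And>n. n \<ge> n0 \<Longrightarrow> test_beta Pr \<kappa> \<Theta>1 n (K n) < ennreal (1 / 8)"
    by (auto simp: eventually_sequentially)
  then have "test_beta Pr \<kappa> \<Theta>1 (Suc n0) (K (Suc n0)) \<le> ennreal (1 / 8)" by (simp add: less_imp_le)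
  with K(1,2) show ?thesis
    by (intro amplify_test[OF sub, of "Suc n0" "K (Suc n0)"]) (auto simp: less_imp_le)
qed

end

section \<open>Discernibility\<close>

text \<open>
  The decisions \<open>K n\<close> are constant from this index on, if they are ever eventually constant;
  otherwise \<open>Least\<close> returns an arbitrary default. The index does not refer to the true mean measure, as is
  required of the associated random variable.
\<close>

definition stabilization_index :: "(nat \<Rightarrow> (nat \<Rightarrow> 'a measure) \<Rightarrow> real) \<Rightarrow> (nat \<Rightarrow> 'a measure) \<Rightarrow> nat" where
  "stabilization_index K x = (LEAST m. \<forall>n\<ge>m. K n (restrict x {..<n}) = K m (restrict x {..<m}))"

lemma measurable_stabilization_index:
  assumes "\<And>n. is_test n (K n)"
  shows "stabilization_index K \<in> measurable (Pi\<^sub>M UNIV (\<lambda>_. config_space)) (count_space UNIV)"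
proof -
  have meas: "(\<lambda>x. K n (restrict x {..<n})) \<in> borel_measurable (Pi\<^sub>M UNIV (\<lambda>_. config_space))" for n
    by (rule measurable_compose[OF measurable_restrict_subset measurable_test_function[OF assms]]) simp
  have "Measurable.pred (Pi\<^sub>M UNIV (\<lambda>_. config_space))
      (\<lambda>x. K n (restrict x {..<n}) = K m (restrict x {..<m}))" for n m
    unfolding pred_def by (rule borel_measurable_eq[OF meas meas])
  then have "Measurable.pred (Pi\<^sub>M UNIV (\<lambda>_. config_space))
      (\<lambda>x. \<forall>n\<ge>m. K n (restrict x {..<n}) = K m (restrict x {..<m}))" for m
    by (intro pred_intros_countable pred_intros_imp')
  then show ?thesis
    unfolding stabilization_index_def[abs_def] by (rule measurable_Least)
qed

lemma sample_eq_restrict: "sample \<kappa> n s = restrict (sample_path \<kappa> s) {..<n}"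
  by (simp add: sample_def sample_path_def)

context poisson_model
begin

abbreviation late_prob :: "'a measure \<Rightarrow> (nat \<Rightarrow> (nat \<Rightarrow> 'a measure) \<Rightarrow> real) \<Rightarrow> nat \<Rightarrow> ennreal" where
  "late_prob \<mu> K k \<equiv> emeasure (Pr \<mu>) {s \<in> space (Pr \<mu>). k < stabilization_index K (sample_path \<kappa> s)}"

lemma measurable_sample_path:
  assumes "\<mu> \<in> finite_measures"
  shows "sample_path \<kappa> \<in> measurable (Pr \<mu>) (Pi\<^sub>M UNIV (\<lambda>_. config_space))"
  unfolding sample_path_def[abs_def]
  by (intro measurable_PiM_single' measurable_observation assms)
    (use measurable_space[OF measurable_observation[OF assms]] in \<open>auto simp: PiE_iff\<close>)

text \<open>
  If the decision is right from \<open>k\<close> on, then it is constant from \<open>k\<close> on. So the index exceeds \<open>k\<close> only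
  if an error occurs at some \<open>n \<ge> k\<close>, and the union bound applies. By Borel--Cantelli there are almost
  surely finitely many errors, hence the constant value reached is the right one.
\<close>

lemma stabilization:
  assumes \<mu>: "\<mu> \<in> finite_measures" and K: "\<And>n. is_test n (K n)"
    and \<epsilon>: "summable \<epsilon>" "\<And>n. 0 \<le> \<epsilon> n"
    and err: "\<And>n. error_prob \<mu> n (K n) v \<le> ennreal (\<epsilon> n)"
  shows "AE s in Pr \<mu>. \<forall>n. real n > 1 + real (stabilization_index K (sample_path \<kappa> s)) \<longrightarrow> K n (sample \<kappa> n s) = v"
    and "late_prob \<mu> K k \<le> ennreal (\<Sum>n. \<epsilon> (n + k))"
proof -
  interpret prob_space "Pr \<mu>" by (rule prob_space_Pr[OF \<mu>])
  define bad where "bad n = {s \<in> space (Pr \<mu>). K n (sample \<kappa> n s) \<noteq> v}" for n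
  have bad: "bad n \<in> sets (Pr \<mu>)" for n
    unfolding bad_def by (rule test_event_sets[OF \<mu> K])
  have stable: "stabilization_index K (sample_path \<kappa> s) \<le> m"
      "\<forall>n\<ge>stabilization_index K (sample_path \<kappa> s). K n (sample \<kappa> n s) = v"
    if "\<And>n. n \<ge> m \<Longrightarrow> K n (sample \<kappa> n s) = v" for s m
  proof -
    define i where "i = stabilization_index K (sample_path \<kappa> s)"
    have P: "\<forall>n\<ge>m. K n (restrict (sample_path \<kappa> s) {..<n}) = K m (restrict (sample_path \<kappa> s) {..<m})"
      using that by (simp add: sample_eq_restrict)
    then show "stabilization_index K (sample_path \<kappa> s) \<le> m"
      unfolding stabilization_index_def by (rule Least_le)
    have const: "\<forall>n\<ge>i. K n (sample \<kappa> n s) = K i (sample \<kappa> i s)"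
      using LeastI[of "\<lambda>m. \<forall>n\<ge>m. K n (restrict (sample_path \<kappa> s) {..<n}) = K m (restrict (sample_path \<kappa> s) {..<m})", OF P]
      unfolding i_def stabilization_index_def sample_eq_restrict .
    have "K i (sample \<kappa> i s) = K (max i m) (sample \<kappa> (max i m) s)"
      by (rule const[rule_format, symmetric]) simp
    also have "\<dots> = v" by (rule that) simp
    finally have v: "K i (sample \<kappa> i s) = v" .
    show "\<forall>n\<ge>stabilization_index K (sample_path \<kappa> s). K n (sample \<kappa> n s) = v"
      unfolding i_def[symmetric] using const v by metis
  qed
  have "summable (\<lambda>n. measure (Pr \<mu>) (bad n))"
  proof (rule summable_comparison_test'[OF \<epsilon>(1)])
    show "norm (measure (Pr \<mu>) (bad n)) \<le> \<epsilon> n" for n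
      using err[of n] \<epsilon>(2)[of n] by (simp add: bad_def emeasure_eq_measure)
  qed
  then have "AE s in Pr \<mu>. eventually (\<lambda>n. s \<in> space (Pr \<mu>) - bad n) sequentially"
    by (intro borel_cantelli_AE1 bad) (auto simp: less_top[symmetric])
  then show "AE s in Pr \<mu>. \<forall>n. real n > 1 + real (stabilization_index K (sample_path \<kappa> s)) \<longrightarrow> K n (sample \<kappa> n s) = v"
  proof eventually_elim
    case (elim s)
    then obtain m where "\<And>n. n \<ge> m \<Longrightarrow> K n (sample \<kappa> n s) = v"
      by (auto simp: eventually_sequentially bad_def)
    from stable(2)[OF this] show ?case by auto
  qed
  have "{s \<in> space (Pr \<mu>). k < stabilization_index K (sample_path \<kappa> s)} \<subseteq> (\<Union>n. bad (n + k))"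
  proof
    fix s assume s: "s \<in> {s \<in> space (Pr \<mu>). k < stabilization_index K (sample_path \<kappa> s)}"
    then obtain n where n: "n \<ge> k" "K n (sample \<kappa> n s) \<noteq> v"
      using stable(1)[of k s] by (auto simp: not_le)
    then have "s \<in> bad ((n - k) + k)" using s by (simp add: bad_def)
    then show "s \<in> (\<Union>n. bad (n + k))" by blast
  qed
  then have "late_prob \<mu> K k \<le> emeasure (Pr \<mu>) (\<Union>n. bad (n + k))"
    using bad by (intro emeasure_mono) auto
  also have "\<dots> \<le> (\<Sum>n. emeasure (Pr \<mu>) (bad (n + k)))"
    using bad by (intro emeasure_subadditive_countably) auto
  also have "\<dots> \<le> (\<Sum>n. ennreal (\<epsilon> (n + k)))"
    using err by (intro suminf_le summableI) (auto simp: bad_def)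
  also have "\<dots> = ennreal (\<Sum>n. \<epsilon> (n + k))"
    using \<epsilon> summable_ignore_initial_segment[OF \<epsilon>(1)] by (intro suminf_ennreal2) auto
  finally show "late_prob \<mu> K k \<le> ennreal (\<Sum>n. \<epsilon> (n + k))" .
qed

lemma summable_errors_uniformly_discern:
  assumes sub: "\<Theta>0 \<subseteq> finite_measures" "\<Theta>1 \<subseteq> finite_measures"
    and K: "zero_one_tests \<Theta>0 \<Theta>1 K \<epsilon>" and \<epsilon>: "summable \<epsilon>" "\<And>n. 0 \<le> \<epsilon> n"
  shows "uniformly_discerns_with Pr \<kappa> K (\<lambda>x. 1 + real (stabilization_index K x)) \<Theta>0 \<Theta>1"
    and "\<mu> \<in> \<Theta>0 \<union> \<Theta>1 \<Longrightarrow> late_prob \<mu> K k \<le> ennreal (\<Sum>n. \<epsilon> (n + k))"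
proof -
  have test: "is_test n (K n)" for n using K by (simp add: zero_one_tests_def)
  have err0: "error_prob \<mu> n (K n) 0 \<le> ennreal (\<epsilon> n)" if "\<mu> \<in> \<Theta>0" for \<mu> n
    using K that by (simp add: zero_one_tests_def)
  have err1: "error_prob \<mu> n (K n) 1 \<le> ennreal (\<epsilon> n)" if "\<mu> \<in> \<Theta>1" for \<mu> n
    using K that by (simp add: zero_one_tests_def)
  have tail: "late_prob \<mu> K k \<le> ennreal (\<Sum>n. \<epsilon> (n + k))"
    if \<mu>: "\<mu> \<in> \<Theta>0 \<union> \<Theta>1" for \<mu> k
  proof (cases "\<mu> \<in> \<Theta>0")
    case True
    with sub show ?thesis by (intro stabilization(2)[OF _ test \<epsilon> err0]) auto
  next
    case False
    with sub \<mu> show ?thesis by (intro stabilization(2)[OF _ test \<epsilon> err1]) auto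
  qed
  then show "\<mu> \<in> \<Theta>0 \<union> \<Theta>1 \<Longrightarrow> late_prob \<mu> K k \<le> ennreal (\<Sum>n. \<epsilon> (n + k))" .
  note [measurable] = measurable_stabilization_index[OF test]
  show "uniformly_discerns_with Pr \<kappa> K (\<lambda>x. 1 + real (stabilization_index K x)) \<Theta>0 \<Theta>1"
    unfolding uniformly_discerns_with_def
  proof (intro conjI allI ballI)
    show "(\<lambda>x. 1 + real (stabilization_index K x)) \<in> borel_measurable (Pi\<^sub>M UNIV (\<lambda>_. config_space))"
      by measurable
    show "AE s in Pr \<mu>. \<forall>n. 1 + real (stabilization_index K (sample_path \<kappa> s)) < real n \<longrightarrow> K n (sample \<kappa> n s) = 0"
      if "\<mu> \<in> \<Theta>0" for \<mu> using that sub by (intro stabilization(1)[OF _ test \<epsilon> err0]) auto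
    show "AE s in Pr \<mu>. \<forall>n. 1 + real (stabilization_index K (sample_path \<kappa> s)) < real n \<longrightarrow> K n (sample \<kappa> n s) = 1"
      if "\<mu> \<in> \<Theta>1" for \<mu> using that sub by (intro stabilization(1)[OF _ test \<epsilon> err1]) auto
    have k_lim: "filterlim (\<lambda>C::real. nat \<lfloor>C - 1\<rfloor>) sequentially at_top"
      unfolding filterlim_at_top
    proof
      fix Z :: nat
      show "\<forall>\<^sub>F C in at_top. Z \<le> nat \<lfloor>C - 1 :: real\<rfloor>"
        using eventually_ge_at_top[of "real Z + 1"] by eventually_elim linarith
    qed
    have "(\<lambda>k. \<Sum>n. \<epsilon> (n + k)) \<longlonglongrightarrow> 0" by (rule suminf_exist_split2[OF \<epsilon>(1)])
    then have "(\<lambda>k. ennreal (\<Sum>n. \<epsilon> (n + k))) \<longlonglongrightarrow> 0" using tendsto_ennrealI by fastforce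
    then have lim: "((\<lambda>C::real. ennreal (\<Sum>n. \<epsilon> (n + nat \<lfloor>C - 1\<rfloor>))) \<longlongrightarrow> 0) at_top"
      using k_lim by (rule filterlim_compose)
    show "((\<lambda>C::real. SUP \<mu>\<in>\<Theta>0 \<union> \<Theta>1. emeasure (Pr \<mu>) {s \<in> space (Pr \<mu>). 1 + real (stabilization_index K (sample_path \<kappa> s)) > C})
        \<longlongrightarrow> 0) at_top"
    proof (rule tendsto_sandwich[where f = "\<lambda>_. 0", OF _ _ tendsto_const lim])
      show "\<forall>\<^sub>F C::real in at_top. (SUP \<mu>\<in>\<Theta>0 \<union> \<Theta>1. emeasure (Pr \<mu>) {s \<in> space (Pr \<mu>). 1 + real (stabilization_index K (sample_path \<kappa> s)) > C})
          \<le> ennreal (\<Sum>n. \<epsilon> (n + nat \<lfloor>C - 1\<rfloor>))"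
        using eventually_ge_at_top[of 1]
      proof eventually_elim
        case (elim C)
        show ?case
        proof (rule SUP_least)
          fix \<mu> assume \<mu>: "\<mu> \<in> \<Theta>0 \<union> \<Theta>1"
          then have fm: "\<mu> \<in> finite_measures" using sub by blast
          have "(\<lambda>s. stabilization_index K (sample_path \<kappa> s)) \<in> measurable (Pr \<mu>) (count_space UNIV)"
            by (rule measurable_compose[OF measurable_sample_path[OF fm] measurable_stabilization_index[OF test]])
          then have "{s \<in> space (Pr \<mu>). nat \<lfloor>C - 1\<rfloor> < stabilization_index K (sample_path \<kappa> s)} \<in> sets (Pr \<mu>)"
            by measurable
          moreover have "{s \<in> space (Pr \<mu>). 1 + real (stabilization_index K (sample_path \<kappa> s)) > C}
              \<subseteq> {s \<in> space (Pr \<mu>). nat \<lfloor>C - 1\<rfloor> < stabilization_index K (sample_path \<kappa> s)}"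
            by safe (use elim in linarith)
          ultimately show "emeasure (Pr \<mu>) {s \<in> space (Pr \<mu>). 1 + real (stabilization_index K (sample_path \<kappa> s)) > C}
              \<le> ennreal (\<Sum>n. \<epsilon> (n + nat \<lfloor>C - 1\<rfloor>))"
            using tail[OF \<mu>] by (meson emeasure_mono order_trans)
        qed
      qed
    qed auto
  qed (use test in auto)
qed

text \<open>
  The tail of the stabilization index is geometric with ratio \<open>exp (- c)\<close>, so its exponential moment
  of order \<open>c / 2\<close> is bounded by a convergent geometric series, uniformly over both families.
\<close>

lemma exponentially_separable_discernible:
  assumes sub: "\<Theta>0 \<subseteq> finite_measures" "\<Theta>1 \<subseteq> finite_measures"
    and sep: "exponentially_separable \<Theta>0 \<Theta>1"
  shows "\<exists>K N (t::real) (C::real). uniformly_discerns_with Pr \<kappa> K N \<Theta>0 \<Theta>1 \<and> t > 0 \<and>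
           (SUP \<mu>\<in>\<Theta>0 \<union> \<Theta>1. \<integral>\<^sup>+s. ennreal (exp (t * N (sample_path \<kappa> s))) \<partial>Pr \<mu>) < ennreal C"
proof -
  from sep obtain K A' c where c: "c > 0" and K': "zero_one_tests \<Theta>0 \<Theta>1 K (\<lambda>n. A' * exp (- c * real n))"
    unfolding exponentially_separable_def by blast
  \<comment> \<open>Enlarging the constant makes the bound for the index \<open>0\<close> trivial.\<close>
  define A where "A = max 1 A'"
  have "A \<ge> 1" by (simp add: A_def)
  define \<epsilon> where "\<epsilon> n = A * exp (- c) ^ n" for n
  have \<epsilon>0: "0 \<le> \<epsilon> n" for n using \<open>A \<ge> 1\<close> by (simp add: \<epsilon>_def)
  have "ennreal (A' * exp (- c * real n)) \<le> ennreal (\<epsilon> n)" for n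
    unfolding \<epsilon>_def A_def exp_of_nat_mult[symmetric]
    by (intro ennreal_leI) (auto simp: mult.commute intro!: mult_right_mono)
  with K' have K: "zero_one_tests \<Theta>0 \<Theta>1 K \<epsilon>"
    unfolding zero_one_tests_def by (meson order_trans)
  have q: "0 < exp (- c)" "exp (- c) < 1" using c by auto
  have summ: "summable \<epsilon>" unfolding \<epsilon>_def using q by (intro summable_mult summable_geometric) auto
  define I where "I = stabilization_index K"
  define D where "D = A / (1 - exp (- c))"
  have "D \<ge> 1"
  proof -
    have "0 < 1 - exp (- c)" using q by linarith
    moreover have "1 * (1 - exp (- c)) \<le> A" using \<open>A \<ge> 1\<close> q unfolding mult_1_left by linarith
    ultimately show ?thesis unfolding D_def by (subst pos_le_divide_eq)
  qed
  have tail_sum: "(\<Sum>n. \<epsilon> (n + k)) = D * exp (- c) ^ k" for k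
  proof -
    have "(\<Sum>n. \<epsilon> (n + k)) = (\<Sum>n. A * exp (- c) ^ k * exp (- c) ^ n)"
      by (simp add: \<epsilon>_def power_add mult_ac)
    also have "\<dots> = A * exp (- c) ^ k * (1 / (1 - exp (- c)))"
      using q by (subst suminf_mult) (auto intro!: summable_geometric simp: suminf_geometric)
    finally show ?thesis by (simp add: D_def)
  qed
  note disc = summable_errors_uniformly_discern[OF sub K summ \<epsilon>0, unfolded tail_sum]
  define t where "t = c / 2"
  define S where "S = exp t * D * exp c * (1 / (1 - exp (- t)))"
  have "t > 0" using c by (simp add: t_def)
  have moment: "(\<integral>\<^sup>+s. ennreal (exp (t * (1 + real (I (sample_path \<kappa> s))))) \<partial>Pr \<mu>) \<le> ennreal S"
    if \<mu>: "\<mu> \<in> \<Theta>0 \<union> \<Theta>1" for \<mu>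
  proof -
    have fm: "\<mu> \<in> finite_measures" using \<mu> sub by blast
    interpret prob_space "Pr \<mu>" by (rule prob_space_Pr[OF fm])
    define J where "J s = I (sample_path \<kappa> s)" for s
    have Jm: "J \<in> measurable (Pr \<mu>) (count_space UNIV)"
      unfolding J_def I_def
      by (rule measurable_compose[OF measurable_sample_path[OF fm] measurable_stabilization_index])
        (use K in \<open>simp add: zero_one_tests_def\<close>)
    have Jsets [measurable]: "{s \<in> space (Pr \<mu>). J s = k} \<in> sets (Pr \<mu>)" for k using Jm by measurable
    have Jtail: "emeasure (Pr \<mu>) {s \<in> space (Pr \<mu>). J s = k} \<le> ennreal (D * exp c * exp (- c) ^ k)" for k
    proof (cases k)
      case 0
      have "1 \<le> D * exp c" using mult_mono[OF \<open>D \<ge> 1\<close>, of 1 "exp c"] c \<open>D \<ge> 1\<close> by simp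
      then show ?thesis using 0 prob_le_1 by (auto simp: emeasure_eq_measure intro!: ennreal_leI intro: order_trans)
    next
      case (Suc l)
      have "{s \<in> space (Pr \<mu>). l < J s} \<in> sets (Pr \<mu>)" using Jm by measurable
      then have "emeasure (Pr \<mu>) {s \<in> space (Pr \<mu>). J s = k} \<le> emeasure (Pr \<mu>) {s \<in> space (Pr \<mu>). l < J s}"
        using Suc by (intro emeasure_mono) auto
      also have "\<dots> \<le> ennreal (D * exp (- c) ^ l)" using disc(2)[OF \<mu>, of l] by (simp add: J_def I_def)
      also have "D * exp (- c) ^ l = D * exp c * exp (- c) ^ k" by (simp add: Suc exp_minus)
      finally show ?thesis .
    qed
    have "(\<integral>\<^sup>+s. ennreal (exp (t * (1 + real (J s)))) \<partial>Pr \<mu>)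
        = (\<integral>\<^sup>+s. (\<Sum>k. ennreal (exp (t * (1 + real k))) * indicator {s \<in> space (Pr \<mu>). J s = k} s) \<partial>Pr \<mu>)"
    proof (rule nn_integral_cong)
      fix s assume s: "s \<in> space (Pr \<mu>)"
      have "(\<Sum>k. ennreal (exp (t * (1 + real k))) * indicator {s \<in> space (Pr \<mu>). J s = k} s)
          = (\<Sum>k\<in>{J s}. ennreal (exp (t * (1 + real k))) * indicator {s \<in> space (Pr \<mu>). J s = k} s)"
        by (intro suminf_finite) auto
      then show "ennreal (exp (t * (1 + real (J s)))) = (\<Sum>k. ennreal (exp (t * (1 + real k))) * indicator {s \<in> space (Pr \<mu>). J s = k} s)"
        using s by simp
    qed
    also have "\<dots> = (\<Sum>k. ennreal (exp (t * (1 + real k))) * emeasure (Pr \<mu>) {s \<in> space (Pr \<mu>). J s = k})"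
      by (subst nn_integral_suminf) (auto simp: nn_integral_cmult_indicator)
    also have "\<dots> \<le> (\<Sum>k. ennreal (exp t * D * exp c * exp (- t) ^ k))"
    proof (intro suminf_le summableI)
      fix k
      have "ennreal (exp (t * (1 + real k))) * emeasure (Pr \<mu>) {s \<in> space (Pr \<mu>). J s = k}
          \<le> ennreal (exp (t * (1 + real k))) * ennreal (D * exp c * exp (- c) ^ k)"
        by (intro mult_left_mono Jtail) auto
      also have "\<dots> = ennreal (exp (t * (1 + real k)) * (D * exp c * exp (- c) ^ k))"
        by (simp add: ennreal_mult')
      also have "exp (t * (1 + real k)) * (D * exp c * exp (- c) ^ k) = exp t * D * exp c * (exp t * exp (- c)) ^ k"
      proof -
        have "exp (t * (1 + real k)) = exp t * exp t ^ k"
          by (simp add: distrib_left exp_add exp_of_nat2_mult)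
        then show ?thesis by (simp only: power_mult_distrib mult_ac)
      qed
      also have "exp t * exp (- c) = exp (- t)" by (simp add: t_def exp_add[symmetric])
      finally show "ennreal (exp (t * (1 + real k))) * emeasure (Pr \<mu>) {s \<in> space (Pr \<mu>). J s = k}
          \<le> ennreal (exp t * D * exp c * exp (- t) ^ k)" .
    qed
    also have "\<dots> = ennreal S"
    proof (rule suminf_ennreal_eq)
      show "0 \<le> exp t * D * exp c * exp (- t) ^ k" for k using \<open>D \<ge> 1\<close> by simp
      show "(\<lambda>k. exp t * D * exp c * exp (- t) ^ k) sums S"
        unfolding S_def using \<open>t > 0\<close> by (intro sums_mult geometric_sums) auto
    qed
    finally show ?thesis by (simp add: J_def)
  qed
  have "S \<ge> 0" using \<open>D \<ge> 1\<close> \<open>t > 0\<close> by (simp add: S_def)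
  have "(SUP \<mu>\<in>\<Theta>0 \<union> \<Theta>1. \<integral>\<^sup>+s. ennreal (exp (t * (1 + real (I (sample_path \<kappa> s))))) \<partial>Pr \<mu>) \<le> ennreal S"
    by (intro SUP_least moment)
  also have "\<dots> < ennreal (S + 1)" using \<open>S \<ge> 0\<close> by (intro ennreal_lessI) auto
  finally show ?thesis
    using disc(1) \<open>t > 0\<close> unfolding I_def by blast
qed

text \<open>
  At sample size \<open>n\<close> the test for \<open>\<Phi> (d n)\<close> is used, where \<open>d n\<close> is the largest index not exceeding \<open>n\<close>
  whose exponential bound has dropped below \<open>1 / (n + 1)\<^sup>2\<close> by then. As \<open>d n\<close> tends to infinity
  and \<open>\<Phi>\<close> is increasing, the errors against every \<open>\<Phi> k\<close> are eventually bounded by a summable sequence.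
\<close>

lemma diagonal_tests:
  fixes \<Phi> :: "nat \<Rightarrow> 'a measure set"
  assumes sub: "\<Theta>0 \<subseteq> finite_measures" "\<And>k. \<Phi> k \<subseteq> finite_measures"
    and mono: "\<And>k l. k \<le> l \<Longrightarrow> \<Phi> k \<subseteq> \<Phi> l"
    and sep: "\<And>k. exponentially_separable \<Theta>0 (\<Phi> k)"
  shows "\<exists>K. \<forall>k. uniformly_discerns Pr \<kappa> K \<Theta>0 (\<Phi> k)"
proof -
  from sep have "\<forall>k. \<exists>T A c. c > 0 \<and> zero_one_tests \<Theta>0 (\<Phi> k) T (\<lambda>n. A * exp (- c * real n))"
    unfolding exponentially_separable_def by blast
  then obtain T A and c :: "nat \<Rightarrow> real" where c: "\<And>k. c k > 0" and T: "\<And>k. zero_one_tests \<Theta>0 (\<Phi> k) (T k) (\<lambda>n. A k * exp (- c k * real n))"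
    by metis
  define \<epsilon> where "\<epsilon> n = 1 / real (Suc n) ^ 2" for n
  have "\<exists>m. \<forall>n\<ge>m. A k * exp (- c k * real n) \<le> \<epsilon> n" for k
  proof -
    have "filterlim (\<lambda>n. real n + 1) at_top sequentially"
      by (rule filterlim_at_top_mono[OF filterlim_real_sequentially]) auto
    then have "filterlim (\<lambda>n. c k * (real n + 1)) at_top sequentially"
      by (rule filterlim_tendsto_pos_mult_at_top[OF tendsto_const c])
    from filterlim_compose[OF tendsto_power_div_exp_0 this, of 2]
    have "(\<lambda>n. A k * (exp (c k) / (c k)\<^sup>2 * ((c k * (real n + 1)) ^ 2 / exp (c k * (real n + 1))))) \<longlonglongrightarrow> A k * (exp (c k) / (c k)\<^sup>2 * 0)"
      by (intro tendsto_mult tendsto_const)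
    moreover have "exp (c k) / (c k)\<^sup>2 * ((c k * (real n + 1)) ^ 2 / exp (c k * (real n + 1))) = (real n + 1) ^ 2 * exp (- c k * real n)" for n
    proof -
      have "exp (c k * (real n + 1)) = exp (c k * real n) * exp (c k)" by (simp add: distrib_left exp_add)
      moreover have "(c k * (real n + 1)) ^ 2 = (c k)\<^sup>2 * (real n + 1)\<^sup>2" by (rule power_mult_distrib)
      ultimately show ?thesis using c[of k] by (simp only:) (simp add: exp_minus divide_simps)
    qed
    ultimately have "(\<lambda>n. A k * ((real n + 1) ^ 2 * exp (- c k * real n))) \<longlonglongrightarrow> A k * (exp (c k) / (c k)\<^sup>2 * 0)"
      by (simp only:)
    then have "eventually (\<lambda>n. A k * ((real n + 1) ^ 2 * exp (- c k * real n)) < 1) sequentially"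
      by (intro order_tendstoD(2)) auto
    then obtain m where m: "\<And>n. n \<ge> m \<Longrightarrow> A k * ((real n + 1) ^ 2 * exp (- c k * real n)) < 1"
      by (auto simp: eventually_sequentially)
    have "A k * exp (- c k * real n) \<le> \<epsilon> n" if "n \<ge> m" for n
    proof -
      have "(A k * exp (- c k * real n)) * real (Suc n) ^ 2 \<le> 1" using m[OF that] by (simp add: mult_ac add.commute)
      then show ?thesis unfolding \<epsilon>_def by (subst pos_le_divide_eq) auto
    qed
    then show ?thesis by blast
  qed
  then obtain M :: "nat \<Rightarrow> nat" where M: "\<And>k n. n \<ge> M k \<Longrightarrow> A k * exp (- c k * real n) \<le> \<epsilon> n" by metis
  define S where "S n = {k. k \<le> n \<and> M k \<le> n}" for n :: nat
  define d where "d n = (if S n = {} then 0 else Max (S n))" for n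
  have finS: "finite (S n)" for n by (auto simp: S_def)
  have d: "k \<le> d n" "M (d n) \<le> n" if "n \<ge> max k (M k)" for k n
  proof -
    have "k \<in> S n" using that by (auto simp: S_def)
    then have "S n \<noteq> {}" by blast
    then have "d n \<in> S n" using Max_in[OF finS] by (auto simp: d_def)
    then show "M (d n) \<le> n" by (simp add: S_def)
    show "k \<le> d n" using \<open>k \<in> S n\<close> finS by (auto simp: d_def)
  qed
  define K where "K n = T (d n) n" for n
  have "uniformly_discerns Pr \<kappa> K \<Theta>0 (\<Phi> k)" for k
  proof -
    define \<eta> where "\<eta> n = (if n < max k (M k) then 1 else \<epsilon> n)" for n
    have "\<epsilon> = (\<lambda>n. inverse (real (Suc n) ^ 2))" by (simp add: \<epsilon>_def fun_eq_iff inverse_eq_divide)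
    then have "summable \<epsilon>"
      using summable_Suc_iff[of "\<lambda>n. inverse (real n ^ 2)"] inverse_power_summable[of 2, where 'a = real]
      by (simp only:)
    moreover have "eventually (\<lambda>n. \<eta> n = \<epsilon> n) sequentially"
      using eventually_ge_at_top[of "max k (M k)"] by eventually_elim (auto simp: \<eta>_def)
    ultimately have "summable \<eta>" using summable_cong by blast
    have "\<eta> n \<ge> 0" for n by (simp add: \<eta>_def \<epsilon>_def)
    have Td: "zero_one_tests \<Theta>0 (\<Phi> (d n)) (T (d n)) (\<lambda>i. A (d n) * exp (- c (d n) * real i))" for n
      using T[of "d n"] .
    have le: "ennreal (A (d n) * exp (- c (d n) * real n)) \<le> ennreal (\<epsilon> n)" if "n \<ge> max k (M k)" for n
      using M[OF d(2)[OF that]] by (rule ennreal_leI)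
    have "zero_one_tests \<Theta>0 (\<Phi> k) K \<eta>"
      unfolding zero_one_tests_def
    proof (intro conjI allI ballI)
      show "is_test n (K n)" "K n x = 0 \<or> K n x = 1" for n x
        using Td[of n] by (auto simp: zero_one_tests_def K_def)
      fix n \<mu>
      have one: "emeasure (Pr \<mu>) E \<le> 1" if "\<mu> \<in> finite_measures" for E
        using prob_space.emeasure_le_1[OF prob_space_Pr[OF that]] .
      show "error_prob \<mu> n (K n) 0 \<le> ennreal (\<eta> n)" if "\<mu> \<in> \<Theta>0"
      proof (cases "n < max k (M k)")
        case True
        then show ?thesis using one sub(1) that by (auto simp: \<eta>_def)
      next
        case False
        then have "error_prob \<mu> n (K n) 0 \<le> ennreal (A (d n) * exp (- c (d n) * real n))"
          using Td[of n] that by (simp add: zero_one_tests_def K_def)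
        also have "\<dots> \<le> ennreal (\<epsilon> n)" by (rule le) (use False in linarith)
        finally show ?thesis using False by (simp add: \<eta>_def)
      qed
      show "error_prob \<mu> n (K n) 1 \<le> ennreal (\<eta> n)" if "\<mu> \<in> \<Phi> k"
      proof (cases "n < max k (M k)")
        case True
        then show ?thesis using one sub(2)[of k] that by (auto simp: \<eta>_def)
      next
        case False
        then have "k \<le> d n" by (intro d(1)) linarith
        then have "\<mu> \<in> \<Phi> (d n)" using mono that by blast
        then have "error_prob \<mu> n (K n) 1 \<le> ennreal (A (d n) * exp (- c (d n) * real n))"
          using Td[of n] by (simp add: zero_one_tests_def K_def)
        also have "\<dots> \<le> ennreal (\<epsilon> n)" by (rule le) (use False in linarith)
        finally show ?thesis using False by (simp add: \<eta>_def)
      qed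
    qed
    from summable_errors_uniformly_discern(1)[OF sub(1) sub(2) this \<open>summable \<eta>\<close> \<open>\<And>n. \<eta> n \<ge> 0\<close>]
    show ?thesis unfolding uniformly_discerns_def by blast
  qed
  then show ?thesis by blast
qed

end

lemma integral_gap_closure:
  assumes f: "separating_functions f" and \<nu>: "\<nu> \<in> C" "\<nu> \<in> finite_measures"
  shows "\<nu> \<notin> weak_topology closure_of {\<mu> \<in> finite_measures. \<forall>\<nu>\<in>C. integral_gap f k \<mu> \<nu>}"
proof
  assume cl: "\<nu> \<in> weak_topology closure_of {\<mu> \<in> finite_measures. \<forall>\<nu>\<in>C. integral_gap f k \<mu> \<nu>}"
  define W where "W = topspace weak_topology \<inter>
    (\<Inter>i\<in>{..k}. {\<mu> \<in> topspace weak_topology. \<bar>(\<integral>x. f i x \<partial>\<mu>) - (\<integral>x. f i x \<partial>\<nu>)\<bar> < 1 / Suc k})"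
  have fc: "continuous_on UNIV (f i)" for i using f by (simp add: separating_functions_def)
  have "openin weak_topology W"
    unfolding W_def
    by (intro openin_Int openin_topspace openin_Inter)
      (auto intro!: openin_close_value weak_integral_continuous fc separating_functions_bounded f simp del: topspace_weak_topology)
  moreover have "\<nu> \<in> W" using \<nu> by (auto simp: W_def)
  ultimately obtain \<mu> where "\<forall>\<nu>\<in>C. integral_gap f k \<mu> \<nu>" "\<mu> \<in> W"
    using cl unfolding in_closure_of by blast
  then have "integral_gap f k \<mu> \<nu>" using \<nu> by blast
  then obtain i where i: "i < k" "\<bar>(\<integral>x. f i x \<partial>\<nu>) - (\<integral>x. f i x \<partial>\<mu>)\<bar> \<ge> 1 / Suc k"
    by (auto simp: integral_gap_def)
  have "\<bar>(\<integral>x. f i x \<partial>\<mu>) - (\<integral>x. f i x \<partial>\<nu>)\<bar> < 1 / Suc k"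
    using \<open>\<mu> \<in> W\<close> i(1) unfolding W_def by fastforce
  with i(2) show False by linarith
qed

text \<open>
  The alternatives \<open>\<Phi> k\<close> consist of the measures that have a gap with parameter \<open>k\<close> to every point of the
  compact closure. Their weak closures avoid it, and together they exhaust its complement.
\<close>

lemma (in poisson_model) compact_asymptotically_discernible:
  fixes f :: "nat \<Rightarrow> 'a \<Rightarrow> real"
  assumes f: "separating_functions f" and sub: "\<Theta>0 \<subseteq> finite_measures"
    and comp: "relatively_compact_in weak_topology \<Theta>0"
  shows "uniformly_asymptotically_discernible Pr \<kappa> \<Theta>0"
proof -
  define C where "C = weak_topology closure_of \<Theta>0"
  define \<Phi> where "\<Phi> k = {\<mu> \<in> finite_measures. \<forall>\<nu>\<in>C. integral_gap f k \<mu> \<nu>}" for k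
  have Csub: "C \<subseteq> finite_measures" using closure_of_subset_topspace[of weak_topology \<Theta>0] by (simp add: C_def)
  have fc: "continuous_on UNIV (f i)" for i using f by (simp add: separating_functions_def)
  have mono: "\<Phi> k \<subseteq> \<Phi> l" if "k \<le> l" for k l
    using integral_gap_mono[OF _ that] by (auto simp: \<Phi>_def)
  have "C \<inter> weak_topology closure_of \<Phi> k = {}" for k
    using integral_gap_closure[OF f, of _ C k] Csub by (auto simp: \<Phi>_def)
  then have "exponentially_separable \<Theta>0 (\<Phi> k)" for k
    using sub comp by (intro compact_imp_exponentially_separable) (auto simp: C_def \<Phi>_def)
  then obtain K where K: "\<And>k. uniformly_discerns Pr \<kappa> K \<Theta>0 (\<Phi> k)"
    using diagonal_tests[of \<Theta>0 \<Phi>] sub mono by (auto simp: \<Phi>_def)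
  have cover: "\<mu> \<in> (\<Union>k\<in>{1..}. \<Phi> k) \<union> C" if \<mu>: "\<mu> \<in> finite_measures" for \<mu>
  proof (cases "\<mu> \<in> C")
    case False
    then obtain k where "\<forall>\<nu>\<in>C. integral_gap f k \<mu> \<nu>"
      using compact_integral_gap[OF f topspace_weak_topology _ _ \<mu> False] comp
        weak_integral_continuous[OF fc separating_functions_bounded[OF f]]
      unfolding C_def relatively_compact_in_def by blast
    then have "\<mu> \<in> \<Phi> k" using \<mu> by (simp add: \<Phi>_def)
    then have "\<mu> \<in> \<Phi> (Suc k)" using mono[of k "Suc k"] by auto
    then show ?thesis by force
  qed blast
  show ?thesis
    unfolding uniformly_asymptotically_discernible_def
  proof (intro exI[of _ \<Phi>] exI[of _ K] conjI allI impI)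
    show "(\<Union>k\<in>{1..}. \<Phi> k) \<union> weak_topology closure_of \<Theta>0 = finite_measures"
      unfolding C_def[symmetric]
    proof (rule equalityI)
      show "(\<Union>k\<in>{1..}. \<Phi> k) \<union> C \<subseteq> finite_measures" using Csub by (auto simp: \<Phi>_def)
    qed (use cover in blast)
    show "\<Phi> k \<subseteq> finite_measures" "\<Phi> k \<subseteq> \<Phi> (Suc k)" for k
      using mono[of k "Suc k"] by (auto simp: \<Phi>_def)
    show "uniformly_discerns Pr \<kappa> K \<Theta>0 (\<Phi> k)" for k by (rule K)
  qed
qed

section \<open>Uniform absolute continuity on tau-compact sets\<close>

text \<open>
  Dini's theorem: the continuous functions \<open>\<mu> \<mapsto> \<mu>(A n)\<close> decrease pointwise to \<open>0\<close> on a compact set.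
\<close>

lemma tau_compact_Dini:
  fixes M :: "'a::topological_space measure set"
  assumes M: "compactin tau_topology M" and A: "\<And>n. A n \<in> sets borel" "decseq A"
    and null: "\<And>\<mu>. \<mu> \<in> M \<Longrightarrow> measure \<mu> (\<Inter>n. A n) = 0" and "e > 0"
  shows "\<exists>n. \<forall>\<mu>\<in>M. measure \<mu> (A n) < e"
proof -
  define U where "U n = {\<mu> \<in> topspace tau_topology. measure \<mu> (A n) \<in> {..<e}}" for n
  have "openin tau_topology (U n)" for n
    unfolding U_def by (intro openin_continuous_map_preimage[OF tau_measure_continuous] A) auto
  moreover have "M \<subseteq> \<Union>(range U)"
  proof
    fix \<mu> assume \<mu>: "\<mu> \<in> M"
    then have fm: "\<mu> \<in> finite_measures" using compactin_subset_topspace[OF M] by auto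
    interpret finite_measure \<mu> using finite_measuresD(3)[OF fm] .
    have "(\<lambda>n. measure \<mu> (A n)) \<longlonglongrightarrow> measure \<mu> (\<Inter>n. A n)"
      using A finite_measuresD(1)[OF fm] by (intro finite_Lim_measure_decseq) auto
    then have "eventually (\<lambda>n. measure \<mu> (A n) < e) sequentially"
      using null[OF \<mu>] \<open>e > 0\<close> by (auto dest: order_tendstoD(2))
    then obtain n where "measure \<mu> (A n) < e" by (auto simp: eventually_sequentially)
    then have "\<mu> \<in> U n" using fm by (simp add: U_def)
    then show "\<mu> \<in> \<Union>(range U)" by blast
  qed
  ultimately obtain \<F> where \<F>: "finite \<F>" "\<F> \<subseteq> range U" "M \<subseteq> \<Union>\<F>"
    using M unfolding compactin_def by (metis (no_types, lifting) imageE)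
  then obtain I where I: "finite I" "\<F> = U ` I" by (meson finite_subset_image)
  have "measure \<mu> (A (Max (insert 0 I))) < e" if \<mu>: "\<mu> \<in> M" for \<mu>
  proof -
    from \<mu> \<F> I obtain n where n: "n \<in> I" "\<mu> \<in> U n" by auto
    then have fm: "\<mu> \<in> finite_measures" and lt: "measure \<mu> (A n) < e" by (auto simp: U_def)
    interpret finite_measure \<mu> using finite_measuresD(3)[OF fm] .
    have "n \<le> Max (insert 0 I)" using n I by auto
    then have "measure \<mu> (A (Max (insert 0 I))) \<le> measure \<mu> (A n)"
      using A finite_measuresD(1)[OF fm] by (intro finite_measure_mono decseqD[OF A(2)]) auto
    with lt show ?thesis by simp
  qed
  then show ?thesis by blast
qed

text \<open>
  Otherwise one can choose \<open>\<mu>\<^sub>n\<close> in \<open>M\<close> and sets \<open>A\<^sub>n\<close> with \<open>\<mu>\<^sub>n(A\<^sub>n) \<ge> \<eta>\<close>, while \<open>A\<^sub>n\<close> has measure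
  below \<open>2\<^sup>-\<^sup>n\<close> for the earlier \<open>\<mu>\<^sub>i\<close>. The limit superior of the sets \<open>A\<^sub>n\<close> is then null for every \<open>\<mu>\<^sub>i\<close>; after
  its removal the sets \<open>B\<^sub>k = \<Union>\<^sub>j A\<^sub>j\<^sub>+\<^sub>k\<close> decrease to the empty set, and Dini's theorem contradicts the choice.
\<close>

lemma tau_compact_uniformly_dominated:
  fixes M :: "'a::topological_space measure set"
  assumes M: "compactin tau_topology M" and "\<eta> > 0"
  shows "\<exists>F \<delta>. finite F \<and> F \<subseteq> M \<and> \<delta> > 0 \<and>
    (\<forall>A\<in>sets borel. (\<forall>\<nu>\<in>F. measure \<nu> A < \<delta>) \<longrightarrow> (\<forall>\<mu>\<in>M. measure \<mu> A < \<eta>))"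
proof (rule ccontr)
  assume neg: "\<not> ?thesis"
  have Mfm: "\<mu> \<in> finite_measures" if "\<mu> \<in> M" for \<mu> using that compactin_subset_topspace[OF M] by auto
  have ex: "\<exists>p. fst p \<in> sets borel \<and> snd p \<in> M \<and> (\<forall>\<nu>\<in>F. measure \<nu> (fst p) < \<delta>) \<and> \<eta> \<le> measure (snd p) (fst p)"
    if "finite F" "F \<subseteq> M" "\<delta> > 0" for F \<delta>
  proof -
    from neg that have "\<not> (\<forall>A\<in>sets borel. (\<forall>\<nu>\<in>F. measure \<nu> A < \<delta>) \<longrightarrow> (\<forall>\<mu>\<in>M. measure \<mu> A < \<eta>))" by blast
    then obtain A \<mu> where "A \<in> sets borel" "\<forall>\<nu>\<in>F. measure \<nu> A < \<delta>" "\<mu> \<in> M" "\<eta> \<le> measure \<mu> A"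
      by (auto simp: not_less)
    then show ?thesis by (intro exI[of _ "(A, \<mu>)"]) simp
  qed
  define ch where "ch F \<delta> = (SOME p. fst p \<in> sets borel \<and> snd p \<in> M \<and> (\<forall>\<nu>\<in>F. measure \<nu> (fst p) < \<delta>) \<and> \<eta> \<le> measure (snd p) (fst p))"
    for F :: "'a measure set" and \<delta> :: real
  have ch: "fst (ch F \<delta>) \<in> sets borel \<and> snd (ch F \<delta>) \<in> M \<and> (\<forall>\<nu>\<in>F. measure \<nu> (fst (ch F \<delta>)) < \<delta>) \<and> \<eta> \<le> measure (snd (ch F \<delta>)) (fst (ch F \<delta>))"
    if "finite F" "F \<subseteq> M" "\<delta> > 0" for F \<delta>
    unfolding ch_def by (rule someI_ex[OF ex[OF that]])
  \<comment> \<open>\<open>G n\<close> collects the measures chosen before stage \<open>n\<close>.\<close>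
  define G where "G = rec_nat {} (\<lambda>n F. insert (snd (ch F ((1 / 2) ^ n))) F)"
  have G0: "G 0 = {}" and GS: "G (Suc n) = insert (snd (ch (G n) ((1 / 2) ^ n))) (G n)" for n
    by (simp_all add: G_def)
  have Gfin: "finite (G n) \<and> G n \<subseteq> M" for n
    by (induction n) (use ch in \<open>auto simp: G0 GS\<close>)
  define A where "A n = fst (ch (G n) ((1 / 2) ^ n))" for n
  define m where "m n = snd (ch (G n) ((1 / 2) ^ n))" for n
  have A: "A n \<in> sets borel" and mM: "m n \<in> M" and small: "\<And>\<nu>. \<nu> \<in> G n \<Longrightarrow> measure \<nu> (A n) < (1 / 2) ^ n"
    and big: "\<eta> \<le> measure (m n) (A n)" for n
    using ch[of "G n" "(1 / 2) ^ n"] Gfin[of n] by (auto simp: A_def m_def)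
  have mG: "m i \<in> G j" if "i < j" for i j
    using that by (induction j) (auto simp: GS m_def less_Suc_eq)
  define B where "B k = (\<Union>j. A (j + k))" for k
  have Bsets: "B k \<in> sets borel" for k using A by (auto simp: B_def)
  have dec: "decseq B"
  proof (rule decseq_SucI)
    fix k show "B (Suc k) \<subseteq> B k"
      unfolding B_def by (intro UN_least) (metis UN_upper UNIV_I add_Suc_shift)
  qed
  have mB: "measure (m i) (B k) \<le> 2 * (1 / 2) ^ k" if "i < k" for i k
  proof -
    interpret finite_measure "m i" using finite_measuresD(3)[OF Mfm[OF mM]] .
    have le: "measure (m i) (A (j + k)) \<le> (1 / 2) ^ k * (1 / 2) ^ j" for j
      using small[OF mG, of i "j + k"] that by (simp add: power_add mult.commute less_imp_le)
    have sums: "(\<lambda>j. (1 / 2) ^ k * (1 / 2) ^ j) sums ((1 / 2) ^ k * (1 / (1 - 1 / 2)) :: real)"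
      by (intro sums_mult geometric_sums) auto
    have summ: "summable (\<lambda>j. measure (m i) (A (j + k)))"
      by (rule summable_comparison_test'[OF sums_summable[OF sums]]) (use le in simp)
    have "measure (m i) (B k) \<le> (\<Sum>j. measure (m i) (A (j + k)))"
      unfolding B_def using A finite_measuresD(1)[OF Mfm[OF mM]] summ
      by (intro finite_measure_subadditive_countably) auto
    also have "\<dots> \<le> (\<Sum>j. (1 / 2) ^ k * (1 / 2) ^ j)"
      by (intro suminf_le le summ sums_summable[OF sums])
    also have "\<dots> = 2 * (1 / 2) ^ k" using sums_unique[OF sums] by simp
    finally show ?thesis .
  qed
  define N where "N = (\<Inter>k. B k)"
  have Nsets: "N \<in> sets borel" using Bsets by (auto simp: N_def)
  have mN: "measure (m i) N = 0" for i
  proof -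
    interpret finite_measure "m i" using finite_measuresD(3)[OF Mfm[OF mM]] .
    have "(\<lambda>k. 2 * (1 / 2) ^ k :: real) \<longlonglongrightarrow> 2 * 0"
      by (intro tendsto_mult tendsto_const LIMSEQ_power_zero) auto
    moreover have "measure (m i) N \<le> 2 * (1 / 2) ^ k" if "k \<ge> Suc i" for k
    proof -
      have "measure (m i) N \<le> measure (m i) (B k)"
        using Bsets finite_measuresD(1)[OF Mfm[OF mM]] by (intro finite_measure_mono) (auto simp: N_def)
      then show ?thesis using mB[of i k] that by simp
    qed
    ultimately have "measure (m i) N \<le> 2 * 0"
      by (intro LIMSEQ_le_const[of "\<lambda>k. 2 * (1 / 2) ^ k"]) auto
    then show ?thesis by (simp add: measure_le_0_iff)
  qed
  have dec': "decseq (\<lambda>k. B k - N)" using dec by (auto simp: decseq_def)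
  have empty: "(\<Inter>k. B k - N) = {}" by (auto simp: N_def)
  have "\<exists>k. \<forall>\<mu>\<in>M. measure \<mu> (B k - N) < \<eta>"
    using Bsets Nsets by (intro tau_compact_Dini[OF M _ dec' _ \<open>\<eta> > 0\<close>]) (auto simp only: empty measure_empty)
  then obtain k where k: "\<forall>\<mu>\<in>M. measure \<mu> (B k - N) < \<eta>" by blast
  interpret finite_measure "m k" using finite_measuresD(3)[OF Mfm[OF mM]] .
  have "A k \<subseteq> B k" unfolding B_def by (rule UN_I[of 0, THEN subsetI]) auto
  then have "measure (m k) (A k) \<le> measure (m k) ((B k - N) \<union> N)"
    using Bsets Nsets finite_measuresD(1)[OF Mfm[OF mM]] by (intro finite_measure_mono) auto
  also have "\<dots> \<le> measure (m k) (B k - N) + measure (m k) N"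
    using Bsets Nsets finite_measuresD(1)[OF Mfm[OF mM]] by (intro measure_Un_le) auto
  also have "\<dots> < \<eta>" using k mM[of k] mN[of k] by simp
  finally show False using big[of k] by simp
qed

lemma finite_sum_measure:
  assumes "finite F" "F \<subseteq> finite_measures"
  shows "\<exists>\<nu>\<in>finite_measures. \<forall>A\<in>sets borel. measure \<nu> A = (\<Sum>\<mu>\<in>F. measure \<mu> A)"
proof -
  have F: "sets \<mu> = sets borel" "finite_measure \<mu>" if "\<mu> \<in> F" for \<mu>
    using finite_measuresD[OF subsetD[OF assms(2) that]] by blast+
  define \<nu> where "\<nu> = measure_of UNIV (sets borel) (\<lambda>A. \<Sum>\<mu>\<in>F. emeasure \<mu> A)"
  have "countably_additive (sets borel) (\<lambda>A. \<Sum>\<mu>\<in>F. emeasure \<mu> A)"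
  proof (rule countably_additiveI)
    fix A :: "nat \<Rightarrow> 'a set" assume A: "range A \<subseteq> sets borel" "disjoint_family A"
    have "(\<Sum>i. \<Sum>\<mu>\<in>F. emeasure \<mu> (A i)) = (\<Sum>\<mu>\<in>F. \<Sum>i. emeasure \<mu> (A i))"
      by (rule suminf_sum) (rule summableI)
    also have "\<dots> = (\<Sum>\<mu>\<in>F. emeasure \<mu> (\<Union>i. A i))"
      using A F by (intro sum.cong refl suminf_emeasure) auto
    finally show "(\<Sum>i. \<Sum>\<mu>\<in>F. emeasure \<mu> (A i)) = (\<Sum>\<mu>\<in>F. emeasure \<mu> (\<Union>i. A i))" .
  qed
  then have e: "emeasure \<nu> A = (\<Sum>\<mu>\<in>F. emeasure \<mu> A)" if "A \<in> sets borel" for A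
    unfolding \<nu>_def using that sets.sigma_algebra_axioms[of borel]
    by (intro emeasure_measure_of_sigma) (auto simp: positive_def)
  have s: "sets \<nu> = sets borel"
    unfolding \<nu>_def using sets.sigma_sets_eq[of borel] sets.space_closed[of borel]
    by (subst sets_measure_of) auto
  have real: "(\<Sum>\<mu>\<in>F. emeasure \<mu> A) = ennreal (\<Sum>\<mu>\<in>F. measure \<mu> A)" for A
  proof -
    have "(\<Sum>\<mu>\<in>F. emeasure \<mu> A) = (\<Sum>\<mu>\<in>F. ennreal (measure \<mu> A))"
      by (intro sum.cong refl finite_measure.emeasure_eq_measure F(2))
    then show ?thesis by (simp add: sum_ennreal)
  qed
  have "emeasure \<nu> (space \<nu>) \<noteq> \<infinity>"
    using e[of UNIV] sets_eq_imp_space_eq[OF s] by (simp add: real)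
  then have "\<nu> \<in> finite_measures" using s by (auto simp: finite_measures_def intro: finite_measureI)
  moreover have "measure \<nu> A = (\<Sum>\<mu>\<in>F. measure \<mu> A)" if "A \<in> sets borel" for A
    using e[OF that] by (simp add: real measure_def sum_nonneg)
  ultimately show ?thesis by blast
qed

section \<open>Approximation by cylinder events\<close>

text \<open>
  The sets that can be approximated form a \<open>\<sigma>\<close>-algebra: a countable union is close to a finite one, whose
  members are approximated separately. Two measures are treated at once because
  estimates are transferred from one law to another.
\<close>

lemma algebra_approximation:
  fixes Q1 Q2 :: "'b measure"
  assumes fin: "finite_measure Q1" "finite_measure Q2"
    and G: "sets Q1 = sigma_sets \<Omega> G" "sets Q2 = sigma_sets \<Omega> G"
    and alg: "\<Omega> \<in> G" "G \<subseteq> Pow \<Omega>" "\<And>a. a \<in> G \<Longrightarrow> \<Omega> - a \<in> G" "\<And>a b. a \<in> G \<Longrightarrow> b \<in> G \<Longrightarrow> a \<union> b \<in> G"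
    and A: "A \<in> sigma_sets \<Omega> G" and "e > 0"
  shows "\<exists>A'\<in>G. measure Q1 (sym_diff A A') < e \<and> measure Q2 (sym_diff A A') < e"
  using A \<open>e > 0\<close>
proof (induction arbitrary: e rule: sigma_sets.induct)
  case (Basic a)
  then show ?case by (intro bexI[of _ a]) auto
next
  case Empty
  then show ?case using alg(1) alg(3)[OF alg(1)] by (intro bexI[of _ "{}"]) auto
next
  case (Compl a)
  then obtain A' where A': "A' \<in> G" "measure Q1 (sym_diff a A') < e" "measure Q2 (sym_diff a A') < e" by blast
  have "a \<subseteq> \<Omega>" using Compl(1) alg(2) sigma_sets_into_sp by blast
  then have "sym_diff (\<Omega> - a) (\<Omega> - A') = sym_diff a A'" using A'(1) alg(2) by blast
  then show ?case using A' alg(3) by (intro bexI[of _ "\<Omega> - A'"]) auto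
next
  case (Union a)
  have sets: "a i \<in> sets Q1" "a i \<in> sets Q2" for i using Union(1) G by auto
  have Gsets: "b \<in> sets Q1" "b \<in> sets Q2" if "b \<in> G" for b using that G by auto
  have stage: "\<exists>N. \<forall>n\<ge>N. measure Q ((\<Union>i. a i) - (\<Union>i<n. a i)) < e / 2"
    if "finite_measure Q" "\<And>i. a i \<in> sets Q" for Q
  proof -
    interpret finite_measure Q by fact
    have "(\<lambda>n. measure Q ((\<Union>i. a i) - (\<Union>i<n. a i))) \<longlonglongrightarrow> measure Q (\<Inter>n. (\<Union>i. a i) - (\<Union>i<n. a i))"
      using that(2) by (intro finite_Lim_measure_decseq) (auto simp: decseq_def)
    moreover have "(\<Inter>n. (\<Union>i. a i) - (\<Union>i<n. a i)) = {}" by auto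
    ultimately have "(\<lambda>n. measure Q ((\<Union>i. a i) - (\<Union>i<n. a i))) \<longlonglongrightarrow> 0"
      by (simp only: measure_empty)
    from order_tendstoD(2)[OF this, of "e / 2"] Union(3) show ?thesis
      by (simp add: eventually_sequentially)
  qed
  obtain N1 N2 where N12: "\<forall>n\<ge>N1. measure Q1 ((\<Union>i. a i) - (\<Union>i<n. a i)) < e / 2"
    "\<forall>n\<ge>N2. measure Q2 ((\<Union>i. a i) - (\<Union>i<n. a i)) < e / 2"
    using stage[OF fin(1) sets(1)] stage[OF fin(2) sets(2)] by blast
  define N where "N = max N1 N2"
  have N: "measure Q1 ((\<Union>i. a i) - (\<Union>i<N. a i)) < e / 2" "measure Q2 ((\<Union>i. a i) - (\<Union>i<N. a i)) < e / 2"
    using N12 by (auto simp: N_def)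
  \<comment> \<open>The \<open>N\<close> separate errors then add up to less than \<open>e / 2\<close>.\<close>
  define e' where "e' = e / (2 * (real N + 1))"
  have "e' > 0" using Union(3) by (simp add: e'_def)
  then have "\<forall>i. \<exists>A'\<in>G. measure Q1 (sym_diff (a i) A') < e' \<and> measure Q2 (sym_diff (a i) A') < e'"
    using Union(2) by blast
  then obtain a' where a': "\<And>i. a' i \<in> G" "\<And>i. measure Q1 (sym_diff (a i) (a' i)) < e'"
    "\<And>i. measure Q2 (sym_diff (a i) (a' i)) < e'" by metis
  define A' where "A' = (\<Union>i<N. a' i)"
  have "{} \<in> G" using alg(1) alg(3)[OF alg(1)] by simp
  then have "A' \<in> G" unfolding A'_def
    by (induction N) (auto simp: lessThan_Suc intro: alg(4) a'(1))
  have bound: "measure Q (sym_diff (\<Union>i. a i) A') < e"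
    if Q: "finite_measure Q" "\<And>i. a i \<in> sets Q" "\<And>b. b \<in> G \<Longrightarrow> b \<in> sets Q"
      and QN: "measure Q ((\<Union>i. a i) - (\<Union>i<N. a i)) < e / 2" and Qa: "\<And>i. measure Q (sym_diff (a i) (a' i)) < e'" for Q
  proof -
    interpret finite_measure Q by fact
    have m: "sym_diff (a i) (a' i) \<in> sets Q" for i using Q a'(1) by auto
    have "measure Q (sym_diff (\<Union>i. a i) A') \<le> measure Q (((\<Union>i. a i) - (\<Union>i<N. a i)) \<union> (\<Union>i<N. sym_diff (a i) (a' i)))"
      using Q(2) m by (intro finite_measure_mono) (auto simp: A'_def)
    also have "\<dots> \<le> measure Q ((\<Union>i. a i) - (\<Union>i<N. a i)) + measure Q (\<Union>i<N. sym_diff (a i) (a' i))"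
      using Q(2) m by (intro measure_Un_le) auto
    also have "measure Q (\<Union>i<N. sym_diff (a i) (a' i)) \<le> (\<Sum>i<N. measure Q (sym_diff (a i) (a' i)))"
      using m by (intro finite_measure_subadditive_finite) auto
    also have "\<dots> \<le> (\<Sum>i<N. e')" using Qa by (intro sum_mono) (simp add: less_imp_le)
    also have "\<dots> \<le> e / 2" using Union(3) by (simp add: e'_def field_simps)
    finally show ?thesis using QN by linarith
  qed
  show ?case
    using bound[OF fin(1) sets(1) Gsets(1) N(1) a'(2)] bound[OF fin(2) sets(2) Gsets(2) N(2) a'(3)] \<open>A' \<in> G\<close> by blast
qed

lemma measure_sym_diff_close:
  assumes "finite_measure Q" "A \<in> sets Q" "A' \<in> sets Q"
  shows "\<bar>measure Q A - measure Q A'\<bar> \<le> measure Q (sym_diff A A')"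
proof -
  interpret finite_measure Q by fact
  have "measure Q A \<le> measure Q (A' \<union> sym_diff A A')" "measure Q A' \<le> measure Q (A \<union> sym_diff A A')"
    using assms by (intro finite_measure_mono; auto)+
  moreover have "measure Q (A' \<union> sym_diff A A') \<le> measure Q A' + measure Q (sym_diff A A')"
    "measure Q (A \<union> sym_diff A A') \<le> measure Q A + measure Q (sym_diff A A')"
    using assms by (intro measure_Un_le; auto)+
  ultimately show ?thesis by linarith
qed

section \<open>Poisson samples over tau-compact sets of means\<close>

text \<open>
  The alternative \<open>c = 0\<close> covers the sets on which \<open>a\<close> is not bounded by \<open>L * b\<close>: there the
  comparison is made for empty counts only.
\<close>

lemma poisson_weight_dominated:
  assumes "L \<ge> 1" "a \<ge> 0" "b \<ge> 0" and "a \<le> L * b \<or> c = 0"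
  shows "poisson_weight a c \<le> L ^ c * exp b * poisson_weight b c"
proof -
  have pow: "a ^ c \<le> L ^ c * b ^ c"
  proof (cases "c = 0")
    case False
    then have "a ^ c \<le> (L * b) ^ c" using assms by (intro power_mono) auto
    then show ?thesis by (simp add: power_mult_distrib)
  qed simp
  have "poisson_weight a c \<le> L ^ c * b ^ c / fact c * 1"
    unfolding poisson_weight_def using assms pow by (intro mult_mono divide_right_mono) auto
  also have "\<dots> = L ^ c * exp b * poisson_weight b c"
    by (simp add: poisson_weight_def exp_minus)
  finally show ?thesis .
qed

context poisson_model
begin

lemma prob_point_in_set:
  assumes \<mu>: "\<mu> \<in> finite_measures" and "U \<in> sets borel" "i < n"
  shows "measure (sample_law \<mu> n) {x \<in> space (samples n). measure (x i) U \<noteq> 0} \<le> measure \<mu> U"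
proof -
  interpret prob_space "Pr \<mu>" by (rule prob_space_Pr[OF \<mu>])
  have ev: "{x \<in> space (samples n). measure (x i) U \<noteq> 0} \<in> sets (samples n)"
    using measurable_sample_count[OF assms(3,2)] by measurable
  have meas: "(\<lambda>s. measure (\<kappa> i s) U) \<in> borel_measurable (Pr \<mu>)"
    by (rule measurable_compose[OF measurable_observation[OF \<mu>] measurable_count[OF assms(2)]])
  have all: "\<forall>k::nat. prob {s \<in> space (Pr \<mu>). measure (\<kappa> i s) U = real k} = measure \<mu> U ^ k / fact k * exp (- measure \<mu> U)"
    using poisson_observation[OF \<mu>, of i] assms(2) unfolding poisson_process_def by blast
  from spec[OF this, of 0]
  have zero: "prob {s \<in> space (Pr \<mu>). measure (\<kappa> i s) U = real 0} = exp (- measure \<mu> U)"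
    by simp
  have "measure (sample_law \<mu> n) {x \<in> space (samples n). measure (x i) U \<noteq> 0}
      = prob (sample \<kappa> n -` {x \<in> space (samples n). measure (x i) U \<noteq> 0} \<inter> space (Pr \<mu>))"
    unfolding sample_law_def by (rule measure_distr[OF _ ev]) (simp add: sample_eq_subsample measurable_subsample[OF \<mu>])
  also have "sample \<kappa> n -` {x \<in> space (samples n). measure (x i) U \<noteq> 0} \<inter> space (Pr \<mu>)
      = space (Pr \<mu>) - {s \<in> space (Pr \<mu>). measure (\<kappa> i s) U = real 0}"
    using subsample_in_space[OF \<mu>, of _ "\<lambda>i. i" n] \<open>i < n\<close> by (auto simp: sample_eq_subsample) (auto simp: subsample_def)
  also have "prob \<dots> = 1 - prob {s \<in> space (Pr \<mu>). measure (\<kappa> i s) U = real 0}"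
    by (intro prob_compl borel_measurable_eq meas borel_measurable_const)
  also note zero
  finally show ?thesis using exp_ge_add_one_self[of "- measure \<mu> U"] by simp
qed

lemma prob_many_points:
  assumes \<mu>: "\<mu> \<in> finite_measures" and "i < n"
  shows "measure (sample_law \<mu> n) {x \<in> space (samples n). k \<le> measure (x i) UNIV}
    \<le> exp (measure \<mu> UNIV * (exp 1 - 1) - k)"
proof -
  interpret prob_space "Pr \<mu>" by (rule prob_space_Pr[OF \<mu>])
  have ev: "{x \<in> space (samples n). k \<le> measure (x i) UNIV} \<in> sets (samples n)"
    using measurable_sample_count[OF assms(2), of UNIV] by measurable
  have "indep_vars (\<lambda>_. borel) (\<lambda>j s. 1 * measure (\<kappa> j s) UNIV) {i}"
    by (rule indep_vars_compose2[OF indep_vars_subset[OF indep_observations[OF \<mu>]]])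
      (auto intro!: borel_measurable_times measurable_count)
  from exponential_Markov_indep[OF this, of k]
  have "emeasure (Pr \<mu>) {s \<in> space (Pr \<mu>). k \<le> measure (\<kappa> i s) UNIV}
    \<le> ennreal (exp (- k)) * ennreal (exp (measure \<mu> UNIV * (exp 1 - 1)))"
    using poisson_exponential_moment[OF \<mu>, of UNIV 1 i] by simp
  also have "\<dots> = ennreal (exp (measure \<mu> UNIV * (exp 1 - 1) - k))"
    by (simp add: ennreal_mult[symmetric] exp_add[symmetric])
  finally have le: "prob {s \<in> space (Pr \<mu>). k \<le> measure (\<kappa> i s) UNIV} \<le> exp (measure \<mu> UNIV * (exp 1 - 1) - k)"
    by (simp add: emeasure_eq_measure)
  have "measure (sample_law \<mu> n) {x \<in> space (samples n). k \<le> measure (x i) UNIV}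
      = prob (sample \<kappa> n -` {x \<in> space (samples n). k \<le> measure (x i) UNIV} \<inter> space (Pr \<mu>))"
    unfolding sample_law_def by (rule measure_distr[OF _ ev]) (simp add: sample_eq_subsample measurable_subsample[OF \<mu>])
  also have "sample \<kappa> n -` {x \<in> space (samples n). k \<le> measure (x i) UNIV} \<inter> space (Pr \<mu>)
      = {s \<in> space (Pr \<mu>). k \<le> measure (\<kappa> i s) UNIV}"
    using subsample_in_space[OF \<mu>, of _ "\<lambda>i. i" n] \<open>i < n\<close> by (auto simp: sample_eq_subsample) (auto simp: subsample_def)
  finally show ?thesis using le by simp
qed

text \<open>
  Let \<open>U\<close> be the union of those blocks of the partition on which \<open>\<mu>\<close> exceeds \<open>L * \<nu>\<close>. Outside two
  events of small probability, a point in \<open>U\<close> or at least \<open>k\<close> points in one of the observations, the Poisson weights under \<open>\<mu>\<close>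
  are at most a constant times those under \<open>\<nu>\<close>. The constant does not depend on the partition, which is why
  the estimate extends to all events by approximation.
\<close>

lemma cylinder_law_dominated:
  assumes \<mu>: "\<mu> \<in> finite_measures" and \<nu>: "\<nu> \<in> finite_measures" and L: "L \<ge> 1"
    and dom: "\<And>U. U \<in> sets borel \<Longrightarrow> L * measure \<nu> U \<le> measure \<mu> U \<Longrightarrow> measure \<mu> U \<le> \<eta>"
    and A: "A \<in> cylinders n"
  shows "measure (sample_law \<mu> n) A \<le> real n * \<eta> + real n * exp (measure \<mu> UNIV * (exp 1 - 1) - real k)
    + (L ^ k * exp (measure \<nu> UNIV)) ^ n * measure (sample_law \<nu> n) A"
proof -
  interpret Q\<mu>: prob_space "sample_law \<mu> n" by (rule prob_space_sample_law[OF \<mu>])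
  interpret Q\<nu>: prob_space "sample_law \<nu> n" by (rule prob_space_sample_law[OF \<nu>])
  obtain \<P> where \<P>: "finite \<P>" "\<P> \<subseteq> sets borel" "disjoint \<P>" "\<Union>\<P> = UNIV" and det: "determined_by n \<P> A"
    using cylinder_partition[OF A] by auto
  have sum: "measure \<rho> (\<Union>\<Q>) = (\<Sum>B\<in>\<Q>. measure \<rho> B)" if "\<rho> \<in> finite_measures" "\<Q> \<subseteq> \<P>" for \<rho> \<Q>
  proof -
    interpret finite_measure \<rho> using finite_measuresD(3)[OF that(1)] .
    have "measure \<rho> (\<Union>B\<in>\<Q>. B) = (\<Sum>B\<in>\<Q>. measure \<rho> B)"
      using \<P>(1-3) that(2) finite_measuresD(1)[OF that(1)] finite_subset[OF that(2)]
      by (intro finite_measure_finite_Union) (auto simp: disjoint_family_on_def disjoint_def)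
    then show ?thesis by simp
  qed
  define H where "H = {B\<in>\<P>. L * measure \<nu> B < measure \<mu> B}"
  define U where "U = \<Union>H"
  have "H \<subseteq> \<P>" by (auto simp: H_def)
  have Usets: "U \<in> sets borel"
    unfolding U_def using \<P>(1,2) \<open>H \<subseteq> \<P>\<close> by (intro sets.finite_Union) (auto intro: finite_subset)
  have "L * measure \<nu> U = (\<Sum>B\<in>H. L * measure \<nu> B)"
    using sum[OF \<nu> \<open>H \<subseteq> \<P>\<close>] by (simp add: U_def sum_distrib_left)
  also have "\<dots> \<le> (\<Sum>B\<in>H. measure \<mu> B)" by (intro sum_mono) (auto simp: H_def)
  also have "\<dots> = measure \<mu> U" using sum[OF \<mu> \<open>H \<subseteq> \<P>\<close>] by (simp add: U_def)
  finally have U\<eta>: "measure \<mu> U \<le> \<eta>" by (rule dom[OF Usets])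
  have inspace: "x i \<in> finite_measures" if "x \<in> space (samples n)" "i < n" for x i
    using that by (auto simp: space_samples intro!: counting_measuresD(1))
  define E1 where "E1 i = {x \<in> space (samples n). measure (x i) U \<noteq> 0}" for i
  define E2 :: "nat \<Rightarrow> (nat \<Rightarrow> 'a measure) set" where "E2 i = {x \<in> space (samples n). real k \<le> measure (x i) UNIV}" for i
  have E1s: "E1 i \<in> sets (samples n)" if "i < n" for i
    unfolding E1_def using measurable_sample_count[OF that Usets] by measurable
  have E2s: "E2 i \<in> sets (samples n)" if "i < n" for i
    unfolding E2_def using measurable_sample_count[OF that, of UNIV] by measurable
  define A' where "A' = {x \<in> A. \<forall>i<n. (\<forall>B\<in>H. measure (x i) B = 0) \<and> (\<Sum>B\<in>\<P>. measure (x i) B) \<le> real k}"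
  have Asp: "A \<subseteq> space (samples n)" using det by (simp add: determined_by_def)
  have As: "A \<in> sets (samples n)" using A cylinder_sets by blast
  have det': "determined_by n \<P> A'"
    unfolding determined_by_def
  proof (intro conjI ballI impI)
    show "A' \<subseteq> space (samples n)" using Asp by (auto simp: A'_def)
    fix x y assume xy: "x \<in> A'" "y \<in> space (samples n)" "\<forall>i<n. \<forall>B\<in>\<P>. measure (x i) B = measure (y i) B"
    then have "y \<in> A" using det unfolding determined_by_def A'_def by blast
    moreover have "measure (y i) B = 0" if "i < n" "B \<in> H" for i B
    proof -
      have "measure (x i) B = 0" using xy(1) that by (simp add: A'_def)
      moreover have "measure (x i) B = measure (y i) B" using xy(3) that \<open>H \<subseteq> \<P>\<close> by blast
      ultimately show ?thesis by simp
    qed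
    moreover have "(\<Sum>B\<in>\<P>. measure (y i) B) \<le> real k" if "i < n" for i
    proof -
      have "(\<Sum>B\<in>\<P>. measure (y i) B) = (\<Sum>B\<in>\<P>. measure (x i) B)"
        using xy(3) that by (intro sum.cong) auto
      then show ?thesis using xy(1) that by (simp add: A'_def)
    qed
    ultimately show "y \<in> A'" by (simp add: A'_def)
  qed
  have "A' \<in> cylinders n" using det' \<P>(1,2) by (auto simp: cylinders_def)
  then have A's: "A' \<in> sets (samples n)" using cylinder_sets by blast
  have cover: "A \<subseteq> A' \<union> ((\<Union>i<n. E1 i) \<union> (\<Union>i<n. E2 i))"
  proof
    fix x assume x: "x \<in> A"
    show "x \<in> A' \<union> ((\<Union>i<n. E1 i) \<union> (\<Union>i<n. E2 i))"
    proof (rule ccontr)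
      assume no: "\<not> ?thesis"
      have xsp: "x \<in> space (samples n)" using x Asp by blast
      have "measure (x i) B = 0" if "i < n" "B \<in> H" for i B
      proof -
        interpret finite_measure "x i" using finite_measuresD(3)[OF inspace[OF xsp \<open>i < n\<close>]] .
        have "measure (x i) U = 0" using no that xsp by (auto simp: E1_def)
        moreover have "measure (x i) B \<le> measure (x i) U"
          using Usets that finite_measuresD(1)[OF inspace[OF xsp \<open>i < n\<close>]] by (intro finite_measure_mono) (auto simp: U_def)
        ultimately show ?thesis by (simp add: measure_le_0_iff)
      qed
      moreover have "(\<Sum>B\<in>\<P>. measure (x i) B) \<le> real k" if "i < n" for i
      proof -
        have "\<not> real k \<le> measure (x i) UNIV" using no that xsp by (auto simp: E2_def)
        then show ?thesis using sum[OF inspace[OF xsp that], of \<P>] \<P>(4) by simp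
      qed
      ultimately show False using no x by (auto simp: A'_def)
    qed
  qed
  define CC where "CC = (L ^ k * exp (measure \<nu> UNIV)) ^ n"
  have "CC \<ge> 0" using L by (simp add: CC_def)
  have main: "measure (sample_law \<mu> n) A' \<le> CC * measure (sample_law \<nu> n) A'"
  proof -
    from cylinder_atoms[OF \<P>(1,2) det'] obtain S where S: "countable S" "A' = (\<Union>c\<in>S. count_atom n \<P> c)"
      "disjoint_family_on (count_atom n \<P>) S" "\<forall>c\<in>S. count_atom n \<P> c \<noteq> {}" by blast
    have em: "emeasure (sample_law \<rho> n) A' = (\<integral>\<^sup>+c. ennreal (atom_weight n \<P> \<rho> c) \<partial>count_space S)"
      if "\<rho> \<in> finite_measures" for \<rho>
      unfolding S(2)
      by (subst emeasure_UN_countable[OF _ S(1,3)]) (simp_all add: count_atom_sets \<P> sample_law_atom[OF that])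
    have "(atom_weight n \<P> \<mu> c)
        \<le> CC * (atom_weight n \<P> \<nu> c)" if c: "c \<in> S" for c
    proof -
      obtain x where x: "x \<in> count_atom n \<P> c" "x \<in> A'" using S c by blast
      have row: "(\<Prod>B\<in>\<P>. poisson_weight (measure \<mu> B) (c (i, B)))
          \<le> (L ^ k * exp (measure \<nu> UNIV)) * (\<Prod>B\<in>\<P>. poisson_weight (measure \<nu> B) (c (i, B)))" if "i < n" for i
      proof -
        have xc: "measure (x i) B = real (c (i, B))" if "B \<in> \<P>" for B
          using x(1) \<open>i < n\<close> that by (auto simp: count_atom_def)
        have "(\<Sum>B\<in>\<P>. measure (x i) B) \<le> real k" using x(2) \<open>i < n\<close> by (simp add: A'_def)
        then have "real (\<Sum>B\<in>\<P>. c (i, B)) \<le> real k" using xc by simp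
        then have ck: "(\<Sum>B\<in>\<P>. c (i, B)) \<le> k" by linarith
        have "(\<Prod>B\<in>\<P>. poisson_weight (measure \<mu> B) (c (i, B)))
            \<le> (\<Prod>B\<in>\<P>. L ^ c (i, B) * exp (measure \<nu> B) * poisson_weight (measure \<nu> B) (c (i, B)))"
        proof (intro prod_mono conjI poisson_weight_dominated L measure_nonneg poisson_weight_nonneg)
          fix B assume B: "B \<in> \<P>"
          show "measure \<mu> B \<le> L * measure \<nu> B \<or> c (i, B) = 0"
          proof (cases "B \<in> H")
            case True
            then have "measure (x i) B = 0" using x(2) \<open>i < n\<close> by (auto simp: A'_def)
            then show ?thesis using xc[OF B] by simp
          next
            case False
            then show ?thesis using B by (auto simp: H_def)
          qed
        qed
        also have "\<dots> = L ^ (\<Sum>B\<in>\<P>. c (i, B)) * exp (\<Sum>B\<in>\<P>. measure \<nu> B) * (\<Prod>B\<in>\<P>. poisson_weight (measure \<nu> B) (c (i, B)))"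
          by (simp add: prod.distrib power_sum exp_sum \<P>(1))
        also have "(\<Sum>B\<in>\<P>. measure \<nu> B) = measure \<nu> UNIV" using sum[OF \<nu>, of \<P>] \<P>(4) by simp
        also have "L ^ (\<Sum>B\<in>\<P>. c (i, B)) * exp (measure \<nu> UNIV) * (\<Prod>B\<in>\<P>. poisson_weight (measure \<nu> B) (c (i, B)))
            \<le> L ^ k * exp (measure \<nu> UNIV) * (\<Prod>B\<in>\<P>. poisson_weight (measure \<nu> B) (c (i, B)))"
          using L ck by (intro mult_right_mono power_increasing prod_nonneg poisson_weight_nonneg) auto
        finally show ?thesis .
      qed
      have "(atom_weight n \<P> \<mu> c)
        \<le> (\<Prod>i<n. (L ^ k * exp (measure \<nu> UNIV)) * (\<Prod>B\<in>\<P>. poisson_weight (measure \<nu> B) (c (i, B))))"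
        by (intro prod_mono conjI row prod_nonneg poisson_weight_nonneg) auto
      also have "\<dots> = CC * (atom_weight n \<P> \<nu> c)"
        by (simp add: prod.distrib CC_def power_mult_distrib)
      finally show ?thesis .
    qed
    then have "emeasure (sample_law \<mu> n) A' \<le> (\<integral>\<^sup>+c. ennreal CC * ennreal (atom_weight n \<P> \<nu> c) \<partial>count_space S)"
      unfolding em[OF \<mu>] using \<open>CC \<ge> 0\<close> by (intro nn_integral_mono) (simp add: ennreal_mult'[symmetric] ennreal_leI)
    also have "\<dots> = ennreal CC * emeasure (sample_law \<nu> n) A'"
      unfolding em[OF \<nu>] by (rule nn_integral_cmult) simp
    also have "\<dots> = ennreal (CC * measure (sample_law \<nu> n) A')"
      using \<open>CC \<ge> 0\<close> by (simp add: Q\<nu>.emeasure_eq_measure ennreal_mult)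
    finally show ?thesis using \<open>CC \<ge> 0\<close> by (simp add: Q\<mu>.emeasure_eq_measure)
  qed
  have "measure (sample_law \<mu> n) A \<le> measure (sample_law \<mu> n) (A' \<union> ((\<Union>i<n. E1 i) \<union> (\<Union>i<n. E2 i)))"
    using cover A's E1s E2s by (intro Q\<mu>.finite_measure_mono) auto
  also have "\<dots> \<le> measure (sample_law \<mu> n) A' + (measure (sample_law \<mu> n) (\<Union>i<n. E1 i) + measure (sample_law \<mu> n) (\<Union>i<n. E2 i))"
    using A's E1s E2s by (intro order_trans[OF measure_Un_le] add_left_mono measure_Un_le) auto
  also have "measure (sample_law \<mu> n) (\<Union>i<n. E1 i) \<le> (\<Sum>i<n. measure (sample_law \<mu> n) (E1 i))"
    using E1s by (intro Q\<mu>.finite_measure_subadditive_finite) auto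
  also have "\<dots> \<le> (\<Sum>i<n. \<eta>)"
    using prob_point_in_set[OF \<mu> Usets] U\<eta> unfolding E1_def by (intro sum_mono) (meson lessThan_iff order_trans)
  also have "measure (sample_law \<mu> n) (\<Union>i<n. E2 i) \<le> (\<Sum>i<n. measure (sample_law \<mu> n) (E2 i))"
    using E2s by (intro Q\<mu>.finite_measure_subadditive_finite) auto
  also have "\<dots> \<le> (\<Sum>i<n. exp (measure \<mu> UNIV * (exp 1 - 1) - real k))"
    using prob_many_points[OF \<mu>] unfolding E2_def by (intro sum_mono) auto
  also have "measure (sample_law \<mu> n) A' \<le> CC * measure (sample_law \<nu> n) A"
    using main \<open>CC \<ge> 0\<close> As by (elim order_trans) (intro mult_left_mono Q\<nu>.finite_measure_mono, auto simp: A'_def)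
  finally show ?thesis by (simp add: CC_def)
qed

text \<open>
  Up to \<open>\<epsilon>\<close>, the laws of the samples with means in \<open>M\<close> are dominated by a single law. The measure \<open>\<nu>\<close>
  is the sum of the finitely many measures that dominate \<open>M\<close> up to \<open>\<eta>\<close>.
\<close>

lemma tau_compact_law_dominated:
  fixes M :: "'a measure set"
  assumes M: "compactin tau_topology M" and "\<epsilon> > 0"
  shows "\<exists>\<nu>\<in>finite_measures. \<exists>CC>0. \<forall>\<mu>\<in>M. \<forall>A\<in>sets (samples n).
    measure (sample_law \<mu> n) A \<le> \<epsilon> + CC * measure (sample_law \<nu> n) A"
proof -
  have Mfm: "\<mu> \<in> finite_measures" if "\<mu> \<in> M" for \<mu> using that compactin_subset_topspace[OF M] by auto
  define \<eta> where "\<eta> = \<epsilon> / (2 * (real n + 1))"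
  have "\<eta> > 0" "real n * \<eta> \<le> \<epsilon> / 2" using \<open>\<epsilon> > 0\<close> by (auto simp: \<eta>_def field_simps)
  obtain F \<delta> where F: "finite F" "F \<subseteq> M" "\<delta> > 0"
    "\<And>A \<mu>. A \<in> sets borel \<Longrightarrow> (\<And>\<nu>. \<nu> \<in> F \<Longrightarrow> measure \<nu> A < \<delta>) \<Longrightarrow> \<mu> \<in> M \<Longrightarrow> measure \<mu> A < \<eta>"
    using tau_compact_uniformly_dominated[OF M \<open>\<eta> > 0\<close>] by (elim exE conjE) (rule that, auto)
  obtain \<nu> where \<nu>: "\<nu> \<in> finite_measures" "\<And>A. A \<in> sets borel \<Longrightarrow> measure \<nu> A = (\<Sum>\<mu>\<in>F. measure \<mu> A)"
    using finite_sum_measure[OF F(1)] F(2) Mfm by blast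
  have "compactin euclideanreal ((\<lambda>\<mu>. measure \<mu> UNIV) ` M)"
    by (rule image_compactin[OF M tau_measure_continuous]) simp
  then have "bounded ((\<lambda>\<mu>. measure \<mu> UNIV) ` M)" using compact_imp_bounded by (simp add: compactin_euclidean_iff)
  then obtain R where R: "R > 0" "\<And>\<mu>. \<mu> \<in> M \<Longrightarrow> measure \<mu> UNIV \<le> R"
    unfolding bounded_pos by (auto simp: abs_le_iff)
  \<comment> \<open>If \<open>\<mu>\<close> has mass at most \<open>R\<close> and dominates \<open>L * \<nu>\<close> on \<open>U\<close>, then \<open>\<nu>\<close> has mass below \<open>\<delta>\<close> on \<open>U\<close>.\<close>
  define L where "L = max 1 (R / \<delta> + 1)"
  have "L \<ge> 1" by (simp add: L_def)
  have "R / \<delta> < L" by (simp add: L_def max_def)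
  then have L: "R < L * \<delta>" using \<open>\<delta> > 0\<close> by (simp add: pos_divide_less_eq)
  have dom: "measure \<mu> U \<le> \<eta>" if "\<mu> \<in> M" "U \<in> sets borel" "L * measure \<nu> U \<le> measure \<mu> U" for \<mu> U
  proof -
    interpret finite_measure \<mu> using finite_measuresD(3)[OF Mfm[OF that(1)]] .
    have "measure \<mu> U \<le> R"
      using R(2)[OF that(1)] bounded_measure[of U] finite_measuresD(2)[OF Mfm[OF that(1)]] by simp
    then have "L * measure \<nu> U < L * \<delta>" using that(3) L by linarith
    then have "measure \<nu> U < \<delta>" using \<open>L \<ge> 1\<close> by simp
    have "measure \<rho> U < \<delta>" if "\<rho> \<in> F" for \<rho>
    proof -
      have "measure \<rho> U \<le> (\<Sum>\<mu>\<in>F. measure \<mu> U)" using that F(1) by (intro member_le_sum) auto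
      then show ?thesis using \<nu>(2)[OF \<open>U \<in> sets borel\<close>] \<open>measure \<nu> U < \<delta>\<close> by simp
    qed
    then show ?thesis using F(4)[OF that(2) _ that(1)] by (simp add: less_imp_le)
  qed
  \<comment> \<open>At least \<open>k\<close> points in one observation then have probability at most \<open>\<eta>\<close>.\<close>
  obtain k :: nat where k: "real k \<ge> R * (exp 1 - 1) - ln \<eta>" using real_arch_simple by blast
  define CC where "CC = (L ^ k * exp (measure \<nu> UNIV)) ^ n"
  have "CC > 0" using \<open>L \<ge> 1\<close> by (simp add: CC_def)
  have cyl: "measure (sample_law \<mu> n) A \<le> \<epsilon> + CC * measure (sample_law \<nu> n) A" if \<mu>: "\<mu> \<in> M" and A: "A \<in> cylinders n" for \<mu> A
  proof -
    have "measure \<mu> UNIV * (exp 1 - 1) \<le> R * (exp 1 - 1)" using R(2)[OF \<mu>] by (intro mult_right_mono) auto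
    with k have "exp (measure \<mu> UNIV * (exp 1 - 1) - real k) \<le> exp (ln \<eta>)" by (simp only: exp_le_cancel_iff)
    then have "exp (measure \<mu> UNIV * (exp 1 - 1) - real k) \<le> \<eta>" using \<open>\<eta> > 0\<close> by simp
    then have "real n * exp (measure \<mu> UNIV * (exp 1 - 1) - real k) \<le> real n * \<eta>" by (intro mult_left_mono) auto
    then show ?thesis
      using cylinder_law_dominated[OF Mfm[OF \<mu>] \<nu>(1) \<open>L \<ge> 1\<close> dom[OF \<mu>] A, of k] \<open>real n * \<eta> \<le> \<epsilon> / 2\<close>
      unfolding CC_def by linarith
  qed
  have "measure (sample_law \<mu> n) A \<le> \<epsilon> + CC * measure (sample_law \<nu> n) A" if \<mu>: "\<mu> \<in> M" and A: "A \<in> sets (samples n)" for \<mu> A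
  proof (rule field_le_epsilon)
    fix e :: real assume "e > 0"
    interpret Q\<mu>: prob_space "sample_law \<mu> n" by (rule prob_space_sample_law[OF Mfm[OF \<mu>]])
    interpret Q\<nu>: prob_space "sample_law \<nu> n" by (rule prob_space_sample_law[OF \<nu>(1)])
    define d where "d = e / (1 + CC)"
    have "d * (1 + CC) = e" using \<open>CC > 0\<close> by (simp add: d_def)
    then have d: "d > 0" "d + CC * d = e" using \<open>e > 0\<close> \<open>CC > 0\<close> by (simp add: d_def, simp add: algebra_simps)
    have "\<exists>A'\<in>cylinders n. measure (sample_law \<mu> n) (sym_diff A A') < d \<and> measure (sample_law \<nu> n) (sym_diff A A') < d"
    proof (rule algebra_approximation[where \<Omega> = "space (samples n)"])
      show "sets (sample_law \<mu> n) = sigma_sets (space (samples n)) (cylinders n)"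
        "sets (sample_law \<nu> n) = sigma_sets (space (samples n)) (cylinders n)"
        by (simp_all add: sets_samples)
      show "A \<in> sigma_sets (space (samples n)) (cylinders n)" using A by (simp add: sets_samples)
      show "cylinders n \<subseteq> Pow (space (samples n))" by (auto simp: cylinders_def determined_by_def)
    qed (use d Q\<mu>.finite_measure_axioms Q\<nu>.finite_measure_axioms in \<open>auto intro: cylinder_space cylinder_Diff cylinder_Un\<close>)
    then obtain A' where A': "A' \<in> cylinders n" "measure (sample_law \<mu> n) (sym_diff A A') < d"
      "measure (sample_law \<nu> n) (sym_diff A A') < d" by blast
    have "A' \<in> sets (samples n)" using A'(1) cylinder_sets by blast
    then have close: "\<bar>measure (sample_law \<mu> n) A - measure (sample_law \<mu> n) A'\<bar> < d"
      "\<bar>measure (sample_law \<nu> n) A - measure (sample_law \<nu> n) A'\<bar> < d"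
      using A A'(2,3) measure_sym_diff_close[OF Q\<mu>.finite_measure_axioms, of A A'] measure_sym_diff_close[OF Q\<nu>.finite_measure_axioms, of A A']
      by auto
    then have "CC * measure (sample_law \<nu> n) A' \<le> CC * (measure (sample_law \<nu> n) A + d)"
      using \<open>CC > 0\<close> by (intro mult_left_mono) auto
    then show "measure (sample_law \<mu> n) A \<le> \<epsilon> + CC * measure (sample_law \<nu> n) A + e"
      using cyl[OF \<mu> A'(1)] close(1) d(2) by (simp add: distrib_left)
  qed
  with \<nu>(1) \<open>CC > 0\<close> show ?thesis by blast
qed

text \<open>
  Finitely many atoms exhaust the event up to \<open>\<epsilon> / 2\<close>, and their total weight is a continuous
  function of the measures of the sets of the partition.
\<close>

lemma cylinder_lower_semicontinuous:
  assumes \<mu>: "\<mu> \<in> finite_measures" and A: "A \<in> cylinders n" and "\<epsilon> > 0"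
  shows "\<exists>W. openin tau_topology W \<and> \<mu> \<in> W \<and> (\<forall>\<nu>\<in>W. measure (sample_law \<nu> n) A > measure (sample_law \<mu> n) A - \<epsilon>)"
proof -
  obtain \<P> where \<P>: "finite \<P>" "\<P> \<subseteq> sets borel" "disjoint \<P>" and det: "determined_by n \<P> A"
    using cylinder_partition[OF A] by auto
  from cylinder_atoms[OF \<P>(1,2) det] obtain S where S: "countable S" "A = (\<Union>c\<in>S. count_atom n \<P> c)"
    "disjoint_family_on (count_atom n \<P>) S" by blast
  have atoms: "count_atom n \<P> c \<in> sets (samples n)" for c by (rule count_atom_sets[OF \<P>(1,2)])
  define w where "w \<nu> c = (atom_weight n \<P> \<nu> c)" for \<nu> c
  have finite_union: "measure (sample_law \<nu> n) (\<Union>c\<in>F. count_atom n \<P> c) = (\<Sum>c\<in>F. w \<nu> c)"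
    if \<nu>: "\<nu> \<in> finite_measures" and F: "finite F" "F \<subseteq> S" for \<nu> F
  proof -
    interpret prob_space "sample_law \<nu> n" by (rule prob_space_sample_law[OF \<nu>])
    have atom: "measure (sample_law \<nu> n) (count_atom n \<P> c) = w \<nu> c" for c
      using sample_law_atom[OF \<nu> \<P>, of n c] by (simp add: measure_def w_def prod_nonneg poisson_weight_nonneg)
    have "measure (sample_law \<nu> n) (\<Union>c\<in>F. count_atom n \<P> c) = (\<Sum>c\<in>F. measure (sample_law \<nu> n) (count_atom n \<P> c))"
      using F S(3) atoms by (intro finite_measure_finite_Union) (auto simp: disjoint_family_on_def)
    then show ?thesis by (simp add: atom)
  qed
  interpret Q: prob_space "sample_law \<mu> n" by (rule prob_space_sample_law[OF \<mu>])
  have "\<exists>F. finite F \<and> F \<subseteq> S \<and> (\<Sum>c\<in>F. w \<mu> c) > measure (sample_law \<mu> n) A - \<epsilon> / 2"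
  proof (cases "S = {}")
    case True
    then show ?thesis using S(2) \<open>\<epsilon> > 0\<close> by (intro exI[of _ "{}"]) auto
  next
    case False
    define F where "F N = from_nat_into S ` {..<N}" for N
    have F: "finite (F N)" "F N \<subseteq> S" for N using from_nat_into[OF False] by (auto simp: F_def)
    have "(\<Union>N. \<Union>c\<in>F N. count_atom n \<P> c) = A"
    proof -
      have "(\<Union>N. F N) = S"
        using F(2) from_nat_into_surj[OF S(1)] by (fastforce simp: F_def)
      then show ?thesis unfolding S(2) by blast
    qed
    moreover have "(\<lambda>N. measure (sample_law \<mu> n) (\<Union>c\<in>F N. count_atom n \<P> c)) \<longlonglongrightarrow> measure (sample_law \<mu> n) (\<Union>N. \<Union>c\<in>F N. count_atom n \<P> c)"
    proof (intro Q.finite_Lim_measure_incseq incseq_SucI)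
      have "F N \<subseteq> F (Suc N)" for N by (auto simp: F_def)
      then show "(\<Union>c\<in>F N. count_atom n \<P> c) \<subseteq> (\<Union>c\<in>F (Suc N). count_atom n \<P> c)" for N by blast
    qed (use atoms F(1) in auto)
    ultimately have "(\<lambda>N. \<Sum>c\<in>F N. w \<mu> c) \<longlonglongrightarrow> measure (sample_law \<mu> n) A"
      by (simp add: finite_union[OF \<mu> F])
    from order_tendstoD(1)[OF this, of "measure (sample_law \<mu> n) A - \<epsilon> / 2"] \<open>\<epsilon> > 0\<close>
    obtain N where "measure (sample_law \<mu> n) A - \<epsilon> / 2 < (\<Sum>c\<in>F N. w \<mu> c)" by (auto simp: eventually_sequentially)
    then show ?thesis using F by blast
  qed
  then obtain F where F: "finite F" "F \<subseteq> S" "(\<Sum>c\<in>F. w \<mu> c) > measure (sample_law \<mu> n) A - \<epsilon> / 2" by blast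
  have wcont: "continuous_map tau_topology euclideanreal (\<lambda>\<nu>. \<Sum>c\<in>F. w \<nu> c)"
  proof -
    have "continuous_map tau_topology euclideanreal (\<lambda>\<nu>. poisson_weight (measure \<nu> B) k)" if "B \<in> \<P>" for B k
    proof -
      have "continuous_map euclideanreal euclideanreal (\<lambda>m. poisson_weight m k)"
        by (simp add: poisson_weight_def continuous_intros)
      from continuous_map_compose[OF tau_measure_continuous this, of B] that \<P>(2)
      show ?thesis by (auto simp: o_def)
    qed
    then show ?thesis
      unfolding w_def using F(1) \<P>(1) by (intro continuous_map_sum continuous_map_prod) auto
  qed
  define W where "W = {\<nu> \<in> topspace tau_topology. \<bar>(\<Sum>c\<in>F. w \<nu> c) - (\<Sum>c\<in>F. w \<mu> c)\<bar> < \<epsilon> / 2}"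
  have "openin tau_topology W" unfolding W_def by (rule openin_close_value[OF wcont])
  moreover have "\<mu> \<in> W" using \<mu> \<open>\<epsilon> > 0\<close> by (simp add: W_def)
  moreover have "measure (sample_law \<nu> n) A > measure (sample_law \<mu> n) A - \<epsilon>" if "\<nu> \<in> W" for \<nu>
  proof -
    have \<nu>: "\<nu> \<in> finite_measures" and close: "\<bar>(\<Sum>c\<in>F. w \<nu> c) - (\<Sum>c\<in>F. w \<mu> c)\<bar> < \<epsilon> / 2"
      using that by (auto simp: W_def)
    interpret prob_space "sample_law \<nu> n" by (rule prob_space_sample_law[OF \<nu>])
    have "(\<Sum>c\<in>F. w \<nu> c) \<le> measure (sample_law \<nu> n) A"
      unfolding finite_union[OF \<nu> F(1,2), symmetric] using A cylinder_sets F(2)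
      by (intro finite_measure_mono) (auto simp: S(2))
    with close F(3) show ?thesis by linarith
  qed
  ultimately show ?thesis by blast
qed

text \<open>
  A cylinder event that is close under the dominating law is uniformly close
  under all laws with means in \<open>M\<close>.
\<close>

lemma event_lower_semicontinuous:
  assumes M: "compactin tau_topology M" and \<mu>: "\<mu> \<in> M" and A: "A \<in> sets (samples n)" and "\<epsilon> > 0"
  shows "\<exists>W. openin tau_topology W \<and> \<mu> \<in> W \<and> (\<forall>\<rho>\<in>W \<inter> M. measure (sample_law \<rho> n) A > measure (sample_law \<mu> n) A - \<epsilon>)"
proof -
  have Mfm: "\<mu> \<in> finite_measures" if "\<mu> \<in> M" for \<mu> using that compactin_subset_topspace[OF M] by auto
  obtain \<nu> CC where \<nu>: "\<nu> \<in> finite_measures" "CC > 0"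
    "\<And>\<mu> A. \<mu> \<in> M \<Longrightarrow> A \<in> sets (samples n) \<Longrightarrow> measure (sample_law \<mu> n) A \<le> \<epsilon> / 6 + CC * measure (sample_law \<nu> n) A"
    using tau_compact_law_dominated[OF M, of "\<epsilon> / 6" n] \<open>\<epsilon> > 0\<close> by auto
  interpret Q\<nu>: prob_space "sample_law \<nu> n" by (rule prob_space_sample_law[OF \<nu>(1)])
  have "\<exists>A'\<in>cylinders n. measure (sample_law \<nu> n) (sym_diff A A') < \<epsilon> / (6 * CC) \<and> measure (sample_law \<nu> n) (sym_diff A A') < \<epsilon> / (6 * CC)"
  proof (rule algebra_approximation[where \<Omega> = "space (samples n)"])
    show "sets (sample_law \<nu> n) = sigma_sets (space (samples n)) (cylinders n)"
      "sets (sample_law \<nu> n) = sigma_sets (space (samples n)) (cylinders n)"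
      by (simp_all add: sets_samples)
    show "A \<in> sigma_sets (space (samples n)) (cylinders n)" using A by (simp add: sets_samples)
    show "cylinders n \<subseteq> Pow (space (samples n))" by (auto simp: cylinders_def determined_by_def)
  qed (use \<open>\<epsilon> > 0\<close> \<nu>(2) Q\<nu>.finite_measure_axioms in \<open>auto intro: cylinder_space cylinder_Diff cylinder_Un\<close>)
  then obtain A' where A': "A' \<in> cylinders n" "measure (sample_law \<nu> n) (sym_diff A A') < \<epsilon> / (6 * CC)" by blast
  have A's: "A' \<in> sets (samples n)" using A'(1) cylinder_sets by blast
  have close: "\<bar>measure (sample_law \<rho> n) A - measure (sample_law \<rho> n) A'\<bar> < \<epsilon> / 3" if "\<rho> \<in> M" for \<rho>
  proof -
    interpret prob_space "sample_law \<rho> n" by (rule prob_space_sample_law[OF Mfm[OF that]])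
    have "\<bar>measure (sample_law \<rho> n) A - measure (sample_law \<rho> n) A'\<bar> \<le> measure (sample_law \<rho> n) (sym_diff A A')"
      using A A's by (intro measure_sym_diff_close finite_measure_axioms) auto
    also have "\<dots> \<le> \<epsilon> / 6 + CC * measure (sample_law \<nu> n) (sym_diff A A')"
      using A A's by (intro \<nu>(3) that) auto
    also have "CC * measure (sample_law \<nu> n) (sym_diff A A') < \<epsilon> / 6"
      using A'(2) \<nu>(2) by (simp add: pos_less_divide_eq mult_ac)
    finally show ?thesis by simp
  qed
  obtain W where W: "openin tau_topology W" "\<mu> \<in> W"
    "\<forall>\<rho>\<in>W. measure (sample_law \<rho> n) A' > measure (sample_law \<mu> n) A' - \<epsilon> / 3"
    using cylinder_lower_semicontinuous[OF Mfm[OF \<mu>] A'(1), of "\<epsilon> / 3"] \<open>\<epsilon> > 0\<close> by auto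
  have "measure (sample_law \<rho> n) A > measure (sample_law \<mu> n) A - \<epsilon>" if "\<rho> \<in> W \<inter> M" for \<rho>
  proof -
    have "measure (sample_law \<rho> n) A' > measure (sample_law \<mu> n) A' - \<epsilon> / 3" "\<rho> \<in> M"
      using W(3) that by blast+
    with close[of \<rho>] close[OF \<mu>] show ?thesis by linarith
  qed
  with W(1,2) show ?thesis by blast
qed

lemma test_lower_semicontinuous:
  fixes K :: "(nat \<Rightarrow> 'a measure) \<Rightarrow> real"
  assumes M: "compactin tau_topology M" and \<mu>: "\<mu> \<in> M"
    and K: "K \<in> borel_measurable (samples n)" "\<And>x. x \<in> space (samples n) \<Longrightarrow> 0 \<le> K x \<and> K x \<le> 1" and "\<epsilon> > 0"
  shows "\<exists>W. openin tau_topology W \<and> \<mu> \<in> W \<and>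
    (\<forall>\<rho>\<in>W \<inter> M. (\<integral>x. K x \<partial>sample_law \<rho> n) > (\<integral>x. K x \<partial>sample_law \<mu> n) - \<epsilon>)"
proof -
  have Mfm: "\<mu> \<in> finite_measures" if "\<mu> \<in> M" for \<mu> using that compactin_subset_topspace[OF M] by auto
  obtain p :: nat where p: "p > 4 / \<epsilon>" using reals_Archimedean2 by blast
  then have "p > 0" using \<open>\<epsilon> > 0\<close> by (metis divide_pos_pos gr0I less_asym of_nat_0 zero_less_numeral)
  have p4: "1 / real p < \<epsilon> / 4" using p \<open>p > 0\<close> \<open>\<epsilon> > 0\<close> by (simp add: field_simps)
  define A where "A j = {x \<in> space (samples n). real j / p < K x}" for j
  have A: "A j \<in> sets (samples n)" for j unfolding A_def using K(1) by measurable
  have stair: "\<bar>(\<integral>x. K x \<partial>sample_law \<rho> n) - (\<Sum>j<p. measure (sample_law \<rho> n) (A j)) / p\<bar> \<le> 1 / p" if "\<rho> \<in> M" for \<rho>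
  proof -
    interpret prob_space "sample_law \<rho> n" by (rule prob_space_sample_law[OF Mfm[OF that]])
    have "K \<in> borel_measurable (sample_law \<rho> n)"
      using K(1) measurable_cong_sets[OF sets_sample_law refl] by blast
    from integral_staircase[OF finite_measure_axioms this \<open>p > 0\<close>, of "\<lambda>j. real j / p"] K(2) \<open>p > 0\<close>
    show ?thesis using prob_space by (simp add: A_def divide_strict_right_mono)
  qed
  have "\<forall>j. \<exists>W. openin tau_topology W \<and> \<mu> \<in> W \<and> (\<forall>\<rho>\<in>W \<inter> M. measure (sample_law \<rho> n) (A j) > measure (sample_law \<mu> n) (A j) - \<epsilon> / 2)"
    using event_lower_semicontinuous[OF M \<mu> A, of "\<epsilon> / 2"] \<open>\<epsilon> > 0\<close> by simp
  then obtain W where W: "\<And>j. openin tau_topology (W j)" "\<And>j. \<mu> \<in> W j"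
    "\<And>j \<rho>. \<rho> \<in> W j \<inter> M \<Longrightarrow> measure (sample_law \<rho> n) (A j) > measure (sample_law \<mu> n) (A j) - \<epsilon> / 2"
    by metis
  have "openin tau_topology (\<Inter>j<p. W j)"
    using W(1) \<open>p > 0\<close> by (intro openin_Inter) (auto simp: lessThan_empty_iff)
  moreover have "\<mu> \<in> (\<Inter>j<p. W j)" using W(2) by blast
  moreover have "(\<integral>x. K x \<partial>sample_law \<rho> n) > (\<integral>x. K x \<partial>sample_law \<mu> n) - \<epsilon>" if \<rho>: "\<rho> \<in> (\<Inter>j<p. W j) \<inter> M" for \<rho>
  proof -
    have "(\<Sum>j<p. measure (sample_law \<mu> n) (A j) - \<epsilon> / 2) \<le> (\<Sum>j<p. measure (sample_law \<rho> n) (A j))"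
      using \<rho> W(3) by (intro sum_mono less_imp_le) blast
    then have "((\<Sum>j<p. measure (sample_law \<mu> n) (A j)) - p * (\<epsilon> / 2)) / p \<le> (\<Sum>j<p. measure (sample_law \<rho> n) (A j)) / p"
      by (intro divide_right_mono) (simp_all add: sum_subtractf)
    then have "(\<Sum>j<p. measure (sample_law \<mu> n) (A j)) / p - \<epsilon> / 2 \<le> (\<Sum>j<p. measure (sample_law \<rho> n) (A j)) / p"
      using \<open>p > 0\<close> by (simp add: diff_divide_distrib)
    then show ?thesis using stair[of \<rho>] stair[OF \<mu>] p4 \<rho> by auto
  qed
  ultimately show ?thesis by blast
qed

text \<open>
  A limit point of \<open>\<Theta>\<close> cannot have a larger error than the supremum over \<open>\<Theta>\<close>. Applied to \<open>K\<close> and to \<open>1 - K\<close>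
  at a common limit point, this gives two errors whose sum is at least \<open>1\<close>.
\<close>

lemma tau_limit_lower_bound:
  assumes comp: "relatively_compact_in tau_topology \<Theta>" and sub: "\<Theta> \<subseteq> finite_measures"
    and \<mu>: "\<mu> \<in> tau_topology closure_of \<Theta>"
    and K: "K \<in> borel_measurable (samples n)" "\<And>x. x \<in> space (samples n) \<Longrightarrow> 0 \<le> K x \<and> K x \<le> (1::real)"
  shows "ennreal (\<integral>x. K x \<partial>sample_law \<mu> n) \<le> (SUP \<rho>\<in>\<Theta>. \<integral>\<^sup>+s. ennreal (K (sample \<kappa> n s)) \<partial>Pr \<rho>)"
proof (rule ennreal_le_epsilon)
  fix e :: real assume "e > 0"
  let ?M = "tau_topology closure_of \<Theta>"
  have M: "compactin tau_topology ?M" using comp by (simp add: relatively_compact_in_def)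
  from test_lower_semicontinuous[OF M \<mu> K \<open>e > 0\<close>]
  obtain W where W: "openin tau_topology W" "\<mu> \<in> W"
    "\<forall>\<rho>\<in>W \<inter> ?M. (\<integral>x. K x \<partial>sample_law \<rho> n) > (\<integral>x. K x \<partial>sample_law \<mu> n) - e" by blast
  then obtain \<rho> where \<rho>: "\<rho> \<in> \<Theta>" "\<rho> \<in> W" using \<mu> unfolding in_closure_of by blast
  then have fm: "\<rho> \<in> finite_measures" using sub by blast
  interpret prob_space "sample_law \<rho> n" by (rule prob_space_sample_law[OF fm])
  have "\<rho> \<in> ?M" using \<rho>(1) closure_of_subset[of \<Theta> tau_topology] sub by auto
  with W(3) \<rho>(2) have gt: "(\<integral>x. K x \<partial>sample_law \<rho> n) > (\<integral>x. K x \<partial>sample_law \<mu> n) - e" by blast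
  have Km: "K \<in> borel_measurable (sample_law \<rho> n)"
    using K(1) measurable_cong_sets[OF sets_sample_law refl] by blast
  have int: "integrable (sample_law \<rho> n) K"
    using K(2) Km by (intro integrable_const_bound[of _ 1]) auto
  have "(\<integral>\<^sup>+s. ennreal (K (sample \<kappa> n s)) \<partial>Pr \<rho>) = (\<integral>\<^sup>+x. ennreal (K x) \<partial>sample_law \<rho> n)"
    using K(1) by (intro nn_integral_sample[OF fm, of "\<lambda>x. ennreal (K x)"]) measurable
  also have "\<dots> = ennreal (\<integral>x. K x \<partial>sample_law \<rho> n)"
    using K(2) by (intro nn_integral_eq_integral int) auto
  finally have eq: "(\<integral>\<^sup>+s. ennreal (K (sample \<kappa> n s)) \<partial>Pr \<rho>) = ennreal (\<integral>x. K x \<partial>sample_law \<rho> n)" .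
  have nonneg: "0 \<le> (\<integral>x. K x \<partial>sample_law \<rho> n)" using K(2) by (intro integral_nonneg_AE) auto
  have "ennreal (\<integral>x. K x \<partial>sample_law \<mu> n) \<le> ennreal ((\<integral>x. K x \<partial>sample_law \<rho> n) + e)"
    using gt by (intro ennreal_leI) linarith
  also have "\<dots> = (\<integral>\<^sup>+s. ennreal (K (sample \<kappa> n s)) \<partial>Pr \<rho>) + ennreal e"
    using nonneg \<open>e > 0\<close> by (simp add: eq)
  also have "\<dots> \<le> (SUP \<rho>\<in>\<Theta>. \<integral>\<^sup>+s. ennreal (K (sample \<kappa> n s)) \<partial>Pr \<rho>) + ennreal e"
    using \<rho>(1) by (intro add_right_mono SUP_upper)
  finally show "ennreal (\<integral>x. K x \<partial>sample_law \<mu> n) \<le> (SUP \<rho>\<in>\<Theta>. \<integral>\<^sup>+s. ennreal (K (sample \<kappa> n s)) \<partial>Pr \<rho>) + ennreal e" .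
qed

lemma common_tau_limit_indistinguishable:
  assumes sub: "\<Theta>0 \<subseteq> finite_measures" "\<Theta>1 \<subseteq> finite_measures"
    and comp: "relatively_compact_in tau_topology \<Theta>0" "relatively_compact_in tau_topology \<Theta>1"
    and \<mu>: "\<mu> \<in> tau_topology closure_of \<Theta>0" "\<mu> \<in> tau_topology closure_of \<Theta>1"
  shows "indistinguishable Pr \<kappa> \<Theta>0 \<Theta>1"
  unfolding indistinguishable_def
proof (intro allI impI)
  fix n and K :: "(nat \<Rightarrow> 'a measure) \<Rightarrow> real" assume "is_test n K"
  then have K: "K \<in> borel_measurable (samples n)" "\<And>x. x \<in> space (samples n) \<Longrightarrow> 0 \<le> K x \<and> K x \<le> 1"
    by (auto simp: is_test_def)
  then have K': "(\<lambda>x. 1 - K x) \<in> borel_measurable (samples n)"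
    "\<And>x. x \<in> space (samples n) \<Longrightarrow> 0 \<le> 1 - K x \<and> 1 - K x \<le> 1" by auto
  have fm: "\<mu> \<in> finite_measures" using \<mu>(1) by (auto simp: in_closure_of)
  interpret prob_space "sample_law \<mu> n" by (rule prob_space_sample_law[OF fm])
  have Km: "K \<in> borel_measurable (sample_law \<mu> n)"
    using K(1) measurable_cong_sets[OF sets_sample_law refl] by blast
  have int: "integrable (sample_law \<mu> n) K"
    using K(2) Km by (intro integrable_const_bound[of _ 1]) auto
  have "ennreal (\<integral>x. K x \<partial>sample_law \<mu> n) + ennreal (\<integral>x. 1 - K x \<partial>sample_law \<mu> n)
      \<le> test_alpha Pr \<kappa> \<Theta>0 n K + test_beta Pr \<kappa> \<Theta>1 n K"
    unfolding test_alpha_def test_beta_def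
    by (intro add_mono tau_limit_lower_bound[OF comp(1) sub(1) \<mu>(1) K] tau_limit_lower_bound[OF comp(2) sub(2) \<mu>(2) K'])
  moreover have "ennreal (\<integral>x. K x \<partial>sample_law \<mu> n) + ennreal (\<integral>x. 1 - K x \<partial>sample_law \<mu> n) = 1"
  proof -
    have "0 \<le> (\<integral>x. K x \<partial>sample_law \<mu> n)" "0 \<le> (\<integral>x. 1 - K x \<partial>sample_law \<mu> n)"
      using K(2) by (auto intro!: integral_nonneg_AE)
    then show ?thesis
      using int prob_space by (simp add: ennreal_plus[symmetric] del: ennreal_plus)
  qed
  ultimately show "1 \<le> test_alpha Pr \<kappa> \<Theta>0 n K + test_beta Pr \<kappa> \<Theta>1 n K" by simp
qed

end

section \<open>Distinguishability of Poisson mean measures\<close>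

theorem theorem2p10:
  fixes Pr :: "'a::t2_space measure \<Rightarrow> 's measure"
    and \<kappa> :: "nat \<Rightarrow> 's \<Rightarrow> 'a measure"
    and \<Theta>0 \<Theta>1 :: "'a measure set"
  assumes "poisson_sampling Pr \<kappa>"
    and "\<Theta>0 \<subseteq> finite_measures" and "\<Theta>1 \<subseteq> finite_measures"
  shows
    \<comment> \<open>(a)(i)\<close>
    "(Polish_topology (euclidean :: 'a topology) \<and>
      relatively_compact_in tau_topology \<Theta>0 \<and> relatively_compact_in tau_topology \<Theta>1 \<and>
      weak_topology closure_of \<Theta>0 \<inter> weak_topology closure_of \<Theta>1 \<noteq> {} \<longrightarrow>
        indistinguishable Pr \<kappa> \<Theta>0 \<Theta>1)
     \<and>
     \<comment> \<open>(a)(ii)\<close>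
     (Polish_topology (euclidean :: 'a topology) \<and>
      (relatively_compact_in weak_topology \<Theta>0 \<or> relatively_compact_in weak_topology \<Theta>1) \<and>
      weak_topology closure_of \<Theta>0 \<inter> weak_topology closure_of \<Theta>1 = {} \<longrightarrow>
        distinguishable Pr \<kappa> \<Theta>0 \<Theta>1 \<and>
        (\<exists>K (c::real) (n0::nat). (\<forall>n. is_test n (K n)) \<and> c > 0 \<and>
           (\<forall>n>n0. test_alpha Pr \<kappa> \<Theta>0 n (K n) \<le> ennreal (exp (- c * real n)) \<and>
                   test_beta Pr \<kappa> \<Theta>1 n (K n) \<le> ennreal (exp (- c * real n)))))
     \<and>
     \<comment> \<open>(b)\<close>
     (Polish_topology (euclidean :: 'a topology) \<and>
      (relatively_compact_in weak_topology \<Theta>0 \<or> relatively_compact_in weak_topology \<Theta>1) \<and>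
      weak_topology closure_of \<Theta>0 \<inter> weak_topology closure_of \<Theta>1 = {} \<longrightarrow>
        (\<exists>(k::nat) (B :: nat \<Rightarrow> 'a set). k \<ge> 1 \<and> (\<forall>i<k. open (B i)) \<and>
           Euclidean_space k closure_of (measure_vector k B ` \<Theta>0) \<inter>
           Euclidean_space k closure_of (measure_vector k B ` \<Theta>1) = {}))
     \<and>
     \<comment> \<open>(c)\<close>
     (distinguishable Pr \<kappa> \<Theta>0 \<Theta>1 \<longrightarrow>
        uniformly_discernible Pr \<kappa> \<Theta>0 \<Theta>1 \<and>
        (\<exists>K N (t::real) (C::real). uniformly_discerns_with Pr \<kappa> K N \<Theta>0 \<Theta>1 \<and> t > 0 \<and>
           (SUP \<mu>\<in>\<Theta>0 \<union> \<Theta>1. \<integral>\<^sup>+s. ennreal (exp (t * N (sample_path \<kappa> s))) \<partial>Pr \<mu>) < ennreal C))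
     \<and>
     \<comment> \<open>(d)\<close>
     (Polish_topology (euclidean :: 'a topology) \<and> relatively_compact_in weak_topology \<Theta>0 \<longrightarrow>
        uniformly_asymptotically_discernible Pr \<kappa> \<Theta>0)"
proof -
  interpret poisson_model Pr \<kappa> by unfold_locales (fact assms(1))
  note sub = assms(2,3)
  have sep: "exponentially_separable \<Theta>0 \<Theta>1"
    if comp: "relatively_compact_in weak_topology \<Theta>0 \<or> relatively_compact_in weak_topology \<Theta>1"
      and disj: "weak_topology closure_of \<Theta>0 \<inter> weak_topology closure_of \<Theta>1 = {}"
    using comp
  proof
    assume "relatively_compact_in weak_topology \<Theta>0"
    then show ?thesis using disj by (rule compact_imp_exponentially_separable[OF sub])
  next
    assume "relatively_compact_in weak_topology \<Theta>1"
    moreover have "weak_topology closure_of \<Theta>1 \<inter> weak_topology closure_of \<Theta>0 = {}" using disj by blast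
    ultimately show ?thesis
      by (intro exponentially_separable_swap[OF compact_imp_exponentially_separable[OF sub(2,1)]])
  qed
  show ?thesis
  proof (intro conjI impI; (elim conjE)?)
    assume polish: "Polish_topology (euclidean :: 'a topology)"
      and comp: "relatively_compact_in tau_topology \<Theta>0" "relatively_compact_in tau_topology \<Theta>1"
      and meet: "weak_topology closure_of \<Theta>0 \<inter> weak_topology closure_of \<Theta>1 \<noteq> {}"
    have closure: "weak_topology closure_of \<Theta> \<subseteq> tau_topology closure_of \<Theta>"
      if "relatively_compact_in tau_topology \<Theta>" "\<Theta> \<subseteq> finite_measures" for \<Theta> :: "'a measure set"
      using that closure_of_subset[of \<Theta> tau_topology]
      by (intro weak_closure_in_tau_compact[OF polish]) (simp_all add: relatively_compact_in_def)
    from meet obtain \<mu> where "\<mu> \<in> tau_topology closure_of \<Theta>0" "\<mu> \<in> tau_topology closure_of \<Theta>1"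
      using closure[OF comp(1) sub(1)] closure[OF comp(2) sub(2)] by blast
    then show "indistinguishable Pr \<kappa> \<Theta>0 \<Theta>1"
      by (rule common_tau_limit_indistinguishable[OF sub comp])
  next
    assume comp: "relatively_compact_in weak_topology \<Theta>0 \<or> relatively_compact_in weak_topology \<Theta>1"
      and disj: "weak_topology closure_of \<Theta>0 \<inter> weak_topology closure_of \<Theta>1 = {}"
    show "distinguishable Pr \<kappa> \<Theta>0 \<Theta>1"
      by (rule exponentially_separable_imp_tests(1)[OF sep[OF comp disj] sub])
  next
    assume comp: "relatively_compact_in weak_topology \<Theta>0 \<or> relatively_compact_in weak_topology \<Theta>1"
      and disj: "weak_topology closure_of \<Theta>0 \<inter> weak_topology closure_of \<Theta>1 = {}"
    show "\<exists>K (c::real) (n0::nat). (\<forall>n. is_test n (K n)) \<and> c > 0 \<and>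
           (\<forall>n>n0. test_alpha Pr \<kappa> \<Theta>0 n (K n) \<le> ennreal (exp (- c * real n)) \<and>
                   test_beta Pr \<kappa> \<Theta>1 n (K n) \<le> ennreal (exp (- c * real n)))"
      by (rule exponentially_separable_imp_tests(2)[OF sep[OF comp disj] sub])
  next
    assume comp: "relatively_compact_in weak_topology \<Theta>0 \<or> relatively_compact_in weak_topology \<Theta>1"
      and disj: "weak_topology closure_of \<Theta>0 \<inter> weak_topology closure_of \<Theta>1 = {}"
    from comp show "\<exists>(k::nat) (B :: nat \<Rightarrow> 'a set). k \<ge> 1 \<and> (\<forall>i<k. open (B i)) \<and>
           Euclidean_space k closure_of (measure_vector k B ` \<Theta>0) \<inter>
           Euclidean_space k closure_of (measure_vector k B ` \<Theta>1) = {}"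
    proof
      assume "relatively_compact_in weak_topology \<Theta>0"
      then show ?thesis using disj by (rule open_sets_separating_closures[OF sub])
    next
      assume "relatively_compact_in weak_topology \<Theta>1"
      moreover have "weak_topology closure_of \<Theta>1 \<inter> weak_topology closure_of \<Theta>0 = {}" using disj by blast
      ultimately have "\<exists>(k::nat) (B :: nat \<Rightarrow> 'a set). k \<ge> 1 \<and> (\<forall>i<k. open (B i)) \<and>
           Euclidean_space k closure_of (measure_vector k B ` \<Theta>1) \<inter>
           Euclidean_space k closure_of (measure_vector k B ` \<Theta>0) = {}"
        by (rule open_sets_separating_closures[OF sub(2,1)])
      then show ?thesis by (simp only: Int_commute)
    qed
  next
    assume "distinguishable Pr \<kappa> \<Theta>0 \<Theta>1"
    then have "exponentially_separable \<Theta>0 \<Theta>1"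
      by (rule distinguishable_imp_exponentially_separable[OF sub])
    from exponentially_separable_discernible[OF sub this]
    show "\<exists>K N (t::real) (C::real). uniformly_discerns_with Pr \<kappa> K N \<Theta>0 \<Theta>1 \<and> t > 0 \<and>
           (SUP \<mu>\<in>\<Theta>0 \<union> \<Theta>1. \<integral>\<^sup>+s. ennreal (exp (t * N (sample_path \<kappa> s))) \<partial>Pr \<mu>) < ennreal C" .
    then show "uniformly_discernible Pr \<kappa> \<Theta>0 \<Theta>1"
      unfolding uniformly_discernible_def uniformly_discerns_def by blast
  next
    assume polish: "Polish_topology (euclidean :: 'a topology)"
      and comp: "relatively_compact_in weak_topology \<Theta>0"
    obtain f :: "nat \<Rightarrow> 'a \<Rightarrow> real" where "separating_functions f"
      using Polish_separating_functions[OF polish] by blast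
    then show "uniformly_asymptotically_discernible Pr \<kappa> \<Theta>0"
      by (rule compact_asymptotically_discernible[OF _ sub(1) comp])
  qed
qed

end
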